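(* Assume that $\omega\subset\mathbb{R}^2$ is open, bounded, simply connected and has $\mathcal{C}^{1,1}$-regular boundary. Let $\alpha\in(0,4)$ and $\gamma>0$. Then the following holds: (i) If $\alpha\in[4/7,4)$ and $5\alpha/6+2/3>2+\gamma$, then $\inf I^h\leq Ch^{2+\gamma}$. (ii) If $\alpha\in[4/7,4)$ and $5\alpha/6+2/3\leq2+\gamma$, then $\inf I^h\leq Ch^{\delta}$ for every $\delta\in(0,5\alpha/6+2/3)$. (iii) If $\alpha\in(0,4/7)$, then $\inf I^h\leq Ch^{2\alpha}$. When $B=0$, then: $\inf I^h\leq Ch^\delta$ for every $\delta\in(0,5\alpha/6+2/3)$ if $\alpha\in[4/7,4)$, and $\inf I^h\leq Ch^{2\alpha}$ if $\alpha\in(0,4/7)$.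
   Context: Points are written $x=(x',x_3)$, $x'\in\omega$; $\Omega^h=\omega\times(-\frac h2,\frac h2)$. Let $S,B:\bar\omega\to\mathbb{R}^{3\times3}_{sym}$ be smooth and $A^h(x',x_3)=Id_3+h^{\alpha/2}S(x')+h^{\gamma/2}x_3B(x')$ on $\Omega^h$. Only small $h>0$ (for which $A^h$ is invertible) are considered. Define $$I^h(u^h)=\frac1h\int_{\Omega^h}W\big((\nabla u^h)(A^h)^{-1}\big)\,\mathrm{d}x,\qquad u^h\in W^{1,2}(\Omega^h,\mathbb{R}^3),$$ and $\inf I^h$ is the infimum over $W^{1,2}(\Omega^h,\mathbb{R}^3)$. Here $W:\mathbb{R}^{3\times3}\to\mathbb{R}$ is Borel measurable, $\mathcal{C}^2$ in a neighborhood of $SO(3)$, and for all $F\in\mathbb{R}^{3\times3}$, $R\in SO(3)$: $W(R)=0$, $W(RF)=W(F)$, $W(F)\geq c\,\mathrm{dist}^2(F,SO(3))$ with $c>0$. The constants $C$ are independent of $h$ (they may depend on $\delta$), and the bounds are for all sufficiently small $h$. *)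

theory Defs
  imports "HOL-Analysis.Analysis"
begin

text \<open>Classes \<open>C\<^sup>k\<close> and \<open>C\<^sup>\<infinity>\<close>. These are meant for open sets \<open>U\<close>.\<close>

primrec Ck_on :: "nat \<Rightarrow> 'a::euclidean_space set \<Rightarrow> ('a \<Rightarrow> 'b::real_normed_vector) \<Rightarrow> bool" where
  "Ck_on 0 U f \<longleftrightarrow> continuous_on U f"
| "Ck_on (Suc k) U f \<longleftrightarrow>
     (\<forall>x\<in>U. f differentiable (at x)) \<and>
     (\<forall>b\<in>Basis. Ck_on k U (\<lambda>x. frechet_derivative f (at x) b))"

definition smooth_on :: "'a::euclidean_space set \<Rightarrow> ('a \<Rightarrow> 'b::real_normed_vector) \<Rightarrow> bool" where
  "smooth_on U f \<longleftrightarrow> (\<forall>k. Ck_on k U f)"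

text \<open>Smoothness on a set that need not be open, such as the closure of a domain: the function is
  the restriction of a smooth function defined on an open neighbourhood.\<close>

definition smooth_up_to :: "'a::euclidean_space set \<Rightarrow> ('a \<Rightarrow> 'b::real_normed_vector) \<Rightarrow> bool" where
  "smooth_up_to K f \<longleftrightarrow>
     (\<exists>U g. open U \<and> K \<subseteq> U \<and> smooth_on U g \<and> (\<forall>x\<in>K. f x = g x))"

text \<open>Near each boundary point the set is, in suitable orthonormal coordinates, the part of a ball
  lying strictly above the graph of a function with Lipschitz derivative.\<close>

definition C11_boundary :: "(real^2) set \<Rightarrow> bool" where
  "C11_boundary \<omega> \<longleftrightarrow>
     (\<forall>p\<in>frontier \<omega>. \<exists>r>0. \<exists>(Q :: real^2 \<Rightarrow> real^2) (g :: real \<Rightarrow> real).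
        orthogonal_transformation Q \<and>
        (\<forall>t. g differentiable (at t)) \<and> (\<exists>L. L-lipschitz_on UNIV (deriv g)) \<and>
        \<omega> \<inter> ball p r = {x \<in> ball p r. g (Q x $ 1) < Q x $ 2})"

definition test_function :: "(real^'n) set \<Rightarrow> (real^'n \<Rightarrow> real) \<Rightarrow> bool" where
  "test_function \<Omega> \<phi> \<longleftrightarrow>
     smooth_on UNIV \<phi> \<and> compact (closure {x. \<phi> x \<noteq> 0}) \<and> closure {x. \<phi> x \<noteq> 0} \<subseteq> \<Omega>"

definition L2_on :: "(real^'n) set \<Rightarrow> (real^'n \<Rightarrow> 'b::euclidean_space) set" where
  "L2_on \<Omega> = {f. f \<in> borel_measurable (lebesgue_on \<Omega>) \<and>
                 integrable (lebesgue_on \<Omega>) (\<lambda>x. (norm (f x))\<^sup>2)}"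

text \<open>The entry \<open>G x $ i $ j\<close> is the weak derivative of the \<open>i\<close>-th component of \<open>u\<close>
  in direction \<open>j\<close>.\<close>

definition has_L2_weak_gradient ::
    "(real^'n) set \<Rightarrow> (real^'n \<Rightarrow> real^'m) \<Rightarrow> (real^'n \<Rightarrow> real^'n^'m) \<Rightarrow> bool" where
  "has_L2_weak_gradient \<Omega> u G \<longleftrightarrow>
     G \<in> L2_on \<Omega> \<and>
     (\<forall>\<phi> i j. test_function \<Omega> \<phi> \<longrightarrow>
        (LINT x|lebesgue_on \<Omega>. u x $ i * frechet_derivative \<phi> (at x) (axis j 1)) =
        - (LINT x|lebesgue_on \<Omega>. G x $ i $ j * \<phi> x))"

definition W12 :: "(real^'n) set \<Rightarrow> (real^'n \<Rightarrow> real^'m) set" where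
  "W12 \<Omega> = {u \<in> L2_on \<Omega>. \<exists>G. has_L2_weak_gradient \<Omega> u G}"

text \<open>A representative; weak gradients are unique up to null sets.\<close>

definition weak_gradient :: "(real^'n) set \<Rightarrow> (real^'n \<Rightarrow> real^'m) \<Rightarrow> real^'n \<Rightarrow> real^'n^'m" where
  "weak_gradient \<Omega> u = (SOME G. has_L2_weak_gradient \<Omega> u G)"

definition planar :: "real^3 \<Rightarrow> real^2" where
  "planar x = vector [x $ 1, x $ 2]"

definition thin_plate :: "(real^2) set \<Rightarrow> real \<Rightarrow> (real^3) set" where
  "thin_plate \<omega> h = {x. planar x \<in> \<omega> \<and> - h / 2 < x $ 3 \<and> x $ 3 < h / 2}"

definition prestrain ::
    "real \<Rightarrow> real \<Rightarrow> (real^2 \<Rightarrow> real^3^3) \<Rightarrow> (real^2 \<Rightarrow> real^3^3) \<Rightarrow> real \<Rightarrow> real^3 \<Rightarrow> real^3^3" where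
  "prestrain \<alpha> \<gamma> S B h x =
     mat 1 + (h powr (\<alpha> / 2)) *\<^sub>R S (planar x) + (h powr (\<gamma> / 2) * x $ 3) *\<^sub>R B (planar x)"

definition SO3 :: "(real^3^3) set" where
  "SO3 = {R. rotation_matrix R}"

text \<open>The norm of \<open>real^3^3\<close>, hence the distance in the coercivity bound, is the Frobenius one.\<close>

definition admissible_density :: "(real^3^3 \<Rightarrow> real) \<Rightarrow> bool" where
  "admissible_density W \<longleftrightarrow>
     W \<in> borel_measurable borel \<and>
     (\<exists>U. open U \<and> SO3 \<subseteq> U \<and> Ck_on 2 U W) \<and>
     (\<forall>R\<in>SO3. W R = 0) \<and>
     (\<forall>F. \<forall>R\<in>SO3. W (R ** F) = W F) \<and>
     (\<exists>c>0. \<forall>F. W F \<ge> c * (infdist F SO3)\<^sup>2)"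

text \<open>An admissible density is nonnegative but need not be bounded above by a quadratic, so the
  energy takes values in \<open>[0, \<infinity>]\<close>.\<close>

definition energy ::
    "(real^3^3 \<Rightarrow> real) \<Rightarrow> (real^2) set \<Rightarrow> real \<Rightarrow> real \<Rightarrow> (real^2 \<Rightarrow> real^3^3) \<Rightarrow> (real^2 \<Rightarrow> real^3^3) \<Rightarrow>
     real \<Rightarrow> (real^3 \<Rightarrow> real^3) \<Rightarrow> ennreal" where
  "energy W \<omega> \<alpha> \<gamma> S B h u =
     ennreal (1 / h) *
     (\<integral>\<^sup>+ x. ennreal (W (weak_gradient (thin_plate \<omega> h) u x ** matrix_inv (prestrain \<alpha> \<gamma> S B h x)))
        \<partial>lebesgue_on (thin_plate \<omega> h))"

definition inf_energy ::
    "(real^3^3 \<Rightarrow> real) \<Rightarrow> (real^2) set \<Rightarrow> real \<Rightarrow> real \<Rightarrow> (real^2 \<Rightarrow> real^3^3) \<Rightarrow> (real^2 \<Rightarrow> real^3^3) \<Rightarrow>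
     real \<Rightarrow> ennreal" where
  "inf_energy W \<omega> \<alpha> \<gamma> S B h = (INF u\<in>W12 (thin_plate \<omega> h). energy W \<omega> \<alpha> \<gamma> S B h u)"

definition scaling_bound :: "(real \<Rightarrow> ennreal) \<Rightarrow> real \<Rightarrow> bool" where
  "scaling_bound E \<beta> \<longleftrightarrow> (\<exists>C>0. \<forall>\<^sub>F h in at_right 0. E h \<le> ennreal (C * h powr \<beta>))"

end

theory Submission
  imports Defs
begin

text \<open>A single explicit corrugated ansatz gives the bound; neither the iteration of convex integration
  nor any elliptic equation is needed. Extend \<open>S\<close> smoothly to the plane. The off-diagonal entry of the
  tangential part of \<open>S\<close> is absorbed by the in-plane displacement
  \<open>\<kappa>(x) = 2 \<integral>\<^sub>0\<^sup>x\<^sub>1 S\<^sub>1\<^sub>2(t, x\<^sub>2) dt\<close>, and what is left plus \<open>c Id\<close> equals \<open>a\<^sup>2 e\<^sub>1 \<otimes> e\<^sub>1 + b\<^sup>2 e\<^sub>2 \<otimes> e\<^sub>2\<close>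
  for a large constant \<open>c\<close>. Two corrugations, in direction \<open>e\<^sub>1\<close> with frequency \<open>N\<close> and in direction
  \<open>e\<^sub>2\<close> with frequency \<open>N\<^sup>2\<close>, then produce displacements \<open>(w, v)\<close> with
  \<open>sym \<nabla>w + \<nabla>v \<otimes> \<nabla>v / 2 = S + O(1/N)\<close> and second derivatives \<open>O(N\<^sup>2)\<close>. Scaling \<open>v\<close> by
  \<open>\<epsilon> = h\<^bsup>\<alpha>/4\<^esup>\<close> and \<open>w\<close> by \<open>\<epsilon>\<^sup>2\<close>, and extending linearly in \<open>x\<^sub>3\<close> along a director that realises the entries
  \<open>S\<^sub>i\<^sub>3\<close>, the strain misses \<open>(A\<^sup>h)\<^sup>2\<close> by \<open>O(\<epsilon>\<^sup>2/N + \<epsilon>\<^sup>4 + h \<epsilon> N\<^sup>2 + h\<^bsup>1+\<gamma>/2\<^esup>)\<close>. The first and the third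
  term balance for \<open>N = h\<^bsup>-(4-\<alpha>)/12\<^esup>\<close>, where their squares are \<open>h\<^bsup>5\<alpha>/6+2/3\<^esup>\<close>.\<close>

section \<open>\<open>C\<^sup>k\<close> functions and smooth cutoffs\<close>

text \<open>Different frequencies are forced by the cross term of the two corrugations in the
  product of the first derivatives of \<open>v\<close>, which has order one. The displacement that
  cancels it oscillates with frequency \<open>N\<close> in \<open>x\<^sub>1\<close> and
  \<open>N^2\<close> in \<open>x\<^sub>2\<close>; with amplitude \<open>N^(-2)\<close> its second
  partial derivative has order one, while its first is \<open>O(1/N)\<close> and can join the error.
  Equal frequencies would leave an error of order one. Since \<open>W\<close> is controlled from
  above only near the rotations, a bound of the strain in the mean would not suffice: all estimates
  are uniform in \<open>x\<close>, and the gradient has to be uniformly close to the identity before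
  its strain can be inserted. The energy is evaluated at a chosen representative of the weak
  gradient. A classical formula can replace it only through uniqueness of weak gradients, which
  rests on smooth cutoffs.\<close>

lemma Ck_on_cong:
  assumes "open U" "\<And>x. x \<in> U \<Longrightarrow> f x = g x"
  shows "Ck_on k U f \<longleftrightarrow> Ck_on k U g"
proof -
  have *: "Ck_on k U g" if "Ck_on k U f" "\<And>x. x \<in> U \<Longrightarrow> f x = g x" for f g :: "'a \<Rightarrow> 'b"
    using that
  proof (induction k arbitrary: f g)
    case 0
    then show ?case by (auto cong: continuous_on_cong)
  next
    case (Suc k)
    have D: "(g has_derivative frechet_derivative f (at x)) (at x)" if x: "x \<in> U" for x
    proof (rule has_derivative_transform_within_open)
      show "(f has_derivative frechet_derivative f (at x)) (at x)"
        using Suc.prems(1) x frechet_derivative_works by auto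
    qed (use assms(1) x Suc.prems(2) in auto)
    have eq: "frechet_derivative g (at x) = frechet_derivative f (at x)" if "x \<in> U" for x
      using frechet_derivative_at[OF D[OF that]] by simp
    have "Ck_on k U (\<lambda>x. frechet_derivative g (at x) b)" if "b \<in> Basis" for b
      by (rule Suc.IH[of "\<lambda>x. frechet_derivative f (at x) b"]) (use Suc.prems(1) that eq in auto)
    then show ?case
      using D unfolding Ck_on.simps differentiable_def by blast
  qed
  show ?thesis using *[of f g] *[of g f] assms(2) by metis
qed

lemma Ck_on_SucI:
  assumes "open U" "\<And>x. x \<in> U \<Longrightarrow> (f has_derivative D x) (at x)"
    and "\<And>b. b \<in> Basis \<Longrightarrow> Ck_on k U (\<lambda>x. D x b)"
  shows "Ck_on (Suc k) U f"
proof -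
  have "frechet_derivative f (at x) = D x" if "x \<in> U" for x
    using frechet_derivative_at[OF assms(2)[OF that]] by simp
  then have "Ck_on k U (\<lambda>x. frechet_derivative f (at x) b)" if "b \<in> Basis" for b
    using Ck_on_cong[OF assms(1), of "\<lambda>x. frechet_derivative f (at x) b" "\<lambda>x. D x b"] assms(3) that
    by simp
  then show ?thesis
    using assms(2) by (auto simp: differentiable_def)
qed

lemma Ck_on_SucE:
  assumes "Ck_on (Suc k) U f"
  obtains D where "\<And>x. x \<in> U \<Longrightarrow> (f has_derivative D x) (at x)"
    and "\<And>b. b \<in> Basis \<Longrightarrow> Ck_on k U (\<lambda>x. D x b)"
  using assms frechet_derivative_works by (metis Ck_on.simps(2))

lemma Ck_on_imp_continuous_on: "Ck_on k U f \<Longrightarrow> continuous_on U f"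
  by (cases k) (auto intro!: continuous_at_imp_continuous_on differentiable_imp_continuous_within)

lemma Ck_on_Suc_imp: "Ck_on (Suc k) U f \<Longrightarrow> Ck_on k U f"
proof (induction k arbitrary: f)
  case 0
  then show ?case using Ck_on_imp_continuous_on by (metis Ck_on.simps(1))
qed auto

lemma Ck_on_mono: "Ck_on k U f \<Longrightarrow> j \<le> k \<Longrightarrow> Ck_on j U f"
  by (rotate_tac, induction rule: inc_induct) (blast intro: Ck_on_Suc_imp)+

lemma Ck_on_subset: "Ck_on k U f \<Longrightarrow> V \<subseteq> U \<Longrightarrow> Ck_on k V f"
  by (induction k arbitrary: f) (auto intro: continuous_on_subset)

lemma Ck_on_Un:
  assumes "open U" "open V" "Ck_on k U f" "Ck_on k V f"
  shows "Ck_on k (U \<union> V) f"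
  using assms(3,4) by (induction k arbitrary: f) (auto intro: continuous_on_open_Un assms)

lemma Ck_on_const [intro]: "open U \<Longrightarrow> Ck_on k U (\<lambda>x. c)"
proof (induction k arbitrary: c)
  case (Suc k)
  then show ?case by (intro Ck_on_SucI[of _ _ "\<lambda>x v. 0"]) auto
qed auto

lemma Ck_on_bounded_linear:
  assumes "open U" "bounded_linear L" "Ck_on k U f"
  shows "Ck_on k U (\<lambda>x. L (f x))"
  using assms(3)
proof (induction k arbitrary: f)
  case 0
  then show ?case using bounded_linear.continuous_on[OF assms(2)] by auto
next
  case (Suc k)
  from Suc.prems obtain D where D: "\<And>x. x \<in> U \<Longrightarrow> (f has_derivative D x) (at x)"
    "\<And>b. b \<in> Basis \<Longrightarrow> Ck_on k U (\<lambda>x. D x b)" by (rule Ck_on_SucE) blast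
  show ?case
    by (rule Ck_on_SucI[of _ _ "\<lambda>x v. L (D x v)"])
      (use assms(1) D Suc.IH bounded_linear.has_derivative[OF assms(2) D(1)] in auto)
qed

lemma Ck_on_linear:
  assumes "open U" "bounded_linear L"
  shows "Ck_on k U L"
proof (cases k)
  case 0
  then show ?thesis using assms(2) by (simp add: linear_continuous_on)
next
  case (Suc j)
  show ?thesis unfolding Suc
    by (rule Ck_on_SucI[of _ _ "\<lambda>x. L"]) (use assms bounded_linear_imp_has_derivative in auto)
qed

lemma Ck_on_add:
  assumes "open U" "Ck_on k U f" "Ck_on k U g"
  shows "Ck_on k U (\<lambda>x. f x + g x)"
  using assms(2,3)
proof (induction k arbitrary: f g)
  case 0
  then show ?case by (auto intro: continuous_intros)
next
  case (Suc k)
  from Suc.prems(1) obtain D where D: "\<And>x. x \<in> U \<Longrightarrow> (f has_derivative D x) (at x)"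
    "\<And>b. b \<in> Basis \<Longrightarrow> Ck_on k U (\<lambda>x. D x b)" by (rule Ck_on_SucE) blast
  from Suc.prems(2) obtain E where E: "\<And>x. x \<in> U \<Longrightarrow> (g has_derivative E x) (at x)"
    "\<And>b. b \<in> Basis \<Longrightarrow> Ck_on k U (\<lambda>x. E x b)" by (rule Ck_on_SucE) blast
  show ?case
    by (rule Ck_on_SucI[of _ _ "\<lambda>x v. D x v + E x v"])
      (use assms D E Suc.IH has_derivative_add in auto)
qed

lemma Ck_on_mult:
  fixes f g :: "'a::euclidean_space \<Rightarrow> real"
  assumes "open U" "Ck_on k U f" "Ck_on k U g"
  shows "Ck_on k U (\<lambda>x. f x * g x)"
  using assms(2,3)
proof (induction k arbitrary: f g)
  case 0
  then show ?case by (auto intro: continuous_intros)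
next
  case (Suc k)
  note fg = Suc.prems[THEN Ck_on_Suc_imp]
  from Suc.prems(1) obtain D where D: "\<And>x. x \<in> U \<Longrightarrow> (f has_derivative D x) (at x)"
    "\<And>b. b \<in> Basis \<Longrightarrow> Ck_on k U (\<lambda>x. D x b)" by (rule Ck_on_SucE) blast
  from Suc.prems(2) obtain E where E: "\<And>x. x \<in> U \<Longrightarrow> (g has_derivative E x) (at x)"
    "\<And>b. b \<in> Basis \<Longrightarrow> Ck_on k U (\<lambda>x. E x b)" by (rule Ck_on_SucE) blast
  show ?case
    by (rule Ck_on_SucI[of _ _ "\<lambda>x v. f x * E x v + D x v * g x"])
      (use assms D E fg Suc.IH in \<open>auto intro!: Ck_on_add has_derivative_mult\<close>)
qed

lemma Ck_on_cmult:
  fixes f :: "'a::euclidean_space \<Rightarrow> real"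
  shows "open U \<Longrightarrow> Ck_on k U f \<Longrightarrow> Ck_on k U (\<lambda>x. c * f x)"
  by (intro Ck_on_mult Ck_on_const)

lemma Ck_on_diff:
  fixes f g :: "'a::euclidean_space \<Rightarrow> real"
  assumes "open U" "Ck_on k U f" "Ck_on k U g"
  shows "Ck_on k U (\<lambda>x. f x - g x)"
  using Ck_on_add[OF assms(1,2) Ck_on_cmult[OF assms(1,3), of "-1"]] by simp

lemma Ck_on_sum:
  assumes "open U" "finite I" "\<And>i. i \<in> I \<Longrightarrow> Ck_on k U (f i)"
  shows "Ck_on k U (\<lambda>x. \<Sum>i\<in>I. f i x)"
  using assms(2,3) by (induction I rule: finite_induct) (auto intro: Ck_on_add assms(1))

text \<open>Only the outer function varies in the induction: the derivative of the composition is
  the derivative of \<open>f\<close> times \<open>D (f x) 1\<close>, and the latter is again a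
  composition with the same \<open>f\<close>, of one order less.\<close>

lemma Ck_on_compose:
  fixes f :: "'a::euclidean_space \<Rightarrow> real" and h :: "real \<Rightarrow> real"
  assumes "open U" "open V" "Ck_on k V h" "Ck_on k U f" "f ` U \<subseteq> V"
  shows "Ck_on k U (\<lambda>x. h (f x))"
  using assms(3,4)
proof (induction k arbitrary: h)
  case 0
  then show ?case using assms(5) by (auto intro: continuous_on_compose2)
next
  case (Suc k)
  from Suc.prems(1) obtain D where D: "\<And>x. x \<in> V \<Longrightarrow> (h has_derivative D x) (at x)"
    "\<And>b. b \<in> Basis \<Longrightarrow> Ck_on k V (\<lambda>x. D x b)" by (rule Ck_on_SucE) blast
  from Suc.prems(2) obtain E where E: "\<And>x. x \<in> U \<Longrightarrow> (f has_derivative E x) (at x)"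
    "\<And>b. b \<in> Basis \<Longrightarrow> Ck_on k U (\<lambda>x. E x b)" by (rule Ck_on_SucE) blast
  have der: "((\<lambda>x. h (f x)) has_derivative (\<lambda>v. E x v * D (f x) 1)) (at x)" if "x \<in> U" for x
  proof -
    have Df: "(h has_derivative D (f x)) (at (f x))" using D(1) that assms(5) by auto
    have "D (f x) = (\<lambda>t. t * D (f x) 1)"
    proof
      fix t show "D (f x) t = t * D (f x) 1"
        using linear_cmul[OF has_derivative_linear[OF Df], of t 1] by (simp only: real_scaleR_def mult_1_right)
    qed
    then have "(\<lambda>v. D (f x) (E x v)) = (\<lambda>v. E x v * D (f x) 1)"
      by (rule arg_cong)
    then show ?thesis using has_derivative_compose[OF E(1)[OF that] Df] by simp
  qed
  show ?case
    by (rule Ck_on_SucI[OF assms(1) der])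
      (use assms D E Suc.IH Ck_on_Suc_imp[OF Suc.prems(2)] in \<open>auto intro!: Ck_on_mult\<close>)
qed

text \<open>Differentiation maps the span of these functions into itself, which makes them smooth.\<close>

definition flat :: "nat \<Rightarrow> real \<Rightarrow> real" where
  "flat m t = (if t \<le> 0 then 0 else (1/t) ^ m * exp (- (1/t)))"

text \<open>Only the difference quotients at \<open>0\<close> need an argument: from the left they
  vanish identically, from the right they are a power times a decaying exponential.\<close>

lemma flat_has_derivative:
  "(flat m has_real_derivative flat (m + 2) t - real m * flat (m + 1) t) (at t)"
proof -
  consider "t < 0" | "t > 0" | "t = 0" by linarith
  then show ?thesis
  proof cases
    case 1
    have "((\<lambda>_. 0) has_real_derivative 0) (at t)" by simp
    then have "(flat m has_real_derivative 0) (at t)"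
      by (rule has_field_derivative_transform_within_open[where S="{..<0}"])
        (use 1 in \<open>auto simp: flat_def\<close>)
    then show ?thesis using 1 by (simp add: flat_def)
  next
    case 2
    have "((\<lambda>t. (1/t) ^ m) has_real_derivative - real m * (1/t) ^ (m + 1)) (at t)"
    proof -
      have "((\<lambda>t. 1/t) has_real_derivative - ((1/t)\<^sup>2)) (at t)"
        using 2 by (auto intro!: derivative_eq_intros simp: power2_eq_square)
      from DERIV_power[OF this, of m] show ?thesis
        by (cases m) (simp_all add: power2_eq_square algebra_simps add_divide_distrib diff_divide_distrib)
    qed
    moreover have "((\<lambda>t. exp (- (1/t))) has_real_derivative (1/t)\<^sup>2 * exp (- (1/t))) (at t)"
      using 2 by (auto intro!: derivative_eq_intros simp: power2_eq_square)
    ultimately have "((\<lambda>t. (1/t) ^ m * exp (- (1/t))) has_real_derivative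
        flat (m + 2) t - real m * flat (m + 1) t) (at t)"
      by (rule DERIV_cong[OF DERIV_mult]) (use 2 in \<open>simp add: flat_def power_add power2_eq_square algebra_simps\<close>)
    then show ?thesis
      by (rule has_field_derivative_transform_within_open[where S="{0<..}"])
        (use 2 in \<open>auto simp: flat_def\<close>)
  next
    case 3
    \<comment> \<open>Dividing \<open>flat m y\<close> by \<open>y\<close> raises the power to
      \<open>m + 1\<close>; with \<open>z = 1/y\<close> the quotient is
      \<open>z ^ (m + 1) / exp z\<close> as \<open>z\<close> tends to infinity.\<close>
    have "((\<lambda>y::real. (1/y) ^ (m + 1) * exp (- (1/y))) \<longlongrightarrow> 0) (at_right 0)"
    proof -
      have "((\<lambda>z::real. z ^ (m + 1) / exp z) \<longlongrightarrow> 0) at_top"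
        by (rule tendsto_power_div_exp_0)
      moreover have "filterlim (\<lambda>y::real. 1 / y) at_top (at_right 0)"
        using filterlim_inverse_at_top_right by (simp add: inverse_eq_divide)
      ultimately have "((\<lambda>y::real. (1/y) ^ (m + 1) / exp (1/y)) \<longlongrightarrow> 0) (at_right 0)"
        by (rule filterlim_compose)
      then show ?thesis by (simp add: exp_minus inverse_eq_divide)
    qed
    then have "((\<lambda>y. flat m y / y) \<longlongrightarrow> 0) (at_right 0)"
      by (rule Lim_transform_eventually)
        (auto simp: flat_def eventually_at_right_field field_simps intro!: exI[of _ 1])
    moreover have "((\<lambda>y. flat m y / y) \<longlongrightarrow> 0) (at_left 0)"
      by (rule Lim_transform_eventually[of "\<lambda>_. 0"])
        (auto simp: flat_def eventually_at_left_field intro!: exI[of _ "-1"])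
    ultimately have "((\<lambda>y. flat m y / y) \<longlongrightarrow> 0) (at 0)"
      by (simp add: filterlim_split_at)
    then show ?thesis using 3 by (simp add: has_field_derivative_iff flat_def)
  qed
qed

lemma Ck_on_flat: "Ck_on k UNIV (flat m)"
proof (induction k arbitrary: m)
  case 0
  show ?case unfolding Ck_on.simps
    by (rule DERIV_continuous_on[of _ _ "\<lambda>t. flat (m + 2) t - real m * flat (m + 1) t"])
      (use flat_has_derivative has_field_derivative_at_within in blast)
next
  case (Suc k)
  show ?case
    by (rule Ck_on_SucI[of _ _ "\<lambda>t v. (flat (m + 2) t - real m * flat (m + 1) t) * v"])
      (use flat_has_derivative in \<open>auto simp: has_field_derivative_def intro!: Ck_on_diff Ck_on_cmult Suc.IH\<close>)
qed

lemma flat_nonneg: "0 \<le> flat m t" and flat_pos_iff: "0 < flat m t \<longleftrightarrow> 0 < t"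
  by (auto simp: flat_def)

lemma flat_mono: "s \<le> t \<Longrightarrow> flat 0 s \<le> flat 0 t"
  by (auto simp: flat_def frac_le)

text \<open>Real powers are closed under differentiation up to constants, which square roots alone
  are not; the square root is recovered as the exponent \<open>1/2\<close>.\<close>

lemma Ck_on_powr: "Ck_on k {0<..} (\<lambda>t::real. t powr r)"
proof (induction k arbitrary: r)
  case 0
  show ?case by (auto intro!: continuous_intros)
next
  case (Suc k)
  show ?case
    by (rule Ck_on_SucI[of _ _ "\<lambda>t v. r * t powr (r - 1) * v"])
      (auto simp: has_field_derivative_def[symmetric] intro!: Ck_on_cmult Suc.IH has_real_derivative_powr)
qed

lemma Ck_on_sqrt:
  assumes "open U" "Ck_on k U f" "\<And>x. x \<in> U \<Longrightarrow> 0 < f x"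
  shows "Ck_on k U (\<lambda>x. sqrt (f x))"
proof -
  have "Ck_on k U (\<lambda>x. f x powr (1/2))"
    by (rule Ck_on_compose[OF assms(1) _ Ck_on_powr assms(2)]) (use assms(3) in auto)
  then show ?thesis
    using Ck_on_cong[OF assms(1), of "\<lambda>x. f x powr (1/2)" "\<lambda>x. sqrt (f x)"] assms(3)
    by (auto simp: powr_half_sqrt less_imp_le)
qed

text \<open>A sum \<open>F\<close> of radial bumps is positive on \<open>K\<close> and zero off
  finitely many balls inside \<open>U\<close>. Compactness gives \<open>F \<ge> e\<close> on
  \<open>K\<close>, and \<open>1 - flat 0 (e - F) / flat 0 e\<close> turns this into a function that
  is exactly \<open>1\<close> where \<open>F \<ge> e\<close> and exactly \<open>0\<close> where
  \<open>F = 0\<close>. The bumps use the squared distance, which is smooth at the centres.\<close>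

lemma smooth_cutoff:
  fixes K U :: "'a::euclidean_space set"
  assumes "compact K" "open U" "K \<subseteq> U"
  obtains \<eta> :: "'a \<Rightarrow> real" and K' where "\<And>k. Ck_on k UNIV \<eta>" "\<And>x. 0 \<le> \<eta> x" "\<And>x. \<eta> x \<le> 1"
    "\<And>x. x \<in> K \<Longrightarrow> \<eta> x = 1" "compact K'" "K' \<subseteq> U" "\<And>x. x \<notin> K' \<Longrightarrow> \<eta> x = 0"
proof -
  have "\<forall>x\<in>K. \<exists>r>0. cball x r \<subseteq> U"
    using assms open_contains_cball by blast
  then obtain r where r: "\<And>x. x \<in> K \<Longrightarrow> r x > 0" "\<And>x. x \<in> K \<Longrightarrow> cball x (r x) \<subseteq> U" by metis
  obtain I where I: "I \<subseteq> K" "finite I" "K \<subseteq> (\<Union>x\<in>I. ball x (r x))"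
    by (rule compactE_image[OF assms(1), of K "\<lambda>x. ball x (r x)"]) (use r in force)+
  define F where "F = (\<lambda>y. \<Sum>x\<in>I. flat 0 ((r x)\<^sup>2 - (y - x) \<bullet> (y - x)))"
  have CF: "Ck_on k UNIV F" for k
  proof -
    have inner: "Ck_on k UNIV (\<lambda>y. (y - x) \<bullet> (y - x))" for x :: 'a
    proof -
      have "(y - x) \<bullet> (y - x) = (\<Sum>b\<in>Basis. (y \<bullet> b - x \<bullet> b) * (y \<bullet> b - x \<bullet> b))" for y
        by (subst euclidean_inner) (simp add: inner_diff_left)
      moreover have "Ck_on k UNIV (\<lambda>y. y \<bullet> b)" for b :: 'a
        by (rule Ck_on_linear) (auto intro: bounded_linear_inner_left)
      then have "Ck_on k UNIV (\<lambda>y. \<Sum>b\<in>Basis. (y \<bullet> b - x \<bullet> b) * (y \<bullet> b - x \<bullet> b))"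
        by (intro Ck_on_sum Ck_on_mult Ck_on_diff Ck_on_const) auto
      ultimately show ?thesis by simp
    qed
    show ?thesis unfolding F_def
      by (intro Ck_on_sum I(2) Ck_on_compose[OF _ _ Ck_on_flat] Ck_on_diff inner) auto
  qed
  have F0: "F y \<ge> 0" for y by (auto simp: F_def intro!: sum_nonneg flat_nonneg)
  have Fpos: "F y > 0" if y: "y \<in> K" for y
  proof -
    obtain x where x: "x \<in> I" "dist x y < r x" using I(3) y by auto
    then have "(dist x y)\<^sup>2 < (r x)\<^sup>2" by (intro power_strict_mono) auto
    then have "(y - x) \<bullet> (y - x) < (r x)\<^sup>2" by (metis dist_commute dist_norm power2_norm_eq_inner)
    then have "flat 0 ((r x)\<^sup>2 - (y - x) \<bullet> (y - x)) > 0" by (simp add: flat_pos_iff)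
    then show ?thesis unfolding F_def by (intro sum_pos2[OF I(2) x(1)] flat_nonneg)
  qed
  obtain e where e: "e > 0" "\<And>y. y \<in> K \<Longrightarrow> e \<le> F y"
  proof (cases "K = {}")
    case True
    then show ?thesis using that[of 1] by auto
  next
    case False
    obtain z where "z \<in> K" "\<forall>y\<in>K. F z \<le> F y"
      using continuous_attains_inf[OF assms(1) False] Ck_on_imp_continuous_on[OF CF] continuous_on_subset
      by (metis subset_UNIV)
    then show ?thesis using that[of "F z"] Fpos by auto
  qed
  define K' where "K' = (\<Union>x\<in>I. cball x (r x))"
  define \<eta> where "\<eta> = (\<lambda>y. 1 - (1 / flat 0 e) * flat 0 (e - F y))"
  have e': "flat 0 e > 0" using e by (simp add: flat_pos_iff)
  show thesis
  proof
    show "Ck_on k UNIV \<eta>" for k unfolding \<eta>_def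
      by (intro Ck_on_diff Ck_on_cmult Ck_on_compose[OF _ _ Ck_on_flat] CF Ck_on_const) auto
    show "0 \<le> \<eta> x" for x
      using flat_mono[of "e - F x" e] F0[of x] e' by (simp add: \<eta>_def)
    show "\<eta> x \<le> 1" for x
      using flat_nonneg[of 0 "e - F x"] e' by (simp add: \<eta>_def)
    show "\<eta> x = 1" if "x \<in> K" for x
      using e(2)[OF that] by (simp add: \<eta>_def flat_def)
    show "compact K'" unfolding K'_def using I by auto
    show "K' \<subseteq> U" unfolding K'_def using I(1) r(2) by blast
    show "\<eta> x = 0" if "x \<notin> K'" for x
    proof -
      have "F x = 0" unfolding F_def
      proof (rule sum.neutral, rule ballI)
        fix y assume "y \<in> I"
        then have "r y < dist y x" "0 < r y" using that I r(1) by (auto simp: K'_def)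
        then have "(r y)\<^sup>2 < (dist y x)\<^sup>2" by (intro power_strict_mono) auto
        then show "flat 0 ((r y)\<^sup>2 - (x - y) \<bullet> (x - y)) = 0"
          by (simp add: flat_def dist_norm norm_minus_commute power2_norm_eq_inner)
      qed
      then show ?thesis using e' by (simp add: \<eta>_def)
    qed
  qed
qed

section \<open>Energy densities near the identity\<close>

lemma norm_matrix_sq: "(norm (A :: real^'n^'m))\<^sup>2 = (\<Sum>i\<in>UNIV. \<Sum>j\<in>UNIV. (A $ i $ j)\<^sup>2)"
  by (simp add: norm_vec_def L2_set_def sum_nonneg)

lemma norm_transpose: "norm (transpose A) = norm (A :: real^'n^'m)"
proof -
  have "(norm (transpose A))\<^sup>2 = (norm A)\<^sup>2"
    unfolding norm_matrix_sq by (subst sum.swap) (simp add: transpose_def)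
  then show ?thesis by simp
qed

lemma norm_matrix_matrix_mult:
  fixes A :: "real^'n^'m" and B :: "real^'k^'n"
  shows "norm (A ** B) \<le> norm A * norm B"
proof -
  have entry: "((A ** B) $ i $ j)\<^sup>2 \<le> (norm (row i A))\<^sup>2 * (norm (row j (transpose B)))\<^sup>2" for i j
  proof -
    have "(A ** B) $ i $ j = row i A \<bullet> row j (transpose B)"
      by (simp add: matrix_matrix_mult_def inner_vec_def row_def transpose_def)
    then show ?thesis
      using Cauchy_Schwarz_ineq2[of "row i A" "row j (transpose B)"]
      by (metis power_mult_distrib abs_le_square_iff abs_norm_cancel abs_mult)
  qed
  have rows: "(\<Sum>i\<in>UNIV. (norm (row i M))\<^sup>2) = (norm M)\<^sup>2" for M :: "real^'i^'j"
    unfolding norm_matrix_sq by (simp add: norm_vec_def L2_set_def sum_nonneg row_def)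
  have "(norm (A ** B))\<^sup>2 \<le> (\<Sum>i\<in>UNIV. \<Sum>j\<in>UNIV. (norm (row i A))\<^sup>2 * (norm (row j (transpose B)))\<^sup>2)"
    unfolding norm_matrix_sq[of "A ** B"] by (intro sum_mono entry)
  also have "\<dots> = (norm A * norm B)\<^sup>2"
    by (simp only: sum_product[symmetric] rows norm_transpose power_mult_distrib)
  finally show ?thesis by (rule power2_le_imp_le) simp
qed

text \<open>A zero of a nonnegative function is a minimum, so the derivative vanishes at
  \<open>z\<close>. Differentiability of the partial derivatives at \<open>z\<close> then bounds
  them by a multiple of the distance to \<open>z\<close>, and the mean value inequality on the
  closed ball of radius \<open>norm (y - z)\<close> supplies the second factor.\<close>

lemma C2_nonneg_quadratic_bound:
  fixes f :: "'a::euclidean_space \<Rightarrow> real"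
  assumes "open U" "Ck_on 2 U f" "z \<in> U" "f z = 0" "\<And>x. 0 \<le> f x"
  obtains C e where "C > 0" "e > 0" "\<And>y. norm (y - z) < e \<Longrightarrow> f y \<le> C * (norm (y - z))\<^sup>2"
proof -
  obtain D where D: "\<And>x. x \<in> U \<Longrightarrow> (f has_derivative D x) (at x)"
    "\<And>b. b \<in> Basis \<Longrightarrow> Ck_on 1 U (\<lambda>x. D x b)"
    using assms(2) by (metis Ck_on_SucE numeral_2_eq_2 One_nat_def)
  have Dz: "D z = (\<lambda>v. 0)"
    using has_derivative_local_min[OF D(1)[OF assms(3)]] assms(4,5) by simp
  have "\<exists>K d. K > 0 \<and> d > 0 \<and> (\<forall>y. norm (y - z) < d \<longrightarrow> \<bar>D y b\<bar> \<le> K * norm (y - z))"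
    if b: "b \<in> Basis" for b
  proof -
    have "(\<lambda>x. D x b) differentiable (at z)" using D(2)[OF b] assms(3) by simp
    then obtain L where L: "((\<lambda>x. D x b) has_derivative L) (at z)" by (auto simp: differentiable_def)
    then obtain d where d: "d > 0" "\<And>y. norm (y - z) < d \<Longrightarrow> norm (D y b - D z b - L (y - z)) \<le> norm (y - z)"
      using L[unfolded has_derivative_at_alt] by (metis mult_1 zero_less_one)
    obtain K where K: "K > 0" "\<And>v. norm (L v) \<le> norm v * K"
      using bounded_linear.pos_bounded[OF has_derivative_bounded_linear[OF L]] by blast
    have "\<bar>D y b\<bar> \<le> (K + 1) * norm (y - z)" if "norm (y - z) < d" for y
      using d(2)[OF that] K(2)[of "y - z"] by (simp add: Dz algebra_simps)
    then show ?thesis using d K by (intro exI[of _ "K + 1"] exI[of _ d]) auto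
  qed
  then obtain K d where Kd: "\<And>b. b \<in> Basis \<Longrightarrow> K b > 0" "\<And>b. b \<in> Basis \<Longrightarrow> d b > 0"
    "\<And>b y. b \<in> Basis \<Longrightarrow> norm (y - z) < d b \<Longrightarrow> \<bar>D y b\<bar> \<le> K b * norm (y - z)" by metis
  obtain r where r: "r > 0" "ball z r \<subseteq> U" using assms(1,3) open_contains_ball by blast
  define e where "e = Min (insert r (d ` Basis))"
  have e: "e > 0" "e \<le> r" "\<And>b. b \<in> Basis \<Longrightarrow> e \<le> d b"
    using r Kd by (auto simp: e_def simp del: Min_insert intro!: Min_le)
  define C where "C = (\<Sum>b\<in>Basis. K b)"
  have C: "C > 0" unfolding C_def using Kd by (intro sum_pos) auto
  have "f y \<le> C * (norm (y - z))\<^sup>2" if y: "norm (y - z) < e" for y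
  proof -
    have inU: "x \<in> U" if "x \<in> cball z (norm (y - z))" for x
      using that y e r by (auto simp: subset_eq)
    have "onorm (D x) \<le> C * norm (y - z)" if x: "x \<in> cball z (norm (y - z))" for x
    proof (rule onorm_le)
      fix v
      have "D x v = D x (\<Sum>b\<in>Basis. (v \<bullet> b) *\<^sub>R b)" by (simp add: euclidean_representation)
      also have "\<dots> = (\<Sum>b\<in>Basis. (v \<bullet> b) * D x b)"
        using has_derivative_linear[OF D(1)[OF inU[OF x]]]
        by (simp only: linear_sum linear_cmul real_scaleR_def)
      finally have "\<bar>D x v\<bar> = \<bar>\<Sum>b\<in>Basis. (v \<bullet> b) * D x b\<bar>" by simp
      also have "\<dots> \<le> (\<Sum>b\<in>Basis. \<bar>(v \<bullet> b) * D x b\<bar>)" by (rule sum_abs)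
      also have "\<dots> \<le> (\<Sum>b\<in>Basis. norm v * (K b * norm (y - z)))"
      proof (rule sum_mono)
        fix b :: 'a assume b: "b \<in> Basis"
        have nx: "norm (x - z) \<le> norm (y - z)" using x by (simp add: dist_norm norm_minus_commute)
        then have "\<bar>D x b\<bar> \<le> K b * norm (x - z)" using Kd(3)[OF b] y e(3)[OF b] by auto
        also have "\<dots> \<le> K b * norm (y - z)" using nx Kd(1)[OF b] by simp
        finally show "\<bar>(v \<bullet> b) * D x b\<bar> \<le> norm v * (K b * norm (y - z))"
          using Basis_le_norm[OF b, of v] by (simp add: abs_mult mult_mono)
      qed
      also have "\<dots> = C * norm (y - z) * norm v"
        by (simp add: C_def sum_distrib_left sum_distrib_right algebra_simps)
      finally show "norm (D x v) \<le> C * norm (y - z) * norm v" by simp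
    qed
    then have "norm (f y - f z) \<le> C * norm (y - z) * norm (y - z)"
      using D(1)[OF inU]
      by (intro differentiable_bound[of "cball z (norm (y - z))" f D])
        (auto intro: has_derivative_at_withinI simp: dist_norm norm_minus_commute)
    then show ?thesis using assms(4,5) by (simp add: power2_eq_square mult.assoc)
  qed
  then show thesis using that C e(1) by blast
qed

section \<open>Rotating a matrix to upper triangular form\<close>

definition gs2 :: "real^3^3 \<Rightarrow> real^3" where
  "gs2 F = column 2 F - (column 2 F \<bullet> sgn (column 1 F)) *\<^sub>R sgn (column 1 F)"

text \<open>The orthonormalised columns of \<open>F\<close> appear as rows, so the matrix acts from
  the left as the inverse of the usual orthogonal factor. The last row is a cross product rather
  than a third projection step, which makes the determinant \<open>1\<close> whatever the third
  column is.\<close>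

definition gram_schmidt :: "real^3^3 \<Rightarrow> real^3^3" where
  "gram_schmidt F = vector [sgn (column 1 F), sgn (gs2 F), cross3 (sgn (column 1 F)) (sgn (gs2 F))]"

lemma vector3_row: "row i (vector [a, b, c] :: real^3^3) = (vector [a, b, c] :: (real^3)^3) $ i"
  by (simp add: row_def)

lemma gram_schmidt_SO3:
  assumes "column 1 F \<noteq> 0" "gs2 F \<noteq> 0"
  shows "gram_schmidt F \<in> SO3"
proof -
  let ?a = "sgn (column 1 F)" and ?b = "sgn (gs2 F)"
  have a: "?a \<bullet> ?a = 1" and b: "?b \<bullet> ?b = 1"
    using assms by (simp_all add: norm_sgn dot_square_norm)
  have "?a \<bullet> gs2 F = 0" using a by (simp add: gs2_def inner_diff_right inner_commute)
  then have ab: "?a \<bullet> ?b = 0" by (simp add: sgn_div_norm[of "gs2 F"])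
  have cc: "cross3 ?a ?b \<bullet> cross3 ?a ?b = 1"
    using norm_cross_dot[of ?a ?b] a b ab by (simp add: power2_norm_eq_inner power_mult_distrib)
  have cyc: "x \<bullet> cross3 y z = z \<bullet> cross3 x y" for x y z :: "real^3"
    by (simp add: cross3_simps)
  have "orthogonal_matrix (gram_schmidt F)"
    unfolding orthogonal_matrix_orthonormal_rows gram_schmidt_def forall_3 vector3_row
    using a b ab cc by (simp add: orthogonal_def dot_cross_self inner_commute norm_eq_1)
  moreover have "det (gram_schmidt F) = 1"
    unfolding gram_schmidt_def dot_cross_det[symmetric] using cc cyc by metis
  ultimately show ?thesis by (simp add: SO3_def rotation_matrix_def)
qed

lemma gram_schmidt_mult:
  "gram_schmidt F ** F = (\<chi> i j. (vector [sgn (column 1 F), sgn (gs2 F),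
     cross3 (sgn (column 1 F)) (sgn (gs2 F))] :: (real^3)^3) $ i \<bullet> column j F)"
  by (simp add: gram_schmidt_def matrix_matrix_mult_def column_def inner_vec_def)

lemma norm_scaleR_sgn: "norm x *\<^sub>R sgn x = (x :: 'a::real_normed_vector)"
  by (cases "x = 0") (simp_all add: sgn_div_norm)

text \<open>\<open>column 1 F\<close> is a multiple of the first row of
  \<open>gram_schmidt F\<close> and \<open>column 2 F\<close> lies in the span of the first two
  rows; the entries below the diagonal are inner products with rows orthogonal to these.\<close>

lemma gram_schmidt_upper_triangular:
  assumes "column 1 F \<noteq> 0"
  defines "T \<equiv> gram_schmidt F ** F"
  shows "T $ 2 $ 1 = 0" "T $ 3 $ 1 = 0" "T $ 3 $ 2 = 0"
proof -
  let ?a = "sgn (column 1 F)" and ?b = "sgn (gs2 F)"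
  have a: "?a \<bullet> ?a = 1" using assms by (simp_all add: norm_sgn dot_square_norm)
  have col1: "column 1 F = norm (column 1 F) *\<^sub>R ?a" by (simp add: norm_scaleR_sgn)
  have col2: "column 2 F = norm (gs2 F) *\<^sub>R ?b + (column 2 F \<bullet> ?a) *\<^sub>R ?a"
    unfolding norm_scaleR_sgn by (simp add: gs2_def)
  have "gs2 F \<bullet> ?a = 0" using a by (simp add: gs2_def inner_diff_left)
  then have ba: "?b \<bullet> ?a = 0" by (simp add: sgn_div_norm[of "gs2 F"])
  have c1: "cross3 ?a ?b \<bullet> column 1 F = 0" by (subst col1) (simp add: dot_cross_self)
  have c2: "cross3 ?a ?b \<bullet> column 2 F = 0" by (subst col2) (simp add: dot_cross_self inner_add_right)
  have b1: "?b \<bullet> column 1 F = 0" by (subst col1) (simp add: ba)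
  show "T $ 2 $ 1 = 0" "T $ 3 $ 1 = 0" "T $ 3 $ 2 = 0"
    unfolding T_def gram_schmidt_mult by (simp_all add: c1 c2 b1)
qed

lemma column_mat_1: "column i (mat 1) = axis i 1"
  by (simp add: column_def mat_def axis_def vec_eq_iff)

lemma isCont_column: "isCont (column i :: real^'n^'m \<Rightarrow> real^'m) A"
proof -
  have "linear (column i :: real^'n^'m \<Rightarrow> real^'m)"
    by (rule linearI) (simp_all add: column_def vec_eq_iff)
  then show ?thesis
    by (simp add: linear_conv_bounded_linear linear_continuous_at)
qed

lemma gram_schmidt_mat_1:
  "gs2 (mat 1) = axis 2 1" "gram_schmidt (mat 1) = mat 1"
proof -
  show *: "gs2 (mat 1) = axis 2 1"
    by (simp add: gs2_def column_mat_1 sgn_div_norm inner_axis_axis)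
  show "gram_schmidt (mat 1) = mat 1"
    unfolding gram_schmidt_def *
    by (simp add: column_mat_1 sgn_div_norm cross_basis) (simp add: vec_eq_iff forall_3 mat_def axis_def)
qed

lemma isCont_gram_schmidt:
  "isCont gs2 (mat 1)" "isCont (\<lambda>F. gram_schmidt F ** F) (mat 1)"
proof -
  note col = isCont_column
  have 1: "isCont (\<lambda>F. sgn (column 1 F) :: real^3) (mat 1)"
    by (intro continuous_sgn col) (simp add: column_mat_1 axis_eq_0_iff)
  show g: "isCont gs2 (mat 1)"
    unfolding gs2_def[abs_def] by (intro continuous_intros col 1)
  have 2: "isCont (\<lambda>F. sgn (gs2 F) :: real^3) (mat 1)"
    by (intro continuous_sgn g) (simp add: gram_schmidt_mat_1 axis_eq_0_iff)
  have v: "isCont (\<lambda>F. (vector [sgn (column 1 F), sgn (gs2 F),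
     cross3 (sgn (column 1 F)) (sgn (gs2 F))] :: (real^3)^3) $ i) (mat 1)" for i
    using exhaust_3[of i] by (auto intro!: 1 2 continuous_cross)
  show "isCont (\<lambda>F. gram_schmidt F ** F) (mat 1)"
    using v col unfolding gram_schmidt_mult isCont_def
    by (intro tendsto_vec_lambda tendsto_inner)
qed

text \<open>Adding the transpose doubles the diagonal and puts each entry above it into two places,
  so nothing cancels.\<close>

lemma upper_triangular_norm_le:
  fixes E :: "real^3^3"
  assumes "E $ 2 $ 1 = 0" "E $ 3 $ 1 = 0" "E $ 3 $ 2 = 0"
  shows "norm E \<le> norm (E + transpose E)"
proof -
  have "(norm E)\<^sup>2 \<le> (norm (E + transpose E))\<^sup>2"
    unfolding norm_matrix_sq by (simp add: sum_3 transpose_def assms power2_eq_square)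
  then show ?thesis by (rule power2_le_imp_le) simp
qed

text \<open>The Gram--Schmidt factor \<open>Q\<close> of \<open>F\<close> makes \<open>Q F\<close> upper triangular, and for an upper
  triangular perturbation \<open>E\<close> of the identity the linearised strain \<open>E + E\<^sup>T\<close> controls \<open>E\<close>.
  So no polar decomposition is needed.\<close>

lemma admissible_density_strain_bound:
  assumes "admissible_density W"
  obtains C e where "C > 0" "e > 0"
    "\<And>F. norm (F - mat 1) < e \<Longrightarrow> W F \<le> C * (norm (transpose F ** F - mat 1))\<^sup>2"
proof -
  obtain U c where W: "open U" "SO3 \<subseteq> U" "Ck_on 2 U W" "\<forall>R\<in>SO3. W R = 0"
    "\<forall>F. \<forall>R\<in>SO3. W (R ** F) = W F" "c > 0" "\<forall>F. W F \<ge> c * (infdist F SO3)\<^sup>2"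
    using assms unfolding admissible_density_def by blast
  have I: "mat 1 \<in> SO3" by (simp add: SO3_def rotation_matrix_def orthogonal_matrix_id)
  have "0 \<le> W F" for F using W(6,7) by (meson less_imp_le mult_nonneg_nonneg order_trans zero_le_power2)
  then obtain C e where Ce: "C > 0" "e > 0" "\<And>Y. norm (Y - mat 1) < e \<Longrightarrow> W Y \<le> C * (norm (Y - mat 1))\<^sup>2"
    using C2_nonneg_quadratic_bound[OF W(1,3)] I W(2,4) by blast
  have e': "min e (1/2) > 0" using Ce by simp
  \<comment> \<open>The radius \<open>e\<close> keeps the rotated matrix in the range of the
    quadratic bound on \<open>W\<close>; the radius \<open>1/2\<close> lets the term
    \<open>E^T E\<close> be absorbed by \<open>E + E^T\<close>, at the price of a factor
    \<open>2\<close>.\<close>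
  obtain d where d: "d > 0" "\<And>F. dist F (mat 1) < d \<Longrightarrow> norm (gram_schmidt F ** F - mat 1) < min e (1/2)"
    using isCont_gram_schmidt(2)[unfolded continuous_at_eps_delta] e' gram_schmidt_mat_1(2)
    by (metis dist_norm matrix_mul_lid)
  have "\<forall>\<^sub>F F in nhds (mat 1 :: real^3^3). column 1 F \<noteq> (0 :: real^3)"
    using isCont_column[where i=1 and A="mat 1 :: real^3^3"]
    unfolding isCont_def tendsto_at_iff_tendsto_nhds
    by (rule tendsto_imp_eventually_ne) (simp add: column_mat_1 axis_eq_0_iff)
  moreover have "\<forall>\<^sub>F F in nhds (mat 1 :: real^3^3). gs2 F \<noteq> 0"
    using isCont_gram_schmidt(1) unfolding isCont_def tendsto_at_iff_tendsto_nhds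
    by (rule tendsto_imp_eventually_ne) (simp add: gram_schmidt_mat_1 axis_eq_0_iff)
  ultimately have "\<forall>\<^sub>F F in nhds (mat 1 :: real^3^3). column 1 F \<noteq> (0 :: real^3) \<and> gs2 F \<noteq> 0"
    by (rule eventually_conj)
  then obtain d2 where d2: "d2 > 0" "\<And>F. dist F (mat 1) < d2 \<Longrightarrow> column 1 F \<noteq> 0 \<and> gs2 F \<noteq> 0"
    unfolding eventually_nhds_metric by blast
  have "W F \<le> 4 * C * (norm (transpose F ** F - mat 1))\<^sup>2" if F: "norm (F - mat 1) < min d d2" for F
  proof -
    define Q T E where "Q = gram_schmidt F" and "T = Q ** F" and "E = T - mat 1"
    have nz: "column 1 F \<noteq> 0" "gs2 F \<noteq> 0" using d2(2)[of F] F by (auto simp: dist_norm)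
    have Q: "Q \<in> SO3" unfolding Q_def by (rule gram_schmidt_SO3[OF nz])
    have E: "norm E < e" "norm E \<le> 1/2" using d(2)[of F] F by (auto simp: E_def T_def Q_def dist_norm)
    have "transpose Q ** Q = mat 1" using Q by (simp add: SO3_def rotation_matrix_def orthogonal_matrix)
    then have TF: "transpose T ** T = transpose F ** F"
      unfolding T_def matrix_transpose_mul by (metis matrix_mul_assoc matrix_mul_lid)
    have "T = mat 1 + E" by (simp add: E_def)
    then have "transpose F ** F - mat 1 = (E + transpose E) + transpose E ** E"
      unfolding TF[symmetric]
      by (simp add: vec_eq_iff forall_3 sum_3 matrix_matrix_mult_def transpose_def mat_def algebra_simps)
    moreover have "norm (transpose E ** E) \<le> 1/2 * norm E"
      using norm_matrix_matrix_mult[of "transpose E" E] E(2)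
      by (metis (no_types, lifting) mult_right_mono norm_ge_zero norm_transpose order_trans)
    moreover have "norm E \<le> norm (E + transpose E)"
      using gram_schmidt_upper_triangular[OF nz(1)]
      by (intro upper_triangular_norm_le) (simp_all add: E_def T_def Q_def mat_def)
    ultimately have "norm E \<le> 2 * norm (transpose F ** F - mat 1)"
      using norm_triangle_ineq2[of "E + transpose E" "- (transpose E ** E)"] by simp
    then have "(norm E)\<^sup>2 \<le> (2 * norm (transpose F ** F - mat 1))\<^sup>2" by (intro power_mono) auto
    moreover have "W F = W T" using W(5) Q unfolding T_def by simp
    moreover have "W T \<le> C * (norm E)\<^sup>2" using Ce(3)[of T] E unfolding E_def by simp
    ultimately show ?thesis using Ce(1) by (simp add: power_mult_distrib mult_left_mono order_trans)
  qed
  then show thesis using that[of "4 * C" "min d d2"] Ce d d2 by auto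
qed

section \<open>Weak gradients of classically differentiable functions\<close>

text \<open>Difference quotients have integral zero by translation invariance of Lebesgue measure.\<close>

lemma integral_directional_derivative_eq_0:
  fixes f :: "'a::euclidean_space \<Rightarrow> real"
  assumes der: "\<And>x. (f has_derivative D x) (at x)"
    and K: "compact K" "\<And>x. x \<notin> K \<Longrightarrow> f x = 0"
    and C: "\<And>x. \<bar>D x e\<bar> \<le> C"
  shows "(\<lambda>x. D x e) \<in> borel_measurable borel" "(LINT x|lborel. D x e) = 0"
proof -
  define q where "q = (\<lambda>n x. real (Suc n) * (f (x + (1 / real (Suc n)) *\<^sub>R e) - f x))"
  have line: "((\<lambda>t. f (x + t *\<^sub>R e)) has_real_derivative D (x + t *\<^sub>R e) e) (at t)" for x t
  proof -
    have "((\<lambda>t. f (x + t *\<^sub>R e)) has_derivative (\<lambda>s. D (x + t *\<^sub>R e) (s *\<^sub>R e))) (at t)"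
      by (rule has_derivative_compose[OF _ der]) (auto intro!: derivative_eq_intros)
    moreover have "D (x + t *\<^sub>R e) (s *\<^sub>R e) = D (x + t *\<^sub>R e) e * s" for s
      using linear_cmul[OF has_derivative_linear[OF der]] by simp
    ultimately show ?thesis by (simp add: has_field_derivative_def)
  qed
  have lim: "(\<lambda>n. q n x) \<longlonglongrightarrow> D x e" for x
  proof -
    have "((\<lambda>t. (f (x + t *\<^sub>R e) - f x) / t) \<longlongrightarrow> D x e) (at 0)"
      using line[of x 0] by (simp add: has_field_derivative_iff)
    moreover have "filterlim (\<lambda>n. 1 / real (Suc n)) (at 0) sequentially"
      unfolding filterlim_at using LIMSEQ_Suc[OF lim_1_over_n] by auto
    ultimately have "(\<lambda>n. (f (x + (1 / real (Suc n)) *\<^sub>R e) - f x) / (1 / real (Suc n))) \<longlonglongrightarrow> D x e"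
      by (rule filterlim_compose)
    then show ?thesis by (simp add: q_def mult.commute)
  qed
  have cont: "continuous_on UNIV f"
    by (rule has_derivative_continuous_on[OF der])
  have fm [measurable]: "f \<in> borel_measurable borel"
    using cont by (rule borel_measurable_continuous_onI)
  have qm [measurable]: "q n \<in> borel_measurable borel" for n unfolding q_def by measurable
  \<comment> \<open>The derivative may be discontinuous; it is measurable as a pointwise limit of
    continuous difference quotients.\<close>
  show Dm: "(\<lambda>x. D x e) \<in> borel_measurable borel"
    by (rule borel_measurable_LIMSEQ_real[OF lim qm])
  have "integrable lborel (\<lambda>x. indicator K x *\<^sub>R f x)"
    using K(1) cont continuous_on_subset by (intro borel_integrable_compact) blast+
  also have "(\<lambda>x. indicator K x *\<^sub>R f x) = f"
    using K(2) by (force simp: indicator_def)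
  finally have fi: "integrable lborel f" .
  have shift: "integrable lborel (\<lambda>x. f (x + c))" "(LINT x|lborel. f (x + c)) = (LINT x|lborel. f x)" for c
  proof -
    have "lborel = distr lborel borel ((+) c)" by (simp add: lborel_distr_plus)
    then show "integrable lborel (\<lambda>x. f (x + c))" "(LINT x|lborel. f (x + c)) = (LINT x|lborel. f x)"
      using integrable_distr_eq[of "(+) c" lborel borel f] integral_distr[of "(+) c" lborel borel f] fi
      by (simp_all add: add.commute)
  qed
  have q0: "(LINT x|lborel. q n x) = 0" for n
    unfolding q_def using shift fi by (simp add: Bochner_Integration.integral_diff)
  obtain R where R: "\<And>x. x \<in> K \<Longrightarrow> norm x \<le> R"
    using compact_imp_bounded[OF K(1)] by (auto simp: bounded_iff)
  \<comment> \<open>All steps have length at most \<open>norm e\<close>, so the quotients vanish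
    outside one common ball; inside it the mean value inequality along the line bounds them by
    \<open>C\<close>. This is the dominating function.\<close>
  have qb: "norm (q n x) \<le> C * indicator (cball 0 (R + norm e)) x" for n x
  proof (cases "x \<in> cball 0 (R + norm e)")
    case True
    have "norm (f (x + (1 / real (Suc n)) *\<^sub>R e) - f (x + 0 *\<^sub>R e)) \<le> C * norm (1 / real (Suc n) - 0)"
      by (rule field_differentiable_bound[of UNIV _ "\<lambda>t. D (x + t *\<^sub>R e) e"]) (use line C in auto)
    then have "real (Suc n) * \<bar>f (x + (1 / real (Suc n)) *\<^sub>R e) - f x\<bar> \<le> C"
      by (simp add: field_simps)
    then show ?thesis using True by (simp add: q_def abs_mult)
  next
    case False
    have "x \<notin> K" using R[of x] False norm_ge_zero[of e] by (auto simp del: norm_ge_zero)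
    moreover have "x + (1 / real (Suc n)) *\<^sub>R e \<notin> K"
    proof
      assume "x + (1 / real (Suc n)) *\<^sub>R e \<in> K"
      then have "norm (x + (1 / real (Suc n)) *\<^sub>R e) \<le> R" using R by blast
      moreover have "norm ((1 / real (Suc n)) *\<^sub>R e) \<le> norm e"
        by (simp add: field_simps)
      ultimately have "norm x \<le> R + norm e"
        using norm_triangle_ineq4[of "x + (1 / real (Suc n)) *\<^sub>R e" "(1 / real (Suc n)) *\<^sub>R e"] by simp
      then show False using False by simp
    qed
    ultimately show ?thesis using False K(2) by (simp add: q_def)
  qed
  have ic: "integrable lborel (indicator (cball 0 (R + norm e)) :: 'a \<Rightarrow> real)"
    using emeasure_lborel_cball_finite by (intro integrable_real_indicator) auto
  have "(\<lambda>n. LINT x|lborel. q n x) \<longlonglongrightarrow> (LINT x|lborel. D x e)"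
    by (rule integral_dominated_convergence[where w="\<lambda>x. C * indicator (cball 0 (R + norm e)) x"])
      (use Dm lim qb ic in auto)
  then show "(LINT x|lborel. D x e) = 0"
    unfolding q0 by (simp add: LIMSEQ_const_iff)
qed

lemma test_function_C1:
  assumes "test_function \<Omega> \<phi>"
  obtains C where "\<And>x. (\<phi> has_derivative frechet_derivative \<phi> (at x)) (at x)"
    "\<And>b. b \<in> Basis \<Longrightarrow> continuous_on UNIV (\<lambda>x. frechet_derivative \<phi> (at x) b)"
    "C \<ge> 0" "\<And>x. \<bar>\<phi> x\<bar> \<le> C" "\<And>x b. b \<in> Basis \<Longrightarrow> \<bar>frechet_derivative \<phi> (at x) b\<bar> \<le> C"
proof -
  define K where "K = closure {x. \<phi> x \<noteq> 0}"
  have K: "compact K" and C1: "Ck_on 1 UNIV \<phi>"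
    using assms unfolding test_function_def K_def smooth_on_def by blast+
  have der: "(\<phi> has_derivative frechet_derivative \<phi> (at x)) (at x)" for x
    using C1 frechet_derivative_works by auto
  have zero: "\<phi> x = 0" if "x \<notin> K" for x
    using that closure_subset[of "{x. \<phi> x \<noteq> 0}"] by (auto simp: K_def)
  have dzero: "frechet_derivative \<phi> (at x) b = 0" if "x \<notin> K" for x b
  proof -
    have "(\<phi> has_derivative (\<lambda>v. 0)) (at x)"
      by (rule has_derivative_transform_within_open[of "\<lambda>_. 0" _ _ _ "- K"])
        (use that zero compact_imp_closed[OF K] in \<open>auto simp: open_Compl\<close>)
    then show ?thesis using fun_cong[OF frechet_derivative_at, of \<phi> "\<lambda>v. 0" x b] by simp
  qed
  have bound: "\<exists>B. \<forall>x. \<bar>g x\<bar> \<le> B" if g: "continuous_on UNIV g" "\<And>x. x \<notin> K \<Longrightarrow> g x = 0"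
    for g :: "real^'a \<Rightarrow> real"
  proof -
    have "bounded (g ` K)"
      by (meson K compact_continuous_image compact_imp_bounded continuous_on_subset g(1) subset_UNIV)
    then obtain B where "\<And>x. x \<in> K \<Longrightarrow> \<bar>g x\<bar> \<le> B" by (auto simp: bounded_iff)
    then have "\<bar>g x\<bar> \<le> max B 0" for x using g(2)[of x] by (cases "x \<in> K") force+
    then show ?thesis by blast
  qed
  have cont: "continuous_on UNIV (\<lambda>x. frechet_derivative \<phi> (at x) b)" if "b \<in> Basis" for b
    using C1 that by simp
  have "\<forall>b\<in>Basis. \<exists>B. \<forall>x. \<bar>frechet_derivative \<phi> (at x) b\<bar> \<le> B"
    using bound cont dzero by blast
  then obtain B where B: "\<And>b x. b \<in> Basis \<Longrightarrow> \<bar>frechet_derivative \<phi> (at x) b\<bar> \<le> B b" by metis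
  obtain B0 where B0: "\<And>x. \<bar>\<phi> x\<bar> \<le> B0" using bound Ck_on_imp_continuous_on[OF C1] zero by blast
  define C where "C = Max (insert \<bar>B0\<bar> (B ` Basis))"
  have "\<bar>B0\<bar> \<le> C" "\<And>b. b \<in> Basis \<Longrightarrow> B b \<le> C"
    by (auto simp: C_def simp del: Max_insert intro!: Max_ge)
  then have "C \<ge> 0" "\<bar>\<phi> x\<bar> \<le> C" "b \<in> Basis \<Longrightarrow> \<bar>frechet_derivative \<phi> (at x) b\<bar> \<le> C" for x b
    using B0[of x] B[of b x] by (fastforce intro: order_trans)+
  then show thesis using that[of C] der cont by blast
qed

lemma bounded_measurable_in_L2:
  assumes "\<Omega> \<in> lmeasurable" "f \<in> borel_measurable (lebesgue_on \<Omega>)" "\<And>x. x \<in> \<Omega> \<Longrightarrow> norm (f x) \<le> C"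
  shows "f \<in> L2_on \<Omega>"
proof -
  interpret finite_measure "lebesgue_on \<Omega>" using assms(1) by (rule finite_measure_lebesgue_on)
  have "integrable (lebesgue_on \<Omega>) (\<lambda>x. (norm (f x))\<^sup>2)"
    by (rule integrable_const_bound[of _ "C\<^sup>2"])
      (use assms(2,3) in \<open>auto intro!: AE_I2 power_mono\<close>)
  then show ?thesis using assms(2) by (simp add: L2_on_def)
qed

lemma borel_measurable_vec_nth:
  "f \<in> borel_measurable M \<Longrightarrow> (\<lambda>x. f x $ i) \<in> borel_measurable M"
  for f :: "'a \<Rightarrow> 'b::{real_normed_vector,second_countable_topology}^'n"
  by (rule measurable_compose[of f M borel "\<lambda>y. y $ i"])
    (auto intro: borel_measurable_continuous_onI linear_continuous_on bounded_linear_vec_nth)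

text \<open>The gradient is only known to exist, so its measurability comes from a limit of
  difference quotients. Since \<open>\<Omega>\<close> is open, the shifted points eventually lie in
  \<open>\<Omega>\<close>, and extending \<open>u\<close> by zero does not affect the limit.\<close>

lemma borel_measurable_gradient:
  fixes u :: "real^'n \<Rightarrow> real^'m" and G :: "real^'n \<Rightarrow> real^'n^'m"
  assumes "open \<Omega>" and der: "\<And>x. x \<in> \<Omega> \<Longrightarrow> (u has_derivative (\<lambda>v. G x *v v)) (at x)"
  shows "(\<lambda>x. indicator \<Omega> x *\<^sub>R (G x $ i $ j)) \<in> borel_measurable borel"
proof -
  define g where "g = (\<lambda>x. if x \<in> \<Omega> then u x $ i else 0)"
  have cu: "continuous_on \<Omega> u"
    by (rule has_derivative_continuous_on[OF has_derivative_at_withinI[OF der]])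
  have [measurable]: "g \<in> borel_measurable borel" "\<Omega> \<in> sets borel"
    unfolding g_def using assms(1) cu
    by (auto intro!: borel_measurable_continuous_on_if continuous_intros)
  define q where "q = (\<lambda>n x. indicator \<Omega> x *\<^sub>R (real (Suc n) * (g (x + (1 / real (Suc n)) *\<^sub>R axis j 1) - g x)))"
  have "(\<lambda>n. q n x) \<longlonglongrightarrow> indicator \<Omega> x *\<^sub>R (G x $ i $ j)" for x
  proof (cases "x \<in> \<Omega>")
    case True
    have "((\<lambda>y. u y $ i) has_derivative (\<lambda>v. (G x *v v) $ i)) (at x)"
      by (rule bounded_linear.has_derivative[OF bounded_linear_vec_nth der[OF True]])
    then have "(g has_derivative (\<lambda>v. (G x *v v) $ i)) (at x)"
      by (rule has_derivative_transform_within_open[OF _ assms(1) True]) (simp add: g_def)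
    then have "(g has_derivative (\<lambda>v. (G x *v v) $ i)) (at (x + 0 *\<^sub>R axis j 1))" by simp
    then have "((\<lambda>t. g (x + t *\<^sub>R axis j 1)) has_derivative (\<lambda>s. (G x *v (s *\<^sub>R axis j 1)) $ i)) (at 0)"
      by (rule has_derivative_compose[rotated]) (auto intro!: derivative_eq_intros)
    moreover have "(G x *v (s *\<^sub>R axis j 1)) $ i = G x $ i $ j * s" for s
      by (simp add: matrix_vector_mult_scaleR matrix_vector_mult_basis column_def)
    ultimately have "((\<lambda>t. g (x + t *\<^sub>R axis j 1)) has_real_derivative G x $ i $ j) (at 0)"
      by (simp add: has_field_derivative_def)
    then have "((\<lambda>t. (g (x + t *\<^sub>R axis j 1) - g x) / t) \<longlongrightarrow> G x $ i $ j) (at 0)"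
      by (simp add: has_field_derivative_iff)
    moreover have "filterlim (\<lambda>n. 1 / real (Suc n)) (at 0) sequentially"
      unfolding filterlim_at using LIMSEQ_Suc[OF lim_1_over_n] by auto
    ultimately have "(\<lambda>n. (g (x + (1 / real (Suc n)) *\<^sub>R axis j 1) - g x) / (1 / real (Suc n))) \<longlonglongrightarrow> G x $ i $ j"
      by (rule filterlim_compose)
    then show ?thesis using True by (simp add: q_def mult.commute)
  qed (simp add: q_def)
  then show ?thesis
    by (rule borel_measurable_LIMSEQ_real) (simp add: q_def)
qed

text \<open>The product of a component of \<open>u\<close> with \<open>\<phi>\<close>, extended by
  zero, is differentiable on the whole space: near points outside \<open>\<Omega>\<close> it
  vanishes identically, because the support of \<open>\<phi>\<close> is a compact subset of
  \<open>\<Omega>\<close>. Its directional derivative integrates to zero, and the product rule turns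
  this into integration by parts.\<close>

lemma classical_gradient_is_weak:
  fixes u :: "real^'n \<Rightarrow> real^'m" and G :: "real^'n \<Rightarrow> real^'n^'m"
  assumes \<Omega>: "open \<Omega>" "bounded \<Omega>"
    and der: "\<And>x. x \<in> \<Omega> \<Longrightarrow> (u has_derivative (\<lambda>v. G x *v v)) (at x)"
    and C: "\<And>x. x \<in> \<Omega> \<Longrightarrow> norm (u x) \<le> C" "\<And>x. x \<in> \<Omega> \<Longrightarrow> norm (G x) \<le> C"
  shows "u \<in> L2_on \<Omega>" "has_L2_weak_gradient \<Omega> u G"
proof -
  have lm: "\<Omega> \<in> lmeasurable" using \<Omega> by (simp add: lmeasurable_open)
  then have sL: "\<Omega> \<in> sets lebesgue" by (simp add: fmeasurableD)
  interpret finite_measure "lebesgue_on \<Omega>" using lm by (rule finite_measure_lebesgue_on)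
  have cu: "continuous_on \<Omega> u"
    by (rule has_derivative_continuous_on[OF has_derivative_at_withinI[OF der]])
  have um: "u \<in> borel_measurable (lebesgue_on \<Omega>)"
    using cu sL by (rule continuous_imp_measurable_on_sets_lebesgue)
  have Gc: "(\<lambda>x. G x $ i $ j) \<in> borel_measurable (lebesgue_on \<Omega>)" for i j
  proof -
    have "(\<lambda>x. indicator \<Omega> x *\<^sub>R (G x $ i $ j)) \<in> borel_measurable lebesgue"
      using borel_measurable_gradient[OF \<Omega>(1) der] by (simp add: measurable_completion)
    then show ?thesis by (subst borel_measurable_restrict_space_iff) (use sL in auto)
  qed
  have Gm: "G \<in> borel_measurable (lebesgue_on \<Omega>)"
  proof (rule borel_measurable_euclidean_space[THEN iffD2], rule ballI)
    fix b :: "real^'n^'m" assume "b \<in> Basis"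
    then obtain i v where v: "b = axis i v" "v \<in> Basis" unfolding Basis_vec_def by blast
    then obtain j where "v = axis j 1" unfolding Basis_vec_def by auto
    then have "(\<lambda>x. G x \<bullet> b) = (\<lambda>x. G x $ i $ j)" by (simp add: v(1) inner_axis)
    then show "(\<lambda>x. G x \<bullet> b) \<in> borel_measurable (lebesgue_on \<Omega>)" using Gc by simp
  qed
  show "u \<in> L2_on \<Omega>" using bounded_measurable_in_L2[OF lm um C(1)] .
  have "(LINT x|lebesgue_on \<Omega>. u x $ i * frechet_derivative \<phi> (at x) (axis j 1)) =
        - (LINT x|lebesgue_on \<Omega>. G x $ i $ j * \<phi> x)" if \<phi>: "test_function \<Omega> \<phi>" for \<phi> i j
  proof -
    obtain B where d\<phi>: "\<And>x. (\<phi> has_derivative frechet_derivative \<phi> (at x)) (at x)"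
      "\<And>b. b \<in> Basis \<Longrightarrow> continuous_on UNIV (\<lambda>x. frechet_derivative \<phi> (at x) b)"
      and B: "B \<ge> 0" "\<And>x. \<bar>\<phi> x\<bar> \<le> B" "\<And>x b. b \<in> Basis \<Longrightarrow> \<bar>frechet_derivative \<phi> (at x) b\<bar> \<le> B"
      using test_function_C1[OF \<phi>] by blast
    define K where "K = closure {x. \<phi> x \<noteq> 0}"
    have K: "compact K" "K \<subseteq> \<Omega>" using \<phi> by (auto simp: test_function_def K_def)
    have zero: "\<phi> x = 0" if "x \<notin> K" for x
      using that closure_subset[of "{x. \<phi> x \<noteq> 0}"] by (auto simp: K_def)
    define e :: "real^'n" where "e = axis j 1"
    have eB: "e \<in> Basis" by (simp add: e_def axis_in_Basis_iff)
    define f where "f = (\<lambda>x. if x \<in> \<Omega> then u x $ i * \<phi> x else 0)"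
    define D where "D = (\<lambda>x v. if x \<in> \<Omega> then u x $ i * frechet_derivative \<phi> (at x) v + (G x *v v) $ i * \<phi> x else 0)"
    have Df: "(f has_derivative D x) (at x)" for x
    proof (cases "x \<in> \<Omega>")
      case True
      have "((\<lambda>x. u x $ i) has_derivative (\<lambda>v. (G x *v v) $ i)) (at x)"
        by (rule bounded_linear.has_derivative[OF bounded_linear_vec_nth der[OF True]])
      then have "((\<lambda>x. u x $ i * \<phi> x) has_derivative D x) (at x)"
        unfolding D_def using True by (auto intro!: has_derivative_mult d\<phi>)
      then show ?thesis
        by (rule has_derivative_transform_within_open[OF _ \<Omega>(1) True]) (simp add: f_def)
    next
      case False
      have "((\<lambda>x. 0) has_derivative D x) (at x)" using False by (simp add: D_def)
      then show ?thesis
        by (rule has_derivative_transform_within_open[of _ _ _ _ "- K"])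
          (use False K zero in \<open>auto simp: f_def compact_imp_closed\<close>)
    qed
    have Gb: "\<bar>G x $ i $ j\<bar> \<le> C" if "x \<in> \<Omega>" for x
      using C(2)[OF that] component_le_norm_cart[of "G x $ i" j] Finite_Cartesian_Product.norm_nth_le[of "G x" i]
      by linarith
    have ub: "\<bar>u x $ i\<bar> \<le> C" if "x \<in> \<Omega>" for x
      using C(1)[OF that] component_le_norm_cart[of "u x" i] by linarith
    have De: "D x e = indicator \<Omega> x *\<^sub>R (u x $ i * frechet_derivative \<phi> (at x) e + G x $ i $ j * \<phi> x)" for x
      by (simp add: D_def e_def matrix_vector_mult_basis column_def)
    have b1: "\<bar>u x $ i * frechet_derivative \<phi> (at x) e\<bar> \<le> C * B" if "x \<in> \<Omega>" for x
      using mult_mono[OF ub[OF that] B(3)[OF eB, of x]] ub[OF that] by (simp add: abs_mult)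
    have b2: "\<bar>G x $ i $ j * \<phi> x\<bar> \<le> C * B" if "x \<in> \<Omega>" for x
      using mult_mono[OF Gb[OF that] B(2)[of x]] Gb[OF that] by (simp add: abs_mult)
    have C0: "\<Omega> \<noteq> {} \<Longrightarrow> C \<ge> 0" using C(1) norm_ge_zero order_trans by (metis all_not_in_conv)
    have Db: "\<bar>D x e\<bar> \<le> 2 * \<bar>C * B\<bar>" for x
    proof (cases "x \<in> \<Omega>")
      case True
      show ?thesis
        using b1[OF True] b2[OF True] abs_ge_self[of "C * B"] True
          abs_triangle_ineq[of "u x $ i * frechet_derivative \<phi> (at x) e" "G x $ i $ j * \<phi> x"]
        by (simp add: De)
    qed (simp add: De)
    note I = integral_directional_derivative_eq_0[of f D K e, OF Df K(1) _ Db]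
    have fz: "f x = 0" if "x \<notin> K" for x using zero[OF that] by (simp add: f_def)
    have \<phi>m: "\<phi> \<in> borel_measurable (lebesgue_on \<Omega>)" "(\<lambda>x. frechet_derivative \<phi> (at x) e) \<in> borel_measurable (lebesgue_on \<Omega>)"
    proof -
      have "continuous_on \<Omega> \<phi>"
        by (rule has_derivative_continuous_on[OF has_derivative_at_withinI[OF d\<phi>(1)]])
      moreover have "continuous_on \<Omega> (\<lambda>x. frechet_derivative \<phi> (at x) e)"
        using d\<phi>(2)[OF eB] continuous_on_subset by blast
      ultimately show "\<phi> \<in> borel_measurable (lebesgue_on \<Omega>)"
        "(\<lambda>x. frechet_derivative \<phi> (at x) e) \<in> borel_measurable (lebesgue_on \<Omega>)"
        using sL by (auto intro: continuous_imp_measurable_on_sets_lebesgue)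
    qed
    have i1: "integrable (lebesgue_on \<Omega>) (\<lambda>x. u x $ i * frechet_derivative \<phi> (at x) e)"
      by (rule integrable_const_bound[of _ "C * B"])
        (use b1 um \<phi>m in \<open>auto intro!: AE_I2 borel_measurable_times borel_measurable_vec_nth\<close>)
    have i2: "integrable (lebesgue_on \<Omega>) (\<lambda>x. G x $ i $ j * \<phi> x)"
      by (rule integrable_const_bound[of _ "C * B"])
        (use b2 Gc \<phi>m in \<open>auto intro!: AE_I2 borel_measurable_times\<close>)
    have "(LINT x|lebesgue_on \<Omega>. u x $ i * frechet_derivative \<phi> (at x) e + G x $ i $ j * \<phi> x) = (LINT x|lebesgue. D x e)"
      by (subst integral_restrict_space) (use sL De in auto)
    also have "\<dots> = (LINT x|lborel. D x e)"
      using I(1)[OF fz] by (intro integral_completion) simp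
    also have "\<dots> = 0" by (rule I(2)[OF fz])
    finally show ?thesis
      using Bochner_Integration.integral_add[OF i1 i2] by (simp add: e_def)
  qed
  then show "has_L2_weak_gradient \<Omega> u G"
    using bounded_measurable_in_L2[OF lm Gm C(2)] by (simp add: has_L2_weak_gradient_def)
qed

text \<open>Cutoffs increasing to the indicator of an open set \<open>V\<close> show that the integral of \<open>g\<close> over \<open>V\<close>
  vanishes, and the open sets form an intersection-stable generator of the Borel sets.\<close>

lemma fundamental_lemma_calculus_of_variations:
  fixes g :: "real^'n \<Rightarrow> real"
  assumes \<Omega>: "open \<Omega>" and g: "integrable (lebesgue_on \<Omega>) g"
    and 0: "\<And>\<phi>. test_function \<Omega> \<phi> \<Longrightarrow> (LINT x|lebesgue_on \<Omega>. g x * \<phi> x) = 0"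
  shows "AE x in lebesgue_on \<Omega>. g x = 0"
proof -
  let ?M = "lebesgue_on \<Omega>"
  have sL: "\<Omega> \<in> sets lebesgue" using \<Omega> by (simp add: borel_open sets_completionI_sets)
  have bM: "A \<inter> \<Omega> \<in> sets ?M" if "A \<in> sets borel" for A
    using that sL by (auto simp: sets_restrict_space_iff intro!: sets.Int)
  note gm = borel_measurable_integrable[OF g]
  have open0: "(LINT x:(V \<inter> \<Omega>)|?M. g x) = 0" if "open V" for V
  proof -
    have op: "open (V \<inter> \<Omega>)" using \<Omega> that by blast
    obtain C :: "nat \<Rightarrow> (real^'n) set" where C: "\<And>n. compact (C n)" "\<And>n. C n \<subseteq> V \<inter> \<Omega>"
      "\<And>n. C n \<subseteq> interior (C (Suc n))" "\<Union> (range C) = V \<inter> \<Omega>"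
      using open_Union_compact_subsets[OF op] by metis
    have "\<exists>\<phi> :: real^'n \<Rightarrow> real. test_function \<Omega> \<phi> \<and> (\<forall>x. 0 \<le> \<phi> x \<and> \<phi> x \<le> 1) \<and> (\<forall>x\<in>C n. \<phi> x = 1)
        \<and> (\<forall>x. x \<notin> V \<inter> \<Omega> \<longrightarrow> \<phi> x = 0)" for n
    proof -
      obtain \<eta> :: "real^'n \<Rightarrow> real" and K' where \<eta>: "\<And>k. Ck_on k UNIV \<eta>" "\<And>x. 0 \<le> \<eta> x" "\<And>x. \<eta> x \<le> 1"
        "\<And>x. x \<in> C n \<Longrightarrow> \<eta> x = 1" "compact K'" "K' \<subseteq> V \<inter> \<Omega>" "\<And>x. x \<notin> K' \<Longrightarrow> \<eta> x = 0"
        using smooth_cutoff[OF C(1) op C(2), of n] by blast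
      have "closure {x. \<eta> x \<noteq> 0} \<subseteq> K'"
        using \<eta>(5,7) by (intro closure_minimal compact_imp_closed) auto
      moreover from this have "compact (closure {x. \<eta> x \<noteq> 0})"
        using \<eta>(5) by (meson closed_closure compact_Int_closed compact_eq_bounded_closed bounded_subset)
      ultimately have "test_function \<Omega> \<eta>"
        using \<eta>(1,6) by (auto simp: test_function_def smooth_on_def)
      then show ?thesis using \<eta>(2,3,4,6,7) by (intro exI[of _ \<eta>]) blast
    qed
    then obtain \<phi> where \<phi>: "\<And>n. test_function \<Omega> (\<phi> n)" "\<And>n x. 0 \<le> \<phi> n x" "\<And>n x. \<phi> n x \<le> 1"
      "\<And>n x. x \<in> C n \<Longrightarrow> \<phi> n x = 1" "\<And>n x. x \<notin> V \<inter> \<Omega> \<Longrightarrow> \<phi> n x = 0" by metis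
    have mono: "C m \<subseteq> C n" if "m \<le> n" for m n
      using lift_Suc_mono_le[of C m n] C(3) interior_subset that by blast
    have lim: "(\<lambda>n. g x * \<phi> n x) \<longlonglongrightarrow> indicator (V \<inter> \<Omega>) x *\<^sub>R g x" for x
    proof (cases "x \<in> V \<inter> \<Omega>")
      case True
      then obtain m where "x \<in> C m" using C(4) by blast
      then have "\<forall>n\<ge>m. g x * \<phi> n x = indicator (V \<inter> \<Omega>) x *\<^sub>R g x" using mono \<phi>(4) True by (simp add: subset_eq)
      then show ?thesis by (intro tendsto_eventually) (auto simp: eventually_sequentially)
    next
      case False
      then show ?thesis using \<phi>(5) by simp
    qed
    have \<phi>m: "\<phi> n \<in> borel_measurable ?M" for n
    proof -
      have "continuous_on UNIV (\<phi> n)" using \<phi>(1)[of n] Ck_on_imp_continuous_on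
        unfolding test_function_def smooth_on_def by blast
      then show ?thesis
        using continuous_imp_measurable_on_sets_lebesgue[OF _ sL] continuous_on_subset by blast
    qed
    have "(\<lambda>n. LINT x|?M. g x * \<phi> n x) \<longlonglongrightarrow> (LINT x|?M. indicator (V \<inter> \<Omega>) x *\<^sub>R g x)"
    proof (rule integral_dominated_convergence[where w="\<lambda>x. norm (g x)"])
      show "(\<lambda>x. indicator (V \<inter> \<Omega>) x *\<^sub>R g x) \<in> borel_measurable ?M"
        using bM[of V] that gm by (intro borel_measurable_scaleR borel_measurable_indicator) auto
      show "AE x in ?M. norm (g x * \<phi> n x) \<le> norm (g x)" for n
        using \<phi>(2,3)[of n] by (auto simp: abs_mult intro!: AE_I2 mult_left_le)
    qed (use g gm \<phi>m lim in auto)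
    then show ?thesis
      using 0[OF \<phi>(1)] by (simp add: set_lebesgue_integral_def LIMSEQ_const_iff)
  qed
  have si: "set_integrable ?M A g" if "A \<in> sets ?M" for A
    using that g unfolding set_integrable_def by (rule integrable_mult_indicator)
  have borel0: "(LINT x:(A \<inter> \<Omega>)|?M. g x) = 0" if A: "A \<in> sigma_sets UNIV {S. open S}" for A
  proof -
    have "Int_stable {S. open (S :: (real^'n) set)}" "{S. open (S :: (real^'n) set)} \<subseteq> Pow UNIV"
      by (auto simp: Int_stable_def)
    from this A show ?thesis
    proof (induction A rule: sigma_sets_induct_disjoint)
      case (basic A)
      then show ?case using open0 by simp
    next
      case empty
      then show ?case by (simp add: set_lebesgue_integral_def)
    next
      case (compl A)
      then have A: "A \<in> sets borel" by (simp add: borel_def)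
      have "(LINT x:((UNIV - A) \<inter> \<Omega> \<union> (A \<inter> \<Omega>))|?M. g x) = (LINT x:((UNIV - A) \<inter> \<Omega>)|?M. g x) + (LINT x:(A \<inter> \<Omega>)|?M. g x)"
        by (rule set_integral_Un) (use si bM A in auto)
      moreover have "(UNIV - A) \<inter> \<Omega> \<union> (A \<inter> \<Omega>) = UNIV \<inter> \<Omega>" by blast
      ultimately show ?case using open0[of UNIV] compl by simp
    next
      case (union A)
      then have A: "A i \<in> sets borel" for i by (auto simp: borel_def)
      have "(LINT x:(\<Union>i. A i \<inter> \<Omega>)|?M. g x) = (\<Sum>i. (LINT x:(A i \<inter> \<Omega>)|?M. g x))"
      proof (rule lebesgue_integral_countable_add)
        show "A i \<inter> \<Omega> \<inter> (A j \<inter> \<Omega>) = {}" if "i \<noteq> j" for i j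
          using union(1) that unfolding disjoint_family_on_def by blast
        have "(\<Union>i. A i \<inter> \<Omega>) \<in> sets ?M" using bM A by blast
        then show "set_integrable ?M (\<Union>i. A i \<inter> \<Omega>) g" by (rule si)
      qed (use bM A in auto)
      then show ?case using union(3) by simp
    qed
  qed
  show ?thesis
  proof (rule density_unique_real[OF g, of "\<lambda>_. 0"])
    fix A assume "A \<in> sets ?M"
    then have A: "A \<in> sets lebesgue" "A \<subseteq> \<Omega>" using sL by (auto simp: sets_restrict_space_iff)
    \<comment> \<open>Every Lebesgue measurable set is Borel up to a subset of a null set, which
      reduces the claim to the Borel case.\<close>
    obtain S N N' where S: "A = S \<union> N" "N \<subseteq> N'" "N' \<in> null_sets lborel" "S \<in> sets lborel"
      using sets_completionE[OF A(1)] by metis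
    have "AE x in lebesgue. x \<notin> N'"
      using S(3) AE_not_in null_sets_completionI by blast
    then have "AE x in ?M. x \<notin> N'" by (auto simp: AE_restrict_space_iff sL elim: eventually_mono)
    then have "AE x in ?M. indicator A x *\<^sub>R g x = indicator (S \<inter> \<Omega>) x *\<^sub>R g x"
      using A(2) S(1,2) by (auto simp: indicator_def elim!: eventually_mono)
    then have "(LINT x:A|?M. g x) = (LINT x:(S \<inter> \<Omega>)|?M. g x)"
      unfolding set_lebesgue_integral_def
      using \<open>A \<in> sets ?M\<close> bM[of S] S(4) gm
      by (intro integral_cong_AE borel_measurable_scaleR borel_measurable_indicator) auto
    also have "\<dots> = 0" using borel0 S(4) by (simp add: borel_def)
    finally show "(LINT x:A|?M. g x) = (LINT x:A|?M. 0)" by (simp add: set_lebesgue_integral_def)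
  qed simp
qed

lemma test_function_has_bound:
  "test_function \<Omega> \<phi> \<Longrightarrow> \<phi> \<in> borel_measurable borel \<and> (\<exists>C. \<forall>x. \<bar>\<phi> x\<bar> \<le> C)"
proof -
  assume \<phi>: "test_function \<Omega> \<phi>"
  have "continuous_on UNIV \<phi>"
    using \<phi> Ck_on_imp_continuous_on unfolding test_function_def smooth_on_def by blast
  then show ?thesis
    using test_function_C1[OF \<phi>] borel_measurable_continuous_onI by metis
qed

lemma weak_gradient_unique:
  fixes u :: "real^'n \<Rightarrow> real^'m"
  assumes \<Omega>: "open \<Omega>" "bounded \<Omega>"
    and G: "has_L2_weak_gradient \<Omega> u G" and H: "has_L2_weak_gradient \<Omega> u H"
  shows "AE x in lebesgue_on \<Omega>. G x = H x"
proof -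
  let ?M = "lebesgue_on \<Omega>"
  have lm: "\<Omega> \<in> lmeasurable" using \<Omega> by (simp add: lmeasurable_open)
  then have sL: "\<Omega> \<in> sets lebesgue" by (simp add: fmeasurableD)
  interpret finite_measure ?M using lm by (rule finite_measure_lebesgue_on)
  \<comment> \<open>On a set of finite measure square integrability gives integrability through
    \<open>t \<le> 1 + t^2\<close>, which makes the fundamental lemma applicable.\<close>
  have L1: "integrable ?M (\<lambda>x. F x $ i $ j)" if "F \<in> L2_on \<Omega>" for F :: "real^'n \<Rightarrow> real^'n^'m" and i j
  proof (rule Bochner_Integration.integrable_bound)
    show "integrable ?M (\<lambda>x. 1 + (norm (F x))\<^sup>2)"
      using that by (simp add: L2_on_def)
    have "F \<in> borel_measurable ?M" using that by (simp add: L2_on_def)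
    then show "(\<lambda>x. F x $ i $ j) \<in> borel_measurable ?M"
      by (intro borel_measurable_vec_nth)
    have "\<bar>F x $ i $ j\<bar> \<le> 1 + (norm (F x))\<^sup>2" for x
    proof -
      have "\<bar>F x $ i $ j\<bar> \<le> norm (F x)"
        using component_le_norm_cart[of "F x $ i" j] Finite_Cartesian_Product.norm_nth_le[of "F x" i] by linarith
      moreover have "0 \<le> (norm (F x) - 1)\<^sup>2" by simp
      ultimately show ?thesis using norm_ge_zero[of "F x"] by (simp add: power2_diff)
    qed
    then show "AE x in ?M. norm (F x $ i $ j) \<le> norm (1 + (norm (F x))\<^sup>2)" by auto
  qed
  have Gi: "integrable ?M (\<lambda>x. G x $ i $ j)" and Hi: "integrable ?M (\<lambda>x. H x $ i $ j)" for i j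
    using L1 G H by (auto simp: has_L2_weak_gradient_def)
  have "AE x in ?M. G x $ i $ j - H x $ i $ j = 0" for i j
  proof (rule fundamental_lemma_calculus_of_variations[OF \<Omega>(1)])
    show "integrable ?M (\<lambda>x. G x $ i $ j - H x $ i $ j)" using Gi Hi by simp
    fix \<phi> assume \<phi>: "test_function \<Omega> \<phi>"
    obtain C where C: "\<And>x. \<bar>\<phi> x\<bar> \<le> C" and \<phi>b: "\<phi> \<in> borel_measurable borel"
      using test_function_has_bound[OF \<phi>] by blast
    have \<phi>m: "\<phi> \<in> borel_measurable ?M"
      using \<phi>b by (simp add: measurable_completion measurable_restrict_space1)
    have int: "integrable ?M (\<lambda>x. F x * \<phi> x)" if F: "integrable ?M F" for F
    proof (rule Bochner_Integration.integrable_bound)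
      show "integrable ?M (\<lambda>x. C * \<bar>F x\<bar>)" using F by simp
      show "(\<lambda>x. F x * \<phi> x) \<in> borel_measurable ?M" using F \<phi>m by simp
      have "\<bar>F x * \<phi> x\<bar> \<le> C * \<bar>F x\<bar>" for x
        using mult_left_mono[OF C[of x], of "\<bar>F x\<bar>"] by (simp add: abs_mult mult.commute)
      then show "AE x in ?M. norm (F x * \<phi> x) \<le> norm (C * \<bar>F x\<bar>)"
        by (intro AE_I2) (metis abs_ge_self order_trans real_norm_def)
    qed
    have "(LINT x|?M. u x $ i * frechet_derivative \<phi> (at x) (axis j 1)) = - (LINT x|?M. F x $ i $ j * \<phi> x)"
      if "has_L2_weak_gradient \<Omega> u F" for F
      using that \<phi> unfolding has_L2_weak_gradient_def by blast
    from this[OF G] this[OF H]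
    have "(LINT x|?M. G x $ i $ j * \<phi> x) = (LINT x|?M. H x $ i $ j * \<phi> x)" by linarith
    then show "(LINT x|?M. (G x $ i $ j - H x $ i $ j) * \<phi> x) = 0"
      using Bochner_Integration.integral_diff[OF int[OF Gi] int[OF Hi]] by (simp add: left_diff_distrib)
  qed
  then have "AE x in ?M. \<forall>i\<in>UNIV. \<forall>j\<in>UNIV. G x $ i $ j - H x $ i $ j = 0"
    by (intro AE_finite_allI) simp_all
  then show ?thesis by eventually_elim (simp add: vec_eq_iff)
qed

text \<open>\<open>weak_gradient\<close> picks an arbitrary representative; its agreement with
  \<open>G\<close> almost everywhere is what allows the energy to be computed from the classical
  gradient.\<close>

lemma weak_gradient_classical:
  fixes u :: "real^'n \<Rightarrow> real^'m" and G :: "real^'n \<Rightarrow> real^'n^'m"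
  assumes "open \<Omega>" "bounded \<Omega>"
    and "\<And>x. x \<in> \<Omega> \<Longrightarrow> (u has_derivative (\<lambda>v. G x *v v)) (at x)"
    and "\<And>x. x \<in> \<Omega> \<Longrightarrow> norm (u x) \<le> C" "\<And>x. x \<in> \<Omega> \<Longrightarrow> norm (G x) \<le> C"
  shows "u \<in> W12 \<Omega>" "AE x in lebesgue_on \<Omega>. weak_gradient \<Omega> u x = G x"
proof -
  have w: "u \<in> L2_on \<Omega>" "has_L2_weak_gradient \<Omega> u G"
    using classical_gradient_is_weak[of \<Omega> u G C] assms by blast+
  show "u \<in> W12 \<Omega>" using w by (auto simp: W12_def)
  have "has_L2_weak_gradient \<Omega> u (weak_gradient \<Omega> u)"
    unfolding weak_gradient_def using w(2) by (rule someI[where P="has_L2_weak_gradient \<Omega> u"])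
  then show "AE x in lebesgue_on \<Omega>. weak_gradient \<Omega> u x = G x"
    using weak_gradient_unique[OF assms(1,2) _ w(2)] by blast
qed

section \<open>Integration along lines and smooth extensions\<close>

text \<open>The integral of \<open>f\<close> along the horizontal segment from the axis
  \<open>x $ 1 = 0\<close> to \<open>x\<close>, rescaled to a fixed interval. This lets continuity
  in a parameter and differentiation under the integral sign apply, and covers negative
  \<open>x $ 1\<close> with the correct sign.\<close>

definition line_integral :: "(real^2 \<Rightarrow> real) \<Rightarrow> real^2 \<Rightarrow> real" where
  "line_integral f x = integral {0..1} (\<lambda>s. x $ 1 * f (vector [s * x $ 1, x $ 2]))"

lemma continuous_on_vector2 [continuous_intros]:
  assumes "continuous_on A f" "continuous_on A g"
  shows "continuous_on A (\<lambda>x. vector [f x, g x] :: real^2)"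
proof -
  have eq: "(\<lambda>x. vector [f x, g x] :: real^2) = (\<lambda>x. f x *\<^sub>R axis 1 1 + g x *\<^sub>R axis 2 1)"
    by (simp add: fun_eq_iff vec_eq_iff forall_2 axis_def)
  show ?thesis unfolding eq by (intro continuous_intros assms)
qed

lemma continuous_on_line_integral:
  assumes "continuous_on UNIV f"
  shows "continuous_on UNIV (line_integral f)"
  unfolding line_integral_def[abs_def] cbox_interval[symmetric]
  by (rule integral_continuous_on_param)
    (auto simp: split_beta intro!: continuous_intros continuous_on_compose2[OF assms])

lemma antiderivative_integral:
  fixes g :: "real \<Rightarrow> real"
  assumes g: "continuous_on UNIV g"
  shows "((\<lambda>t. integral {0..1} (\<lambda>s. t * g (s * t))) has_real_derivative g t) (at t)"
proof -
  \<comment> \<open>A symmetric interval contains \<open>0\<close> and all points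
    \<open>s * y\<close> for \<open>y\<close> near \<open>t\<close>, whatever the sign of
    \<open>t\<close>.\<close>
  define R where "R = \<bar>t\<bar> + 1"
  obtain G where G: "\<And>x. x \<in> {-R..R} \<Longrightarrow> (G has_vector_derivative g x) (at x within {-R..R})"
    using antiderivative_continuous[of "-R" R g] continuous_on_subset[OF g] by auto
  have eq: "integral {0..1} (\<lambda>s. y * g (s * y)) = G y - G 0" if y: "\<bar>y\<bar> < R" for y
  proof -
    have "((\<lambda>s. y * g (s * y)) has_integral (G (1 * y) - G (0 * y))) {0..1}"
    proof (rule fundamental_theorem_of_calculus)
      fix s :: real assume s: "s \<in> {0..1}"
      have "\<bar>s * y\<bar> \<le> \<bar>y\<bar>" using s by (simp add: abs_mult mult_left_le_one_le)
      then have sy: "-R < s * y" "s * y < R" using y by linarith+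
      then have "(G has_vector_derivative g (s * y)) (at (s * y))"
        using G[of "s * y"] at_within_interior[of "s * y" "{-R..R}"] by simp
      then have "(G has_real_derivative g (s * y)) (at (s * y))"
        by (simp add: has_real_derivative_iff_has_vector_derivative)
      then have "((\<lambda>s. G (s * y)) has_real_derivative g (s * y) * y) (at s)"
        by (rule DERIV_chain2) (auto intro!: derivative_eq_intros)
      then show "((\<lambda>s. G (s * y)) has_vector_derivative y * g (s * y)) (at s within {0..1})"
        by (simp add: has_real_derivative_iff_has_vector_derivative[symmetric] has_field_derivative_at_within mult.commute)
    qed simp
    then have "integral {0..1} (\<lambda>s. y * g (s * y)) = G (1 * y) - G (0 * y)" by (rule integral_unique)
    then show ?thesis by simp
  qed
  have t: "-R < t" "t < R" by (auto simp: R_def)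
  then have "(G has_vector_derivative g t) (at t)"
    using G[of t] at_within_interior[of t "{-R..R}"] by simp
  then have "((\<lambda>y. G y - G 0) has_real_derivative g t) (at t)"
    by (auto simp: has_real_derivative_iff_has_vector_derivative[symmetric] intro!: derivative_eq_intros)
  then show ?thesis
    by (rule has_field_derivative_transform_within_open[of _ _ _ "{-R<..<R}"]) (use t eq in auto)
qed

text \<open>The first partial derivative is the fundamental theorem of calculus, the second is
  differentiation under the integral. Existence of both, together with joint continuity of the
  second, \<open>line_integral f2\<close>, yields the total derivative; the type of bounded linear
  functions enters only to express that continuity.\<close>

lemma has_derivative_line_integral:
  assumes f: "\<And>x. (f has_derivative (\<lambda>v. f1 x * v $ 1 + f2 x * v $ 2)) (at x)"
    and f2: "continuous_on UNIV f2"
  shows "(line_integral f has_derivative (\<lambda>v. f x * v $ 1 + line_integral f2 x * v $ 2)) (at x)"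
proof -
  define J where "J = (\<lambda>g t y. integral {0..1} (\<lambda>s. t * g (vector [s * t, y] :: real^2)) :: real)"
  have fc: "continuous_on UNIV f"
    by (rule has_derivative_continuous_on[OF f])
  have dx: "((\<lambda>t. J f t y) has_derivative (\<lambda>d. f (vector [t, y]) * d)) (at t within UNIV)" for t y
  proof -
    have "continuous_on UNIV (\<lambda>s. f (vector [s, y]))"
      by (intro continuous_on_compose2[OF fc] continuous_intros) auto
    from antiderivative_integral[OF this, of t] show ?thesis
      by (simp add: J_def has_field_derivative_def)
  qed
  have dy: "((\<lambda>y. J f t y) has_derivative blinfun_apply (blinfun_scaleR_left (J f2 t y))) (at y within UNIV)" for t y
  proof -
    have "((\<lambda>y. integral (cbox 0 1) (\<lambda>s. t * f (vector [s * t, y]))) has_real_derivative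
        integral (cbox 0 1) (\<lambda>s. t * f2 (vector [s * t, y]))) (at y within UNIV)"
    proof (rule leibniz_rule_field_derivative)
      fix y s
      have "((\<lambda>y. vector [s * t, y] :: real^2) has_derivative (\<lambda>d. d *\<^sub>R axis 2 1)) (at y)"
      proof -
        have "(\<lambda>y. vector [s * t, y] :: real^2) = (\<lambda>y. (s * t) *\<^sub>R axis 1 1 + y *\<^sub>R axis 2 1)"
          by (simp add: fun_eq_iff vec_eq_iff forall_2 axis_def)
        then show ?thesis by (auto intro!: derivative_eq_intros)
      qed
      from has_derivative_compose[OF this f]
      have "((\<lambda>y. f (vector [s * t, y])) has_real_derivative f2 (vector [s * t, y])) (at y)"
        by (simp add: has_field_derivative_def axis_def)
      then show "((\<lambda>y. t * f (vector [s * t, y])) has_real_derivative t * f2 (vector [s * t, y])) (at y within UNIV)"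
        by (auto intro!: derivative_eq_intros)
    next
      show "(\<lambda>s. t * f (vector [s * t, y])) integrable_on cbox 0 1" for y
        by (intro integrable_continuous continuous_intros continuous_on_compose2[OF fc]) auto
      show "continuous_on (UNIV \<times> cbox 0 1) (\<lambda>(y, s). t * f2 (vector [s * t, y]))"
        unfolding split_beta by (intro continuous_intros continuous_on_compose2[OF f2]) auto
    qed auto
    moreover have "blinfun_apply (blinfun_scaleR_left c) = (*) c" for c :: real
      by (simp add: fun_eq_iff)
    ultimately show ?thesis by (simp add: J_def has_field_derivative_def)
  qed
  have Jc: "continuous_on UNIV (\<lambda>(t, y). J f2 t y)"
  proof -
    have "continuous_on UNIV (\<lambda>z. line_integral f2 (vector [fst z, snd z]))"
      by (intro continuous_on_compose2[OF continuous_on_line_integral[OF f2]] continuous_intros) auto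
    then show ?thesis by (simp add: J_def line_integral_def split_beta)
  qed
  have "((\<lambda>(t, y). J f t y) has_derivative
      (\<lambda>(tx, ty). f (vector [x $ 1, x $ 2]) * tx + blinfun_apply (blinfun_scaleR_left (J f2 (x $ 1) (x $ 2))) ty))
      (at (x $ 1, x $ 2) within UNIV \<times> UNIV)"
  proof (rule has_derivative_partialsI)
    show "((\<lambda>t. J f t (x $ 2)) has_derivative (*) (f (vector [x $ 1, x $ 2]))) (at (x $ 1) within UNIV)"
      by (rule dx)
    show "((\<lambda>y. J f t y) has_derivative blinfun_apply (blinfun_scaleR_left (J f2 t y))) (at y within UNIV)" for t y
      by (rule dy)
    have "isCont (\<lambda>(t, y). J f2 t y) (x $ 1, x $ 2)"
      using Jc by (simp add: continuous_on_eq_continuous_at)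
    then have "isCont (\<lambda>z. blinfun_scaleR_left (J f2 (fst z) (snd z)) :: real \<Rightarrow>\<^sub>L real) (x $ 1, x $ 2)"
      unfolding split_beta
      by (rule bounded_linear.continuous[OF bounded_linear_blinfun_scaleR_left])
    then show "continuous (at (x $ 1, x $ 2) within UNIV \<times> UNIV)
        (\<lambda>(x, y). blinfun_scaleR_left (J f2 x y) :: real \<Rightarrow>\<^sub>L real)"
      by (simp add: case_prod_unfold)
  qed auto
  moreover have "(vector [x $ 1, x $ 2] :: real^2) = x" by (simp add: vec_eq_iff forall_2)
  ultimately have JD: "((\<lambda>z. J f (fst z) (snd z)) has_derivative
      (\<lambda>z. f x * fst z + line_integral f2 x * snd z)) (at (x $ 1, x $ 2))"
    by (simp add: J_def line_integral_def case_prod_unfold mult.commute)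
  have lin: "((\<lambda>x. (x $ 1, x $ 2)) has_derivative (\<lambda>v. (v $ 1, v $ 2))) (at x)" for x :: "real^2"
    by (intro has_derivative_Pair bounded_linear.has_derivative[OF bounded_linear_vec_nth] has_derivative_ident)
  from has_derivative_compose[OF lin JD]
  show ?thesis by (simp add: J_def line_integral_def[abs_def])
qed

lemma Ck_on_planar_SucE:
  fixes f :: "real^2 \<Rightarrow> real"
  assumes "Ck_on (Suc k) U f"
  obtains f1 f2 where "\<And>x. x \<in> U \<Longrightarrow> (f has_derivative (\<lambda>v. f1 x * v $ 1 + f2 x * v $ 2)) (at x)"
    "Ck_on k U f1" "Ck_on k U f2"
proof -
  from assms obtain D where D: "\<And>x. x \<in> U \<Longrightarrow> (f has_derivative D x) (at x)"
    "\<And>b. b \<in> Basis \<Longrightarrow> Ck_on k U (\<lambda>x. D x b)" by (rule Ck_on_SucE) blast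
  have E: "D x = (\<lambda>v. D x (axis 1 1) * v $ 1 + D x (axis 2 1) * v $ 2)" if "x \<in> U" for x
  proof
    fix v :: "real^2"
    have v: "v = (v $ 1) *\<^sub>R axis 1 1 + (v $ 2) *\<^sub>R axis 2 1"
      by (simp add: vec_eq_iff forall_2 axis_def)
    note lin = has_derivative_linear[OF D(1)[OF that]]
    have "D x v = D x ((v $ 1) *\<^sub>R axis 1 1 + (v $ 2) *\<^sub>R axis 2 1)" using v by simp
    also have "\<dots> = D x (axis 1 1) * v $ 1 + D x (axis 2 1) * v $ 2"
      by (simp only: linear_add[OF lin] linear_cmul[OF lin] real_scaleR_def mult.commute)
    finally show "D x v = D x (axis 1 1) * v $ 1 + D x (axis 2 1) * v $ 2" .
  qed
  have "(f has_derivative (\<lambda>v. D x (axis 1 1) * v $ 1 + D x (axis 2 1) * v $ 2)) (at x)" if "x \<in> U" for x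
    by (rule has_derivative_eq_rhs[OF D(1)[OF that] E[OF that]])
  then show thesis
    using that[of "\<lambda>x. D x (axis 1 1)" "\<lambda>x. D x (axis 2 1)"] D(2) by (simp add: axis_in_Basis_iff)
qed

text \<open>The induction closes because one partial derivative is \<open>f\<close> itself and the
  other is the line integral of a partial derivative of \<open>f\<close>.\<close>

lemma Ck_on_line_integral:
  "Ck_on k UNIV f \<Longrightarrow> Ck_on k UNIV (line_integral f)"
proof (induction k arbitrary: f)
  case 0
  then show ?case by (simp add: continuous_on_line_integral)
next
  case (Suc k)
  from Suc.prems obtain f1 f2 where f: "\<And>x. (f has_derivative (\<lambda>v. f1 x * v $ 1 + f2 x * v $ 2)) (at x)"
    "Ck_on k UNIV f1" "Ck_on k UNIV f2" by (rule Ck_on_planar_SucE) blast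
  show ?case
  proof (rule Ck_on_SucI)
    show "(line_integral f has_derivative (\<lambda>v. f x * v $ 1 + line_integral f2 x * v $ 2)) (at x)" for x
      by (rule has_derivative_line_integral[OF f(1) Ck_on_imp_continuous_on[OF f(3)]])
    show "Ck_on k UNIV (\<lambda>x. f x * b $ 1 + line_integral f2 x * b $ 2)" for b :: "real^2"
      by (intro Ck_on_add Ck_on_mult Ck_on_const Suc.IH f(3) Ck_on_Suc_imp[OF Suc.prems]) auto
  qed simp
qed

section \<open>Extension of the data to the whole space\<close>

lemma smooth_extension:
  fixes f :: "'a::euclidean_space \<Rightarrow> real"
  assumes "compact K" "open U" "K \<subseteq> U" "\<And>k. Ck_on k U f"
  obtains F where "\<And>k. Ck_on k UNIV F" "\<And>x. x \<in> K \<Longrightarrow> F x = f x"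
proof -
  obtain \<eta> :: "'a \<Rightarrow> real" and K' where C\<eta>: "\<And>k. Ck_on k UNIV \<eta>" and "\<And>x. 0 \<le> \<eta> x" "\<And>x. \<eta> x \<le> 1"
    and \<eta>: "\<And>x. x \<in> K \<Longrightarrow> \<eta> x = 1" "compact K'" "K' \<subseteq> U" "\<And>x. x \<notin> K' \<Longrightarrow> \<eta> x = 0"
    by (rule smooth_cutoff[OF assms(1-3)]) blast
  define F where "F = (\<lambda>x. if x \<in> U then \<eta> x * f x else 0)"
  have op: "open (- K')" using \<eta>(2) by (simp add: compact_imp_closed open_Compl)
  have "Ck_on k UNIV F" for k
  proof -
    have "Ck_on k U (\<lambda>x. \<eta> x * f x)"
      by (rule Ck_on_mult[OF assms(2) Ck_on_subset[OF C\<eta>] assms(4)]) simp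
    then have "Ck_on k U F"
      using Ck_on_cong[OF assms(2), of "\<lambda>x. \<eta> x * f x" F k] by (simp add: F_def)
    moreover have "Ck_on k (- K') F"
    proof (rule Ck_on_cong[OF op, THEN iffD1])
      show "Ck_on k (- K') (\<lambda>x. 0)" by (rule Ck_on_const[OF op])
      show "0 = F x" if "x \<in> - K'" for x using that \<eta>(4)[of x] by (simp add: F_def)
    qed
    ultimately have "Ck_on k (U \<union> - K') F" by (intro Ck_on_Un assms(2) op)
    moreover have "U \<union> - K' = UNIV" using \<eta>(3) by blast
    ultimately show ?thesis by simp
  qed
  moreover have "F x = f x" if "x \<in> K" for x
    using \<eta>(1)[OF that] assms(3) that by (auto simp: F_def)
  ultimately show thesis by (rule that)
qed

lemma smooth_up_to_entry_extension:
  fixes S :: "'a::euclidean_space \<Rightarrow> real^'n^'m"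
  assumes "compact K" "smooth_up_to K S"
  obtains F :: "'m \<Rightarrow> 'n \<Rightarrow> 'a \<Rightarrow> real"
    where "\<And>i j k. Ck_on k UNIV (F i j)" "\<And>i j x. x \<in> K \<Longrightarrow> F i j x = S x $ i $ j"
proof -
  obtain U g where U: "open U" "K \<subseteq> U" "\<And>k. Ck_on k U g" "\<And>x. x \<in> K \<Longrightarrow> S x = g x"
    using assms(2) unfolding smooth_up_to_def smooth_on_def by blast
  have "\<exists>F. (\<forall>k. Ck_on k UNIV F) \<and> (\<forall>x\<in>K. F x = g x $ i $ j)" for i j
  proof -
    have "Ck_on k U (\<lambda>x. g x $ i $ j)" for k
      using U by (intro Ck_on_bounded_linear[of U "\<lambda>A. A $ i $ j"]
        bounded_linear_compose[OF bounded_linear_vec_nth bounded_linear_vec_nth]) auto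
    from smooth_extension[OF assms(1) U(1,2) this] show ?thesis by metis
  qed
  then obtain F where "\<And>i j k. Ck_on k UNIV (F i j)" "\<And>i j x. x \<in> K \<Longrightarrow> F i j x = g x $ i $ j"
    by metis
  then show thesis using that[of F] U(4) by metis
qed

section \<open>Families with controlled derivatives\<close>

text \<open>Families are indexed by the thickness \<open>h \<in> (0,1)\<close>: \<open>tame\<close> bounds the values uniformly and the
  derivatives by a multiple of \<open>M h\<close>, and \<open>dominated\<close> bounds the values by a multiple of \<open>e h\<close>.\<close>

definition tame :: "'a::real_normed_vector set \<Rightarrow> (real \<Rightarrow> real) \<Rightarrow> (real \<Rightarrow> 'a \<Rightarrow> 'b::real_normed_vector) \<Rightarrow> bool" where
  "tame \<omega> M f \<longleftrightarrow> (\<exists>C\<ge>0. \<forall>h\<in>{0<..<1}. \<forall>x\<in>\<omega>. norm (f h x) \<le> C \<and>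
     (\<exists>D. (f h has_derivative D) (at x) \<and> (\<forall>v. norm (D v) \<le> C * M h * norm v)))"

definition dominated :: "(real \<Rightarrow> 'a set) \<Rightarrow> (real \<Rightarrow> real) \<Rightarrow> (real \<Rightarrow> 'a \<Rightarrow> 'b::real_normed_vector) \<Rightarrow> bool" where
  "dominated \<Omega> e f \<longleftrightarrow> (\<exists>C\<ge>0. \<forall>h\<in>{0<..<1}. \<forall>x\<in>\<Omega> h. norm (f h x) \<le> C * e h)"

lemma tame_imp_dominated: "tame \<omega> M f \<Longrightarrow> dominated (\<lambda>_. \<omega>) (\<lambda>_. 1) f"
  unfolding tame_def dominated_def by fastforce

lemma tame_param:
  fixes \<omega> :: "'a::real_normed_vector set" and r :: "real \<Rightarrow> 'b::real_normed_vector"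
  assumes "\<And>h. h \<in> {0<..<1} \<Longrightarrow> norm (r h) \<le> C" "\<And>h. h \<in> {0<..<1} \<Longrightarrow> 0 \<le> M h"
  shows "tame \<omega> M (\<lambda>h x. r h)"
  unfolding tame_def
proof (intro exI[of _ "max C 0"] conjI ballI exI[of _ "\<lambda>v. 0"] allI)
  fix h :: real assume h: "h \<in> {0<..<1}"
  show "norm (r h) \<le> max C 0" using assms(1)[OF h] by simp
  show "norm (0 :: 'b) \<le> max C 0 * M h * norm v" for v :: 'a using assms(2)[OF h] by simp
qed auto

lemma tame_const:
  "(\<And>h. h \<in> {0<..<1} \<Longrightarrow> 0 \<le> M h) \<Longrightarrow> tame \<omega> M (\<lambda>h x. c)"
  by (rule tame_param[of "\<lambda>h. c" "norm c"]) auto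

lemma tame_add:
  assumes "tame \<omega> M f" "tame \<omega> M g"
  shows "tame \<omega> M (\<lambda>h x. f h x + g h x)"
proof -
  obtain C1 C2 where C: "C1 \<ge> 0" "C2 \<ge> 0"
    and f: "\<And>h x. h \<in> {0<..<1} \<Longrightarrow> x \<in> \<omega> \<Longrightarrow> norm (f h x) \<le> C1 \<and>
      (\<exists>D. (f h has_derivative D) (at x) \<and> (\<forall>v. norm (D v) \<le> C1 * M h * norm v))"
    and g: "\<And>h x. h \<in> {0<..<1} \<Longrightarrow> x \<in> \<omega> \<Longrightarrow> norm (g h x) \<le> C2 \<and>
      (\<exists>D. (g h has_derivative D) (at x) \<and> (\<forall>v. norm (D v) \<le> C2 * M h * norm v))"
    using assms unfolding tame_def by metis
  show ?thesis unfolding tame_def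
  proof (intro exI[of _ "C1 + C2"] conjI ballI)
    fix h :: real and x assume hx: "h \<in> {0<..<1}" "x \<in> \<omega>"
    show "norm (f h x + g h x) \<le> C1 + C2"
      using f[OF hx] g[OF hx] by (intro norm_triangle_mono) auto
    obtain D E where D: "(f h has_derivative D) (at x)" "\<And>v. norm (D v) \<le> C1 * M h * norm v"
      and E: "(g h has_derivative E) (at x)" "\<And>v. norm (E v) \<le> C2 * M h * norm v"
      using f[OF hx] g[OF hx] by blast
    have "norm (D v + E v) \<le> (C1 + C2) * M h * norm v" for v
      using norm_triangle_mono[OF D(2) E(2), of v v] by (simp add: algebra_simps)
    then show "\<exists>D. ((\<lambda>x. f h x + g h x) has_derivative D) (at x) \<and> (\<forall>v. norm (D v) \<le> (C1 + C2) * M h * norm v)"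
      using has_derivative_add[OF D(1) E(1)] by blast
  qed (use C in simp)
qed

text \<open>Values are bounded independently of \<open>h\<close>, so in the product rule only the
  differentiated factor brings \<open>M h\<close>. Hence products of every kind stay in the class
  with the same rate \<open>M\<close>.\<close>

lemma tame_bilinear:
  assumes B: "bounded_bilinear B" and "tame \<omega> M f" "tame \<omega> M g"
  shows "tame \<omega> M (\<lambda>h x. B (f h x) (g h x))"
proof -
  obtain C1 C2 where C: "C1 \<ge> 0" "C2 \<ge> 0"
    and f: "\<And>h x. h \<in> {0<..<1} \<Longrightarrow> x \<in> \<omega> \<Longrightarrow> norm (f h x) \<le> C1 \<and>
      (\<exists>D. (f h has_derivative D) (at x) \<and> (\<forall>v. norm (D v) \<le> C1 * M h * norm v))"
    and g: "\<And>h x. h \<in> {0<..<1} \<Longrightarrow> x \<in> \<omega> \<Longrightarrow> norm (g h x) \<le> C2 \<and>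
      (\<exists>D. (g h has_derivative D) (at x) \<and> (\<forall>v. norm (D v) \<le> C2 * M h * norm v))"
    using assms(2,3) unfolding tame_def by metis
  obtain K where K: "K \<ge> 0" "\<And>a b. norm (B a b) \<le> norm a * norm b * K"
    using bounded_bilinear.nonneg_bounded[OF B] by blast
  show ?thesis unfolding tame_def
  proof (intro exI[of _ "2 * (C1 * C2 * K)"] conjI ballI)
    fix h :: real and x assume hx: "h \<in> {0<..<1}" "x \<in> \<omega>"
    have fx: "norm (f h x) \<le> C1" and gx: "norm (g h x) \<le> C2" using f[OF hx] g[OF hx] by auto
    have Bm: "norm (B a b) \<le> A * A' * K" if "norm a \<le> A" "norm b \<le> A'" "A \<ge> 0" for a b A A'
      using K(2)[of a b] mult_right_mono[OF mult_mono[OF that(1,2,3)] K(1)] by auto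
    have "norm (B (f h x) (g h x)) \<le> C1 * C2 * K" using Bm fx gx C by simp
    also have "\<dots> \<le> 2 * (C1 * C2 * K)" using C K(1) by simp
    finally show "norm (B (f h x) (g h x)) \<le> 2 * (C1 * C2 * K)" .
    obtain D E where D: "(f h has_derivative D) (at x)" "\<And>v. norm (D v) \<le> C1 * M h * norm v"
      and E: "(g h has_derivative E) (at x)" "\<And>v. norm (E v) \<le> C2 * M h * norm v"
      using f[OF hx] g[OF hx] by blast
    have "norm (B (f h x) (E v) + B (D v) (g h x)) \<le> 2 * (C1 * C2 * K) * M h * norm v" for v
    proof -
      have "norm (B (f h x) (E v)) \<le> C1 * (C2 * M h * norm v) * K" by (rule Bm[OF fx E(2) C(1)])
      moreover have "norm (B (D v) (g h x)) \<le> C1 * M h * norm v * C2 * K"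
        by (rule Bm[OF D(2) gx]) (use D(2)[of v] norm_ge_zero order_trans in blast)
      ultimately show ?thesis using norm_triangle_ineq[of "B (f h x) (E v)" "B (D v) (g h x)"]
        by (simp add: algebra_simps)
    qed
    then show "\<exists>D. ((\<lambda>x. B (f h x) (g h x)) has_derivative D) (at x) \<and> (\<forall>v. norm (D v) \<le> 2 * (C1 * C2 * K) * M h * norm v)"
      using bounded_bilinear.FDERIV[OF B D(1) E(1)] by blast
  qed (use C K in simp)
qed

lemmas tame_mult = tame_bilinear[OF bounded_bilinear_mult]
  and tame_scaleR = tame_bilinear[OF bounded_bilinear_scaleR]

lemma bounded_bilinear_cross3: "bounded_bilinear cross3"
  using bilinear_cross bilinear_conv_bounded_bilinear by blast

lemmas tame_cross3 = tame_bilinear[OF bounded_bilinear_cross3]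

text \<open>The small factor is credited to the derivative bound only; the values remain merely
  bounded. This is how \<open>\<epsilon>\<close> improves the rate \<open>M\<close> to
  \<open>\<epsilon> * M\<close> for the frame of the deformed surface.\<close>

lemma tame_scale_param:
  assumes "tame \<omega> M f" "\<And>h. h \<in> {0<..<1} \<Longrightarrow> 0 \<le> r h" "\<And>h. h \<in> {0<..<1} \<Longrightarrow> r h \<le> 1"
  shows "tame \<omega> (\<lambda>h. r h * M h) (\<lambda>h x. r h *\<^sub>R f h x)"
proof -
  obtain C where C: "C \<ge> 0"
    and f: "\<And>h x. h \<in> {0<..<1} \<Longrightarrow> x \<in> \<omega> \<Longrightarrow> norm (f h x) \<le> C \<and>
      (\<exists>D. (f h has_derivative D) (at x) \<and> (\<forall>v. norm (D v) \<le> C * M h * norm v))"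
    using assms(1) unfolding tame_def by metis
  show ?thesis unfolding tame_def
  proof (intro exI[of _ C] conjI ballI)
    fix h :: real and x assume hx: "h \<in> {0<..<1}" "x \<in> \<omega>"
    have r: "0 \<le> r h" "r h \<le> 1" using assms hx by auto
    have "norm (r h *\<^sub>R f h x) \<le> 1 * norm (f h x)"
      using r by (simp add: mult_left_le_one_le)
    then show "norm (r h *\<^sub>R f h x) \<le> C" using f[OF hx] by simp
    obtain D where D: "(f h has_derivative D) (at x)" "\<And>v. norm (D v) \<le> C * M h * norm v"
      using f[OF hx] by blast
    have "norm (r h *\<^sub>R D v) \<le> C * (r h * M h) * norm v" for v
      using mult_left_mono[OF D(2)[of v] r(1)] r(1) by (simp add: algebra_simps)
    then show "\<exists>D. ((\<lambda>x. r h *\<^sub>R f h x) has_derivative D) (at x) \<and> (\<forall>v. norm (D v) \<le> C * (r h * M h) * norm v)"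
      using has_derivative_scaleR_right[OF D(1), of "r h"] by blast
  qed (use C in simp)
qed

lemma tame_sin_cos:
  fixes \<omega> :: "(real^'n) set"
  assumes "\<And>h. h \<in> {0<..<1} \<Longrightarrow> \<bar>N h\<bar> \<le> M h"
  shows "tame \<omega> M (\<lambda>h x. sin (N h * x $ i))" "tame \<omega> M (\<lambda>h x. cos (N h * x $ i))"
proof -
  have lin: "((\<lambda>x. N h * x $ i) has_derivative (\<lambda>v. N h * v $ i)) (at x)" for h and x :: "real^'n"
    by (intro has_derivative_mult_right bounded_linear.has_derivative[OF bounded_linear_vec_nth] has_derivative_ident)
  have bd: "\<bar>N h * v $ i * t\<bar> \<le> 1 * M h * norm v" if "h \<in> {0<..<1}" "\<bar>t\<bar> \<le> 1" for h t and v :: "real^'n"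
  proof -
    have "\<bar>N h\<bar> * \<bar>v $ i\<bar> * \<bar>t\<bar> \<le> M h * norm v * 1"
      using assms[OF that(1)] component_le_norm_cart[of v i] that(2) abs_ge_zero[of "N h"] 
      by (intro mult_mono mult_nonneg_nonneg) (auto intro: order_trans simp del: abs_ge_zero)
    then show ?thesis by (simp add: abs_mult)
  qed
  show "tame \<omega> M (\<lambda>h x. sin (N h * x $ i))" unfolding tame_def
  proof (intro exI[of _ 1] conjI ballI)
    fix h :: real and x :: "real^'n" assume h: "h \<in> {0<..<1}"
    have "((\<lambda>x. sin (N h * x $ i)) has_derivative (\<lambda>v. N h * v $ i * cos (N h * x $ i))) (at x)"
      using has_derivative_sin[OF lin] by simp
    then show "\<exists>D. ((\<lambda>x. sin (N h * x $ i)) has_derivative D) (at x) \<and> (\<forall>v. norm (D v) \<le> 1 * M h * norm v)"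
      using bd[OF h abs_cos_le_one] by (intro exI) auto
  qed auto
  show "tame \<omega> M (\<lambda>h x. cos (N h * x $ i))" unfolding tame_def
  proof (intro exI[of _ 1] conjI ballI)
    fix h :: real and x :: "real^'n" assume h: "h \<in> {0<..<1}"
    have "((\<lambda>x. cos (N h * x $ i)) has_derivative (\<lambda>v. N h * v $ i * - sin (N h * x $ i))) (at x)"
      using has_derivative_cos[OF lin] by simp
    then show "\<exists>D. ((\<lambda>x. cos (N h * x $ i)) has_derivative D) (at x) \<and> (\<forall>v. norm (D v) \<le> 1 * M h * norm v)"
      using bd[OF h, of "- sin _"] by (intro exI) auto
  qed auto
qed

lemma tame_C1:
  fixes f :: "'a::euclidean_space \<Rightarrow> real"
  assumes "Ck_on 1 U f" "bounded \<omega>" "closure \<omega> \<subseteq> U" "\<And>h. h \<in> {0<..<1} \<Longrightarrow> 1 \<le> M h"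
  shows "tame \<omega> M (\<lambda>h. f)"
proof -
  have "compact (closure \<omega>)" using assms(2) by (simp add: compact_closure)
  then have bd: "\<exists>B. \<forall>x\<in>closure \<omega>. \<bar>g x\<bar> \<le> B" if "continuous_on U g" for g :: "'a \<Rightarrow> real"
  proof -
    have "bounded (g ` closure \<omega>)"
      using \<open>compact (closure \<omega>)\<close> continuous_on_subset[OF that assms(3)]
      by (intro compact_imp_bounded compact_continuous_image)
    then show ?thesis by (auto simp: bounded_iff)
  qed
  obtain D where D: "\<And>x. x \<in> U \<Longrightarrow> (f has_derivative D x) (at x)"
    "\<And>b. b \<in> Basis \<Longrightarrow> continuous_on U (\<lambda>x. D x b)"
    using assms(1) Ck_on_SucE[of 0 U f] by (metis One_nat_def Ck_on.simps(1))
  obtain B where B: "\<And>b x. b \<in> Basis \<Longrightarrow> x \<in> closure \<omega> \<Longrightarrow> \<bar>D x b\<bar> \<le> B b"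
    using bd[OF D(2)] by metis
  obtain B0 where B0: "\<And>x. x \<in> closure \<omega> \<Longrightarrow> \<bar>f x\<bar> \<le> B0"
    using bd[OF Ck_on_imp_continuous_on[OF assms(1)]] by blast
  define C where "C = \<bar>B0\<bar> + (\<Sum>b\<in>Basis. \<bar>B b\<bar>)"
  have sb: "0 \<le> (\<Sum>b\<in>Basis. \<bar>B b\<bar>)" by (simp add: sum_nonneg)
  show ?thesis unfolding tame_def
  proof (intro exI[of _ C] conjI ballI)
    fix h :: real and x assume h: "h \<in> {0<..<1}" and "x \<in> \<omega>"
    then have x: "x \<in> closure \<omega>" "x \<in> U" using closure_subset assms(3) by blast+
    show "norm (f x) \<le> C" using B0[OF x(1)] sb abs_ge_self[of B0] unfolding C_def real_norm_def by linarith
    have "norm (D x v) \<le> C * M h * norm v" for v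
    proof -
      note lin = has_derivative_linear[OF D(1)[OF x(2)]]
      have "D x v = D x (\<Sum>b\<in>Basis. (v \<bullet> b) *\<^sub>R b)" by (simp add: euclidean_representation)
      also have "\<dots> = (\<Sum>b\<in>Basis. (v \<bullet> b) * D x b)"
        by (simp only: linear_sum[OF lin] linear_cmul[OF lin] real_scaleR_def)
      finally have "\<bar>D x v\<bar> \<le> (\<Sum>b\<in>Basis. \<bar>(v \<bullet> b) * D x b\<bar>)" by (simp add: sum_abs)
      also have "\<dots> \<le> (\<Sum>b\<in>Basis. norm v * \<bar>B b\<bar>)"
      proof (rule sum_mono)
        fix b :: 'a assume b: "b \<in> Basis"
        have "\<bar>D x b\<bar> \<le> \<bar>B b\<bar>" using B[OF b x(1)] by linarith
        then show "\<bar>(v \<bullet> b) * D x b\<bar> \<le> norm v * \<bar>B b\<bar>"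
          using Basis_le_norm[OF b, of v] by (simp add: abs_mult mult_mono)
      qed
      also have "\<dots> = (\<Sum>b\<in>Basis. \<bar>B b\<bar>) * norm v" by (simp add: sum_distrib_left mult.commute)
      also have "\<dots> \<le> C * norm v" by (intro mult_right_mono) (auto simp: C_def)
      also have "\<dots> \<le> (C * M h) * norm v"
      proof (intro mult_right_mono)
        have "C \<ge> 0" using sb by (simp add: C_def)
        then show "C \<le> C * M h" using assms(4)[OF h] mult_left_mono[of 1 "M h" C] by simp
      qed simp
      finally show ?thesis by simp
    qed
    then show "\<exists>D. (f has_derivative D) (at x) \<and> (\<forall>v. norm (D v) \<le> C * M h * norm v)"
      using D(1)[OF x(2)] by blast
  qed (use sb in \<open>simp add: C_def\<close>)
qed

lemma dominated_add:
  assumes "dominated \<Omega> e f" "dominated \<Omega> e g"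
  shows "dominated \<Omega> e (\<lambda>h x. f h x + g h x)"
proof -
  obtain C1 C2 where C: "C1 \<ge> 0" "C2 \<ge> 0"
    "\<And>h x. h \<in> {0<..<1} \<Longrightarrow> x \<in> \<Omega> h \<Longrightarrow> norm (f h x) \<le> C1 * e h"
    "\<And>h x. h \<in> {0<..<1} \<Longrightarrow> x \<in> \<Omega> h \<Longrightarrow> norm (g h x) \<le> C2 * e h"
    using assms unfolding dominated_def by metis
  then have "norm (f h x + g h x) \<le> (C1 + C2) * e h" if "h \<in> {0<..<1}" "x \<in> \<Omega> h" for h x
    using norm_triangle_mono[OF C(3,4)[OF that]] by (simp add: algebra_simps)
  then show ?thesis unfolding dominated_def using C by (intro exI[of _ "C1 + C2"]) auto
qed

lemma dominated_minus: "dominated \<Omega> e f \<Longrightarrow> dominated \<Omega> e (\<lambda>h x. - f h x)"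
  by (simp add: dominated_def)

lemma dominated_diff:
  "dominated \<Omega> e f \<Longrightarrow> dominated \<Omega> e g \<Longrightarrow> dominated \<Omega> e (\<lambda>h x. f h x - g h x)"
  using dominated_add[OF _ dominated_minus] by (metis (no_types, lifting) ext diff_conv_add_uminus)

lemma dominated_bilinear:
  assumes B: "bounded_bilinear B" and "dominated \<Omega> e f" "dominated \<Omega> e' g"
  shows "dominated \<Omega> (\<lambda>h. e h * e' h) (\<lambda>h x. B (f h x) (g h x))"
proof -
  obtain C1 C2 where C: "C1 \<ge> 0" "C2 \<ge> 0"
    "\<And>h x. h \<in> {0<..<1} \<Longrightarrow> x \<in> \<Omega> h \<Longrightarrow> norm (f h x) \<le> C1 * e h"
    "\<And>h x. h \<in> {0<..<1} \<Longrightarrow> x \<in> \<Omega> h \<Longrightarrow> norm (g h x) \<le> C2 * e' h"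
    using assms(2,3) unfolding dominated_def by metis
  obtain K where K: "K \<ge> 0" "\<And>a b. norm (B a b) \<le> norm a * norm b * K"
    using bounded_bilinear.nonneg_bounded[OF B] by blast
  have "norm (B (f h x) (g h x)) \<le> (C1 * C2 * K) * (e h * e' h)" if hx: "h \<in> {0<..<1}" "x \<in> \<Omega> h" for h x
  proof -
    have "norm (f h x) * norm (g h x) * K \<le> (C1 * e h) * (C2 * e' h) * K"
      using C(3,4)[OF hx] order_trans[OF norm_ge_zero C(3)[OF hx]] by (intro mult_right_mono mult_mono K) auto
    then show ?thesis using K(2)[of "f h x" "g h x"] by (simp add: algebra_simps)
  qed
  then show ?thesis unfolding dominated_def using C K by (intro exI[of _ "C1 * C2 * K"]) auto
qed

lemma dominated_mono:
  assumes "dominated \<Omega> e f" "\<And>h. h \<in> {0<..<1} \<Longrightarrow> e h \<le> K * e' h" "K \<ge> 0"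
  shows "dominated \<Omega> e' f"
proof -
  obtain C where C: "C \<ge> 0" "\<And>h x. h \<in> {0<..<1} \<Longrightarrow> x \<in> \<Omega> h \<Longrightarrow> norm (f h x) \<le> C * e h"
    using assms(1) unfolding dominated_def by metis
  have "norm (f h x) \<le> (C * K) * e' h" if "h \<in> {0<..<1}" "x \<in> \<Omega> h" for h x
    using C(2)[OF that] mult_left_mono[OF assms(2)[OF that(1)] C(1)] by (simp add: mult.assoc)
  then show ?thesis unfolding dominated_def using C(1) assms(3) by (intro exI[of _ "C * K"]) auto
qed

lemma dominated_bilinear_bounded:
  assumes B: "bounded_bilinear B" and "dominated \<Omega> e f" "dominated \<Omega> (\<lambda>_. 1) g"
  shows "dominated \<Omega> e (\<lambda>h x. B (f h x) (g h x))"
  using dominated_bilinear[OF assms] by simp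

lemma dominated_param:
  "(\<And>h. h \<in> {0<..<1} \<Longrightarrow> norm (r h) \<le> e h) \<Longrightarrow> dominated \<Omega> e (\<lambda>h x. r h)"
  unfolding dominated_def by (intro exI[of _ 1]) auto

lemma dominated_cong:
  assumes "dominated \<Omega> e f" "\<And>h x. h \<in> {0<..<1} \<Longrightarrow> x \<in> \<Omega> h \<Longrightarrow> g h x = f h x"
  shows "dominated \<Omega> e g"
  using assms unfolding dominated_def by simp

section \<open>The corrugated plate\<close>

text \<open>The functions \<open>a1\<close>, ..., \<open>\<kappa>2\<close> are the partial
  derivatives of the data and have to be \<open>C\<^sup>1\<close> themselves, since the director
  contains them and is differentiated once more. \<open>U\<close> is a neighbourhood of the closure
  on which the square roots \<open>a\<close> and \<open>b\<close> will be smooth. \<open>N\<close>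
  and \<open>\<epsilon>\<close> stay free here; their powers of \<open>h\<close> are fixed only when
  the errors are balanced.\<close>

locale corrugated_plate =
  fixes \<omega> U :: "(real^2) set" and N \<epsilon> :: "real \<Rightarrow> real" and c :: real
    and a a1 a2 b b1 b2 \<kappa> \<kappa>1 \<kappa>2 \<sigma>13 \<sigma>23 \<sigma>33 :: "real^2 \<Rightarrow> real"
  assumes \<omega>: "bounded \<omega>" "closure \<omega> \<subseteq> U"
    and N: "\<And>h. h \<in> {0<..<1} \<Longrightarrow> 1 \<le> N h"
    and \<epsilon>: "\<And>h. h \<in> {0<..<1} \<Longrightarrow> 0 \<le> \<epsilon> h" "\<And>h. h \<in> {0<..<1} \<Longrightarrow> \<epsilon> h \<le> 1"
    and da: "\<And>x. x \<in> U \<Longrightarrow> (a has_derivative (\<lambda>v. a1 x * v $ 1 + a2 x * v $ 2)) (at x)"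
    and db: "\<And>x. x \<in> U \<Longrightarrow> (b has_derivative (\<lambda>v. b1 x * v $ 1 + b2 x * v $ 2)) (at x)"
    and d\<kappa>: "\<And>x. x \<in> U \<Longrightarrow> (\<kappa> has_derivative (\<lambda>v. \<kappa>1 x * v $ 1 + \<kappa>2 x * v $ 2)) (at x)"
    and C1: "Ck_on 1 U a" "Ck_on 1 U a1" "Ck_on 1 U a2" "Ck_on 1 U b" "Ck_on 1 U b1" "Ck_on 1 U b2"
      "Ck_on 1 U \<kappa>" "Ck_on 1 U \<kappa>1" "Ck_on 1 U \<kappa>2" "Ck_on 1 U \<sigma>13" "Ck_on 1 U \<sigma>23" "Ck_on 1 U \<sigma>33"
begin

definition "\<sigma>11 x = (a x)\<^sup>2 - c"
definition "\<sigma>22 x = (b x)\<^sup>2 + \<kappa>2 x - c"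
definition "\<sigma>12 x = \<kappa>1 x / 2"

definition "\<eta> h = 1 / N h"
definition "sn h x = sin (N h * x $ 1)" for x :: "real^2"
definition "cs h x = cos (N h * x $ 1)" for x :: "real^2"
definition "sn' h x = sin ((N h)\<^sup>2 * x $ 2)" for x :: "real^2"
definition "cs' h x = cos ((N h)\<^sup>2 * x $ 2)" for x :: "real^2"

text \<open>The last term of \<open>w1\<close> cancels the cross term of the two corrugations in \<open>\<partial>\<^sub>1v \<partial>\<^sub>2v\<close>. The letters \<open>v1\<close>, \<open>v2\<close>
  and \<open>w11\<close>, ..., \<open>w22\<close> denote partial derivatives, and \<open>r1\<close>, ..., \<open>r22\<close> their parts of order \<open>1/N\<close>.\<close>

definition "v h x = 2 * \<eta> h * a x * sn h x + 2 * (\<eta> h)\<^sup>2 * b x * sn' h x"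
definition "w1 h x = - c * x $ 1 - \<eta> h * (a x)\<^sup>2 * sn h x * cs h x - 4 * (\<eta> h)\<^sup>2 * a x * b x * cs h x * sn' h x"
definition "w2 h x = \<kappa> x - c * x $ 2 - (\<eta> h)\<^sup>2 * (b x)\<^sup>2 * sn' h x * cs' h x"

definition "r1 h x = 2 * a1 x * sn h x + 2 * \<eta> h * b1 x * sn' h x"
definition "r2 h x = 2 * a2 x * sn h x + 2 * \<eta> h * b2 x * sn' h x"
definition "r11 h x = - 2 * a x * a1 x * sn h x * cs h x
  - 4 * \<eta> h * (a1 x * b x + a x * b1 x) * cs h x * sn' h x + 4 * a x * b x * sn h x * sn' h x"
definition "r12 h x = - 2 * a x * a2 x * sn h x * cs h x
  - 4 * \<eta> h * (a2 x * b x + a x * b2 x) * cs h x * sn' h x"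
definition "r21 h x = - 2 * \<eta> h * b x * b1 x * sn' h x * cs' h x"
definition "r22 h x = - 2 * \<eta> h * b x * b2 x * sn' h x * cs' h x"

definition "v1 h x = 2 * a x * cs h x + \<eta> h * r1 h x"
definition "v2 h x = 2 * b x * cs' h x + \<eta> h * r2 h x"
definition "w11 h x = - c - (a x)\<^sup>2 * ((cs h x)\<^sup>2 - (sn h x)\<^sup>2) + \<eta> h * r11 h x"
definition "w12 h x = - 4 * a x * b x * cs h x * cs' h x + \<eta> h * r12 h x"
definition "w21 h x = \<kappa>1 x + \<eta> h * r21 h x"
definition "w22 h x = \<kappa>2 x - c - (b x)\<^sup>2 * ((cs' h x)\<^sup>2 - (sn' h x)\<^sup>2) + \<eta> h * r22 h x"

lemma has_derivative_nth: "((\<lambda>x. x $ i) has_derivative (\<lambda>d. d $ i)) (at x)" for x :: "real^2"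
  by (rule bounded_linear.has_derivative[OF bounded_linear_vec_nth has_derivative_ident])

lemma trig_derivs:
  "(sn h has_derivative (\<lambda>d. N h * cs h x * d $ 1)) (at x)"
  "(cs h has_derivative (\<lambda>d. - N h * sn h x * d $ 1)) (at x)"
  "(sn' h has_derivative (\<lambda>d. (N h)\<^sup>2 * cs' h x * d $ 2)) (at x)"
  "(cs' h has_derivative (\<lambda>d. - (N h)\<^sup>2 * sn' h x * d $ 2)) (at x)"
proof -
  note lin = has_derivative_mult_right[OF has_derivative_nth]
  show "(sn h has_derivative (\<lambda>d. N h * cs h x * d $ 1)) (at x)"
    unfolding sn_def[abs_def] cs_def[abs_def]
    by (rule has_derivative_eq_rhs[OF has_derivative_sin[OF lin]]) (simp add: fun_eq_iff)
  show "(cs h has_derivative (\<lambda>d. - N h * sn h x * d $ 1)) (at x)"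
    unfolding sn_def[abs_def] cs_def[abs_def]
    by (rule has_derivative_eq_rhs[OF has_derivative_cos[OF lin]]) (simp add: fun_eq_iff)
  show "(sn' h has_derivative (\<lambda>d. (N h)\<^sup>2 * cs' h x * d $ 2)) (at x)"
    unfolding sn'_def[abs_def] cs'_def[abs_def]
    by (rule has_derivative_eq_rhs[OF has_derivative_sin[OF lin]]) (simp add: fun_eq_iff)
  show "(cs' h has_derivative (\<lambda>d. - (N h)\<^sup>2 * sn' h x * d $ 2)) (at x)"
    unfolding sn'_def[abs_def] cs'_def[abs_def]
    by (rule has_derivative_eq_rhs[OF has_derivative_cos[OF lin]]) (simp add: fun_eq_iff)
qed

lemmas derivs = has_derivative_add has_derivative_diff has_derivative_minus has_derivative_mult
  has_derivative_const has_derivative_nth trig_derivs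

text \<open>Differentiating a trigonometric factor costs \<open>N\<close> or \<open>N^2\<close>,
  which the amplitudes \<open>\<eta>\<close> and \<open>\<eta>^2\<close> match, so such terms have
  order one; terms in which \<open>a\<close> or \<open>b\<close> is differentiated keep a factor
  \<open>\<eta>\<close>. The corrector in \<open>w1\<close> has amplitude \<open>\<eta>^2\<close>
  but only the slow frequency in \<open>x\<^sub>1\<close>: its derivative there yields the term with
  \<open>sn\<close> and \<open>sn'\<close> in \<open>r11\<close>, small because of the gap between
  the frequencies.\<close>

lemma displacement_derivs:
  assumes h: "h \<in> {0<..<1}" and x: "x \<in> U"
  shows "(v h has_derivative (\<lambda>d. v1 h x * d $ 1 + v2 h x * d $ 2)) (at x)"
    "(w1 h has_derivative (\<lambda>d. w11 h x * d $ 1 + w12 h x * d $ 2)) (at x)"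
    "(w2 h has_derivative (\<lambda>d. w21 h x * d $ 1 + w22 h x * d $ 2)) (at x)"
proof -
  have N0: "N h \<noteq> 0" using N[OF h] by linarith
  show "(v h has_derivative (\<lambda>d. v1 h x * d $ 1 + v2 h x * d $ 2)) (at x)"
    unfolding v_def[abs_def]
    by (rule has_derivative_eq_rhs, (rule derivs da[OF x] db[OF x])+)
      (use N0 in \<open>simp add: fun_eq_iff v1_def v2_def r1_def r2_def \<eta>_def field_simps power2_eq_square\<close>)
  show "(w1 h has_derivative (\<lambda>d. w11 h x * d $ 1 + w12 h x * d $ 2)) (at x)"
    unfolding w1_def[abs_def] power2_eq_square
    by (rule has_derivative_eq_rhs, (rule derivs da[OF x] db[OF x])+)
      (use N0 in \<open>simp add: fun_eq_iff w11_def w12_def r11_def r12_def \<eta>_def field_simps power2_eq_square\<close>)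
  show "(w2 h has_derivative (\<lambda>d. w21 h x * d $ 1 + w22 h x * d $ 2)) (at x)"
    unfolding w2_def[abs_def] power2_eq_square
    by (rule has_derivative_eq_rhs, (rule derivs db[OF x] d\<kappa>[OF x])+)
      (use N0 in \<open>simp add: fun_eq_iff w21_def w22_def r21_def r22_def \<eta>_def field_simps power2_eq_square\<close>)
qed

definition "M h = (N h)\<^sup>2"

lemma M: "h \<in> {0<..<1} \<Longrightarrow> 1 \<le> M h" "h \<in> {0<..<1} \<Longrightarrow> 0 \<le> M h"
  using N[of h] one_le_power[of "N h" 2] by (simp_all add: M_def)

lemma \<eta>: "h \<in> {0<..<1} \<Longrightarrow> 0 \<le> \<eta> h" "h \<in> {0<..<1} \<Longrightarrow> \<eta> h \<le> 1"
  using N[of h] by (simp_all add: \<eta>_def)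

lemma tame_data:
  "tame \<omega> M (\<lambda>h. a)" "tame \<omega> M (\<lambda>h. a1)" "tame \<omega> M (\<lambda>h. a2)" "tame \<omega> M (\<lambda>h. b)" "tame \<omega> M (\<lambda>h. b1)"
  "tame \<omega> M (\<lambda>h. b2)" "tame \<omega> M (\<lambda>h. \<kappa>)" "tame \<omega> M (\<lambda>h. \<kappa>1)" "tame \<omega> M (\<lambda>h. \<kappa>2)" "tame \<omega> M (\<lambda>h. \<sigma>13)"
  "tame \<omega> M (\<lambda>h. \<sigma>23)" "tame \<omega> M (\<lambda>h. \<sigma>33)"
  using C1 \<omega> M(1) by (auto intro: tame_C1)

lemma tame_trig: "tame \<omega> M sn" "tame \<omega> M cs" "tame \<omega> M sn'" "tame \<omega> M cs'"
proof -
  have 1: "\<bar>N h\<bar> \<le> M h" if "h \<in> {0<..<1}" for h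
    using N[OF that] self_le_power[of "N h" 2] by (simp add: M_def)
  have 2: "\<bar>(N h)\<^sup>2\<bar> \<le> M h" for h by (simp add: M_def)
  show "tame \<omega> M sn" "tame \<omega> M cs" "tame \<omega> M sn'" "tame \<omega> M cs'"
    unfolding sn_def[abs_def] cs_def[abs_def] sn'_def[abs_def] cs'_def[abs_def]
    by (intro tame_sin_cos[where N=N, OF 1] tame_sin_cos[where N="\<lambda>h. (N h)\<^sup>2", OF 2]; assumption)+
qed

lemma tame_coord: "tame \<omega> M (\<lambda>h x. x $ i)"
proof (rule tame_C1[where U=UNIV])
  show "Ck_on 1 UNIV (\<lambda>x :: real^2. x $ i)" by (intro Ck_on_linear bounded_linear_vec_nth) simp
qed (use \<omega> M in auto)

lemma tame_\<eta>: "tame \<omega> M (\<lambda>h x. \<eta> h)" and tame_\<epsilon>: "tame \<omega> M (\<lambda>h x. \<epsilon> h)"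
  using \<eta> \<epsilon> M by (auto intro!: tame_param[of _ 1])

lemma tame_consts: "tame \<omega> M (\<lambda>h x. k)"
  using M by (intro tame_const) auto

lemma tame_minus: "tame \<omega> M f \<Longrightarrow> tame \<omega> M (\<lambda>h x. - f h x :: real)"
  using tame_mult[OF tame_consts[of "-1"], of f] by simp

lemma tame_diff: "tame \<omega> M f \<Longrightarrow> tame \<omega> M g \<Longrightarrow> tame \<omega> M (\<lambda>h x. f h x - g h x :: real)"
  using tame_add[OF _ tame_minus[of g], of f] by simp

lemma tame_square: "tame \<omega> M f \<Longrightarrow> tame \<omega> M (\<lambda>h x. (f h x :: real)\<^sup>2)"
  using tame_mult[of \<omega> M f f] by (simp add: power2_eq_square)

lemmas tame_rules = tame_add tame_diff tame_minus tame_mult tame_square tame_data tame_trig tame_coord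
  tame_\<eta> tame_\<epsilon> tame_consts

lemma tame_displacement: "tame \<omega> M v" "tame \<omega> M w1" "tame \<omega> M w2"
  unfolding v_def[abs_def] w1_def[abs_def] w2_def[abs_def] by (intro tame_rules)+

lemma tame_remainders: "tame \<omega> M r1" "tame \<omega> M r2" "tame \<omega> M r11" "tame \<omega> M r12" "tame \<omega> M r21" "tame \<omega> M r22"
  unfolding r1_def[abs_def] r2_def[abs_def] r11_def[abs_def] r12_def[abs_def] r21_def[abs_def] r22_def[abs_def]
  by (intro tame_rules)+

lemma tame_gradients:
  "tame \<omega> M v1" "tame \<omega> M v2" "tame \<omega> M w11" "tame \<omega> M w12" "tame \<omega> M w21" "tame \<omega> M w22"
  unfolding v1_def[abs_def] v2_def[abs_def] w11_def[abs_def] w12_def[abs_def] w21_def[abs_def] w22_def[abs_def]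
  by (intro tame_rules tame_remainders)+

lemma tame_\<sigma>: "tame \<omega> M (\<lambda>h. \<sigma>11)" "tame \<omega> M (\<lambda>h. \<sigma>12)" "tame \<omega> M (\<lambda>h. \<sigma>22)"
proof -
  have s: "\<sigma>12 = (\<lambda>x. (1/2) * \<kappa>1 x)" by (simp add: \<sigma>12_def fun_eq_iff)
  show "tame \<omega> M (\<lambda>h. \<sigma>12)" unfolding s by (intro tame_rules)
  show "tame \<omega> M (\<lambda>h. \<sigma>11)" "tame \<omega> M (\<lambda>h. \<sigma>22)"
    unfolding \<sigma>11_def[abs_def] \<sigma>22_def[abs_def] by (intro tame_rules)+
qed

text \<open>Collected so that \<open>\<eta> * E11\<close>, and likewise the other two, are the exact
  remainders in \<open>stretching_defect\<close>, which thereby is an identity and not an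
  estimate.\<close>

definition "E11 h x = 2 * r11 h x + 4 * a x * cs h x * r1 h x + \<eta> h * (r1 h x)\<^sup>2"
definition "E12 h x = r12 h x + r21 h x + 2 * a x * cs h x * r2 h x + 2 * b x * cs' h x * r1 h x
  + \<eta> h * (r1 h x * r2 h x)"
definition "E22 h x = 2 * r22 h x + 4 * b x * cs' h x * r2 h x + \<eta> h * (r2 h x)\<^sup>2"

lemma tame_E: "tame \<omega> M E11" "tame \<omega> M E12" "tame \<omega> M E22"
  unfolding E11_def[abs_def] E12_def[abs_def] E22_def[abs_def] by (intro tame_rules tame_remainders)+

text \<open>In the first diagonal entry the square \<open>4 a^2 cs^2\<close> from \<open>v1\<close>
  and the oscillation \<open>- 2 a^2 (cs^2 - sn^2)\<close> from \<open>2 * w11\<close> add up to the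
  non-oscillating \<open>2 a^2\<close>, and the linear displacement contributes
  \<open>- 2 c\<close>. The other diagonal entry works in the same way with
  \<open>b\<close>.\<close>

lemma stretching_defect:
  "2 * w11 h x + (v1 h x)\<^sup>2 = 2 * \<sigma>11 x + \<eta> h * E11 h x"
  "w12 h x + w21 h x + v1 h x * v2 h x = 2 * \<sigma>12 x + \<eta> h * E12 h x"
  "2 * w22 h x + (v2 h x)\<^sup>2 = 2 * \<sigma>22 x + \<eta> h * E22 h x"
proof -
  have "(sn h x)\<^sup>2 + (cs h x)\<^sup>2 = 1" "(sn' h x)\<^sup>2 + (cs' h x)\<^sup>2 = 1"
    by (simp_all add: sn_def cs_def sn'_def cs'_def)
  then have s: "(sn h x)\<^sup>2 = 1 - (cs h x)\<^sup>2" "(sn' h x)\<^sup>2 = 1 - (cs' h x)\<^sup>2" by linarith+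
  show "2 * w11 h x + (v1 h x)\<^sup>2 = 2 * \<sigma>11 x + \<eta> h * E11 h x"
    unfolding w11_def v1_def \<sigma>11_def E11_def s by (simp add: power2_eq_square algebra_simps)
  show "w12 h x + w21 h x + v1 h x * v2 h x = 2 * \<sigma>12 x + \<eta> h * E12 h x"
    unfolding w12_def w21_def v1_def v2_def \<sigma>12_def E12_def by (simp add: power2_eq_square algebra_simps)
  show "2 * w22 h x + (v2 h x)\<^sup>2 = 2 * \<sigma>22 x + \<eta> h * E22 h x"
    unfolding w22_def v2_def \<sigma>22_def E22_def s by (simp add: power2_eq_square algebra_simps)
qed

definition "\<Phi> h x = (x $ 1 + (\<epsilon> h)\<^sup>2 * w1 h x) *\<^sub>R axis 1 1 + (x $ 2 + (\<epsilon> h)\<^sup>2 * w2 h x) *\<^sub>R axis 2 1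
  + (\<epsilon> h * v h x) *\<^sub>R (axis 3 1 :: real^3)"
text \<open>Displacement gradients with one factor \<open>\<epsilon>\<close> split off. They are
  bounded uniformly, and the split makes visible that the derivatives of the tangent vectors
  \<open>P1\<close> and \<open>P2\<close> have size \<open>\<epsilon> * M\<close>.\<close>

definition "Q1 h x = (\<epsilon> h * w11 h x) *\<^sub>R axis 1 1 + (\<epsilon> h * w21 h x) *\<^sub>R axis 2 1 + v1 h x *\<^sub>R (axis 3 1 :: real^3)"
definition "Q2 h x = (\<epsilon> h * w12 h x) *\<^sub>R axis 1 1 + (\<epsilon> h * w22 h x) *\<^sub>R axis 2 1 + v2 h x *\<^sub>R (axis 3 1 :: real^3)"
definition "P1 h x = axis 1 1 + \<epsilon> h *\<^sub>R Q1 h x"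
definition "P2 h x = axis 2 1 + \<epsilon> h *\<^sub>R Q2 h x"

lemma \<Phi>_derivative:
  assumes "h \<in> {0<..<1}" and "x \<in> U"
  shows "(\<Phi> h has_derivative (\<lambda>d. d $ 1 *\<^sub>R P1 h x + d $ 2 *\<^sub>R P2 h x)) (at x)"
  unfolding \<Phi>_def[abs_def]
  by (rule has_derivative_eq_rhs, (rule has_derivative_add has_derivative_scaleR_left
      has_derivative_mult_right has_derivative_nth displacement_derivs[OF assms])+)
    (simp add: fun_eq_iff P1_def P2_def Q1_def Q2_def algebra_simps scaleR_add_left scaleR_add_right power2_eq_square)

lemma tame_Q: "tame \<omega> M Q1" "tame \<omega> M Q2" "tame \<omega> M \<Phi>"
  unfolding Q1_def[abs_def] Q2_def[abs_def] \<Phi>_def[abs_def]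
  by (intro tame_add tame_scaleR tame_mult tame_square tame_\<epsilon> tame_gradients tame_displacement tame_coord tame_consts)+

end

section \<open>Metric of the deformed mid-surface and of its director\<close>

context corrugated_plate begin

definition "e h = (\<epsilon> h)\<^sup>2"
text \<open>The first term is the defect of the corrugation. The second accounts for products of two
  strains of size \<open>e\<close>, beginning with the terms quadratic in the in-plane
  gradients.\<close>

definition "e0 h = e h * \<eta> h + (e h)\<^sup>2"

definition "G11 h x = e h * \<eta> h * E11 h x + (e h)\<^sup>2 * ((w11 h x)\<^sup>2 + (w21 h x)\<^sup>2)"
definition "G12 h x = e h * \<eta> h * E12 h x + (e h)\<^sup>2 * (w11 h x * w12 h x + w21 h x * w22 h x)"
definition "G22 h x = e h * \<eta> h * E22 h x + (e h)\<^sup>2 * ((w12 h x)\<^sup>2 + (w22 h x)\<^sup>2)"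

lemma first_form:
  "P1 h x \<bullet> P1 h x = 1 + 2 * e h * \<sigma>11 x + G11 h x"
  "P1 h x \<bullet> P2 h x = 2 * e h * \<sigma>12 x + G12 h x"
  "P2 h x \<bullet> P2 h x = 1 + 2 * e h * \<sigma>22 x + G22 h x"
proof -
  have 1: "P1 h x \<bullet> P1 h x = 1 + e h * (2 * w11 h x + (v1 h x)\<^sup>2) + (e h)\<^sup>2 * ((w11 h x)\<^sup>2 + (w21 h x)\<^sup>2)"
    by (simp add: P1_def Q1_def inner_vec_def sum_3 axis_def e_def power2_eq_square algebra_simps)
  show "P1 h x \<bullet> P1 h x = 1 + 2 * e h * \<sigma>11 x + G11 h x"
    unfolding 1 stretching_defect G11_def by (simp add: algebra_simps)
  have 2: "P1 h x \<bullet> P2 h x = e h * (w12 h x + w21 h x + v1 h x * v2 h x)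
      + (e h)\<^sup>2 * (w11 h x * w12 h x + w21 h x * w22 h x)"
    by (simp add: P1_def P2_def Q1_def Q2_def inner_vec_def sum_3 axis_def e_def power2_eq_square algebra_simps)
  show "P1 h x \<bullet> P2 h x = 2 * e h * \<sigma>12 x + G12 h x"
    unfolding 2 stretching_defect G12_def by (simp add: algebra_simps)
  have 3: "P2 h x \<bullet> P2 h x = 1 + e h * (2 * w22 h x + (v2 h x)\<^sup>2) + (e h)\<^sup>2 * ((w12 h x)\<^sup>2 + (w22 h x)\<^sup>2)"
    by (simp add: P2_def Q2_def inner_vec_def sum_3 axis_def e_def power2_eq_square algebra_simps)
  show "P2 h x \<bullet> P2 h x = 1 + 2 * e h * \<sigma>22 x + G22 h x"
    unfolding 3 stretching_defect G22_def by (simp add: algebra_simps)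
qed

abbreviation "err \<equiv> dominated (\<lambda>_. \<omega>) e0"
abbreviation "bnd \<equiv> dominated (\<lambda>_. \<omega>) (\<lambda>_. 1)"

lemma e: "h \<in> {0<..<1} \<Longrightarrow> 0 \<le> e h" "h \<in> {0<..<1} \<Longrightarrow> e h \<le> 1"
  using \<epsilon>[of h] by (simp_all add: e_def power_le_one)

lemma tame_e: "tame \<omega> M (\<lambda>h x. e h)"
  unfolding e_def by (intro tame_rules)

lemma e0_dominated:
  assumes "bnd f"
  shows "err (\<lambda>h x. e h * \<eta> h * f h x)" "err (\<lambda>h x. (e h)\<^sup>2 * f h x)"
proof -
  have 1: "dominated (\<lambda>_. \<omega>) (\<lambda>h. e h * \<eta> h) (\<lambda>h x. e h * \<eta> h * f h x)"
    by (rule dominated_bilinear_bounded[OF bounded_bilinear_mult dominated_param assms]) (use e \<eta> in simp)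
  have 2: "dominated (\<lambda>_. \<omega>) (\<lambda>h. (e h)\<^sup>2) (\<lambda>h x. (e h)\<^sup>2 * f h x)"
    by (rule dominated_bilinear_bounded[OF bounded_bilinear_mult dominated_param assms]) simp
  show "err (\<lambda>h x. e h * \<eta> h * f h x)"
    by (rule dominated_mono[OF 1, of 1]) (use e \<eta> in \<open>simp_all add: e0_def\<close>)
  show "err (\<lambda>h x. (e h)\<^sup>2 * f h x)"
    by (rule dominated_mono[OF 2, of 1]) (use e \<eta> in \<open>simp_all add: e0_def\<close>)
qed

lemma dominated_e0_mult: "err f \<Longrightarrow> bnd g \<Longrightarrow> err (\<lambda>h x. f h x * g h x :: real)"
  by (rule dominated_bilinear_bounded[OF bounded_bilinear_mult])

lemmas bnd_tame = tame_imp_dominated[where M=M and \<omega>=\<omega>]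

lemma tame_G: "tame \<omega> M G11" "tame \<omega> M G12" "tame \<omega> M G22"
  unfolding G11_def[abs_def] G12_def[abs_def] G22_def[abs_def]
  by (intro tame_rules tame_e tame_E tame_gradients)+

lemma G_dominated:
  "err G11" "err G12" "err G22"
  unfolding G11_def[abs_def] G12_def[abs_def] G22_def[abs_def]
  by (intro dominated_add e0_dominated bnd_tame tame_rules tame_E tame_gradients)+

text \<open>The cross product is normal to the deformed mid-surface; the tangential part of the director
  produces the entries \<open>\<sigma>13\<close> and \<open>\<sigma>23\<close>, and the factor \<open>\<mu>\<close> corrects the length to produce \<open>\<sigma>33\<close>.\<close>

definition "\<rho> x = \<sigma>33 x - \<sigma>11 x - \<sigma>22 x"
definition "\<mu> h x = 1 + \<epsilon> h * (\<epsilon> h * \<rho> x)"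
definition "director h x = \<mu> h x *\<^sub>R cross3 (P1 h x) (P2 h x)
  + (\<epsilon> h * (2 * \<epsilon> h * \<sigma>13 x)) *\<^sub>R P1 h x + (\<epsilon> h * (2 * \<epsilon> h * \<sigma>23 x)) *\<^sub>R P2 h x"

lemma tame_\<rho>: "tame \<omega> M (\<lambda>h. \<rho>)"
  unfolding \<rho>_def[abs_def] by (intro tame_rules tame_\<sigma>)

lemma tame_\<mu>: "tame \<omega> M \<mu>"
  unfolding \<mu>_def[abs_def] by (intro tame_rules tame_\<rho>)

lemma tame_\<epsilon>M:
  "tame \<omega> M f \<Longrightarrow> tame \<omega> (\<lambda>h. \<epsilon> h * M h) (\<lambda>h x. \<epsilon> h *\<^sub>R f h x)"
  using \<epsilon> by (intro tame_scale_param)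

lemma tame_\<epsilon>M_const: "tame \<omega> (\<lambda>h. \<epsilon> h * M h) (\<lambda>h x. k)"
  using \<epsilon> M by (intro tame_const) simp

text \<open>Every oscillating quantity enters the frame with a factor \<open>\<epsilon>\<close>, so
  one derivative costs \<open>\<epsilon> * M\<close>. For this reason \<open>\<mu>\<close> and the
  tangential coefficients of \<open>director\<close> are written as \<open>\<epsilon>\<close> times
  a function that is tame with rate \<open>M\<close>.\<close>

lemma tame_frame:
  "tame \<omega> (\<lambda>h. \<epsilon> h * M h) P1" "tame \<omega> (\<lambda>h. \<epsilon> h * M h) P2" "tame \<omega> (\<lambda>h. \<epsilon> h * M h) director"
proof -
  show P: "tame \<omega> (\<lambda>h. \<epsilon> h * M h) P1" "tame \<omega> (\<lambda>h. \<epsilon> h * M h) P2"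
    unfolding P1_def[abs_def] P2_def[abs_def]
    by (intro tame_add tame_\<epsilon>M_const tame_\<epsilon>M tame_Q)+
  have r: "tame \<omega> (\<lambda>h. \<epsilon> h * M h) (\<lambda>h x. \<epsilon> h * f h x)" if "tame \<omega> M f" for f :: "real \<Rightarrow> real^2 \<Rightarrow> real"
    using tame_\<epsilon>M[OF that] by simp
  show "tame \<omega> (\<lambda>h. \<epsilon> h * M h) director"
    unfolding director_def[abs_def] \<mu>_def[abs_def]
    by (intro tame_add tame_scaleR[where f="\<lambda>h x. 1 + _ h x"] tame_scaleR tame_cross3 P r tame_mult tame_\<epsilon> tame_consts tame_\<rho> tame_data tame_\<epsilon>M_const)
qed

text \<open>The cross product is orthogonal to \<open>P1\<close> and \<open>P2\<close>, and its
  squared length is their Gram determinant by Lagrange's identity. So all inner products with the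
  director are polynomials in the first fundamental form and the data.\<close>

lemma director_inner:
  "director h x \<bullet> P1 h x = 2 * e h * (\<sigma>13 x * (P1 h x \<bullet> P1 h x) + \<sigma>23 x * (P1 h x \<bullet> P2 h x))"
  "director h x \<bullet> P2 h x = 2 * e h * (\<sigma>13 x * (P1 h x \<bullet> P2 h x) + \<sigma>23 x * (P2 h x \<bullet> P2 h x))"
  "director h x \<bullet> director h x = (\<mu> h x)\<^sup>2 * ((P1 h x \<bullet> P1 h x) * (P2 h x \<bullet> P2 h x) - (P1 h x \<bullet> P2 h x)\<^sup>2)
    + 4 * (e h)\<^sup>2 * ((\<sigma>13 x)\<^sup>2 * (P1 h x \<bullet> P1 h x) + 2 * \<sigma>13 x * \<sigma>23 x * (P1 h x \<bullet> P2 h x) + (\<sigma>23 x)\<^sup>2 * (P2 h x \<bullet> P2 h x))"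
proof -
  define m where "m = cross3 (P1 h x) (P2 h x)"
  have m: "m \<bullet> P1 h x = 0" "m \<bullet> P2 h x = 0" "P1 h x \<bullet> m = 0" "P2 h x \<bullet> m = 0"
    by (simp_all add: m_def dot_cross_self)
  have mm: "m \<bullet> m = (P1 h x \<bullet> P1 h x) * (P2 h x \<bullet> P2 h x) - (P1 h x \<bullet> P2 h x)\<^sup>2"
    using norm_cross_dot[of "P1 h x" "P2 h x"]
    by (simp add: m_def power_mult_distrib power2_norm_eq_inner)
  have D: "director h x = \<mu> h x *\<^sub>R m + (2 * e h * \<sigma>13 x) *\<^sub>R P1 h x + (2 * e h * \<sigma>23 x) *\<^sub>R P2 h x"
    by (simp add: director_def m_def e_def power2_eq_square mult_ac)
  show "director h x \<bullet> P1 h x = 2 * e h * (\<sigma>13 x * (P1 h x \<bullet> P1 h x) + \<sigma>23 x * (P1 h x \<bullet> P2 h x))"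
    by (simp add: D inner_add_left m inner_commute[of "P2 h x" "P1 h x"] algebra_simps)
  show "director h x \<bullet> P2 h x = 2 * e h * (\<sigma>13 x * (P1 h x \<bullet> P2 h x) + \<sigma>23 x * (P2 h x \<bullet> P2 h x))"
    by (simp add: D inner_add_left m algebra_simps)
  show "director h x \<bullet> director h x = (\<mu> h x)\<^sup>2 * ((P1 h x \<bullet> P1 h x) * (P2 h x \<bullet> P2 h x) - (P1 h x \<bullet> P2 h x)\<^sup>2)
    + 4 * (e h)\<^sup>2 * ((\<sigma>13 x)\<^sup>2 * (P1 h x \<bullet> P1 h x) + 2 * \<sigma>13 x * \<sigma>23 x * (P1 h x \<bullet> P2 h x) + (\<sigma>23 x)\<^sup>2 * (P2 h x \<bullet> P2 h x))"
    unfolding mm[symmetric] D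
    by (simp add: inner_add_left inner_add_right m inner_commute[of "P2 h x" "P1 h x"] power2_eq_square algebra_simps)
qed

text \<open>The Gram determinant of \<open>P1\<close> and \<open>P2\<close> is
  \<open>1 + 2 e (\<sigma>11 + \<sigma>22)\<close> up to the error, and \<open>\<mu>^2\<close> adds
  \<open>2 e \<rho>\<close>, so \<open>\<rho>\<close> is chosen to make the sum
  \<open>2 e \<sigma>33\<close>. Each difference is rewritten exactly as a combination of
  \<open>(e h)\<^sup>2\<close>, \<open>G11\<close>, \<open>G12\<close> and \<open>G22\<close> with
  bounded coefficients.\<close>

lemma metric_error:
  "err (\<lambda>h x. P1 h x \<bullet> P1 h x - (1 + 2 * e h * \<sigma>11 x))"
  "err (\<lambda>h x. P1 h x \<bullet> P2 h x - 2 * e h * \<sigma>12 x)"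
  "err (\<lambda>h x. P2 h x \<bullet> P2 h x - (1 + 2 * e h * \<sigma>22 x))"
  "err (\<lambda>h x. director h x \<bullet> P1 h x - 2 * e h * \<sigma>13 x)"
  "err (\<lambda>h x. director h x \<bullet> P2 h x - 2 * e h * \<sigma>23 x)"
  "err (\<lambda>h x. director h x \<bullet> director h x - (1 + 2 * e h * \<sigma>33 x))"
proof -
  note rules = dominated_add e0_dominated dominated_e0_mult G_dominated bnd_tame
    tame_add tame_diff tame_minus tame_mult tame_square tame_consts tame_e tame_\<sigma> tame_\<rho> tame_\<mu> tame_data tame_G
  have e1: "P1 h x \<bullet> P1 h x - (1 + 2 * e h * \<sigma>11 x) = G11 h x" for h x by (simp add: first_form)
  have e2: "P1 h x \<bullet> P2 h x - 2 * e h * \<sigma>12 x = G12 h x" for h x by (simp add: first_form)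
  have e3: "P2 h x \<bullet> P2 h x - (1 + 2 * e h * \<sigma>22 x) = G22 h x" for h x by (simp add: first_form)
  have e4: "director h x \<bullet> P1 h x - 2 * e h * \<sigma>13 x = (e h)\<^sup>2 * (4 * \<sigma>13 x * \<sigma>11 x + 4 * \<sigma>23 x * \<sigma>12 x)
      + G11 h x * (2 * e h * \<sigma>13 x) + G12 h x * (2 * e h * \<sigma>23 x)" for h x
    by (simp add: director_inner first_form power2_eq_square algebra_simps)
  have e5: "director h x \<bullet> P2 h x - 2 * e h * \<sigma>23 x = (e h)\<^sup>2 * (4 * \<sigma>13 x * \<sigma>12 x + 4 * \<sigma>23 x * \<sigma>22 x)
      + G12 h x * (2 * e h * \<sigma>13 x) + G22 h x * (2 * e h * \<sigma>23 x)" for h x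
    by (simp add: director_inner first_form power2_eq_square algebra_simps)
  \<comment> \<open>The coefficient of \<open>(e h)\<^sup>2\<close> in the last entry; the terms
    whose smallness comes from \<open>G11\<close>, \<open>G12\<close> or \<open>G22\<close> are
    listed separately in \<open>e6\<close>.\<close>
  define X where "X h x = 4 * \<rho> x * (\<sigma>11 x + \<sigma>22 x) + (\<rho> x)\<^sup>2 * (1 + 2 * e h * (\<sigma>11 x + \<sigma>22 x))
      + (\<mu> h x)\<^sup>2 * (4 * \<sigma>11 x * \<sigma>22 x - 4 * (\<sigma>12 x)\<^sup>2)
      + 4 * ((\<sigma>13 x)\<^sup>2 * (1 + 2 * e h * \<sigma>11 x + G11 h x) + 2 * \<sigma>13 x * \<sigma>23 x * (2 * e h * \<sigma>12 x + G12 h x)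
        + (\<sigma>23 x)\<^sup>2 * (1 + 2 * e h * \<sigma>22 x + G22 h x))" for h x
  have \<mu>e: "\<mu> h x = 1 + e h * \<rho> x" for h x by (simp add: \<mu>_def e_def power2_eq_square mult.assoc)
  have e6: "director h x \<bullet> director h x - (1 + 2 * e h * \<sigma>33 x) = (e h)\<^sup>2 * X h x
      + G11 h x * ((\<mu> h x)\<^sup>2 * (1 + 2 * e h * \<sigma>22 x + G22 h x)) + G22 h x * ((\<mu> h x)\<^sup>2 * (1 + 2 * e h * \<sigma>11 x))
      + G12 h x * (- ((\<mu> h x)\<^sup>2 * (4 * e h * \<sigma>12 x + G12 h x)))" for h x
  proof -
    have s: "\<sigma>33 x = \<rho> x + \<sigma>11 x + \<sigma>22 x" by (simp add: \<rho>_def)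
    have q: "(\<mu> h x)\<^sup>2 * (1 + 2 * e h * (\<sigma>11 x + \<sigma>22 x)) - (1 + 2 * e h * \<sigma>33 x)
        = (e h)\<^sup>2 * (4 * \<rho> x * (\<sigma>11 x + \<sigma>22 x) + (\<rho> x)\<^sup>2 * (1 + 2 * e h * (\<sigma>11 x + \<sigma>22 x)))"
      unfolding \<mu>e s by (simp add: power2_eq_square algebra_simps)
    show ?thesis
      unfolding director_inner first_form X_def using q by (simp add: power2_eq_square algebra_simps)
  qed
  show "err (\<lambda>h x. P1 h x \<bullet> P1 h x - (1 + 2 * e h * \<sigma>11 x))"
    "err (\<lambda>h x. P1 h x \<bullet> P2 h x - 2 * e h * \<sigma>12 x)"
    "err (\<lambda>h x. P2 h x \<bullet> P2 h x - (1 + 2 * e h * \<sigma>22 x))"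
    unfolding e1 e2 e3 using G_dominated by auto
  show "err (\<lambda>h x. director h x \<bullet> P1 h x - 2 * e h * \<sigma>13 x)"
    "err (\<lambda>h x. director h x \<bullet> P2 h x - 2 * e h * \<sigma>23 x)"
    unfolding e4 e5 by (intro rules)+
  have "tame \<omega> M X" unfolding X_def[abs_def] by (intro rules)
  then show "err (\<lambda>h x. director h x \<bullet> director h x - (1 + 2 * e h * \<sigma>33 x))"
    unfolding e6 by (intro rules)
qed

text \<open>Coarser than the metric error: it serves to bring the gradient into the neighbourhood of
  the identity where \<open>W\<close> is bounded by the squared strain.\<close>

lemma frame_error:
  "dominated (\<lambda>_. \<omega>) \<epsilon> (\<lambda>h x. P1 h x - axis 1 1)"
  "dominated (\<lambda>_. \<omega>) \<epsilon> (\<lambda>h x. P2 h x - axis 2 1)"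
  "dominated (\<lambda>_. \<omega>) \<epsilon> (\<lambda>h x. director h x - axis 3 1)"
proof -
  have scale: "dominated (\<lambda>_. \<omega>) \<epsilon> (\<lambda>h x. \<epsilon> h *\<^sub>R f h x)" if "tame \<omega> M f" for f :: "real \<Rightarrow> real^2 \<Rightarrow> real^3"
    by (rule dominated_bilinear_bounded[OF bounded_bilinear_scaleR dominated_param bnd_tame[OF that]])
      (use \<epsilon> in simp)
  show "dominated (\<lambda>_. \<omega>) \<epsilon> (\<lambda>h x. P1 h x - axis 1 1)" "dominated (\<lambda>_. \<omega>) \<epsilon> (\<lambda>h x. P2 h x - axis 2 1)"
    unfolding P1_def P2_def using scale tame_Q by simp_all
  define Z where "Z h x = cross3 (Q1 h x) (axis 2 1) + cross3 (axis 1 1) (Q2 h x)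
      + \<epsilon> h *\<^sub>R cross3 (Q1 h x) (Q2 h x) + (\<epsilon> h * \<rho> x) *\<^sub>R cross3 (P1 h x) (P2 h x)
      + (2 * \<epsilon> h * \<sigma>13 x) *\<^sub>R P1 h x + (2 * \<epsilon> h * \<sigma>23 x) *\<^sub>R P2 h x" for h x
  have P: "tame \<omega> M P1" "tame \<omega> M P2"
    unfolding P1_def[abs_def] P2_def[abs_def] by (intro tame_add tame_scaleR tame_\<epsilon> tame_consts tame_Q)+
  have "tame \<omega> M Z" unfolding Z_def[abs_def]
    by (intro tame_add tame_scaleR tame_mult tame_\<epsilon> tame_consts tame_Q tame_cross3 tame_\<rho> tame_data P)
  moreover have "director h x - axis 3 1 = \<epsilon> h *\<^sub>R Z h x" for h x
  proof -
    define m K R where "m = cross3 (P1 h x) (P2 h x)"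
      and "K = cross3 (Q1 h x) (axis 2 1) + cross3 (axis 1 1) (Q2 h x) + \<epsilon> h *\<^sub>R cross3 (Q1 h x) (Q2 h x)"
      and "R = (\<epsilon> h * \<rho> x) *\<^sub>R m + (2 * \<epsilon> h * \<sigma>13 x) *\<^sub>R P1 h x + (2 * \<epsilon> h * \<sigma>23 x) *\<^sub>R P2 h x"
    have "m = axis 3 1 + \<epsilon> h *\<^sub>R K"
      by (simp add: m_def K_def P1_def P2_def cross_add_left cross_add_right cross_mult_left cross_mult_right cross_basis scaleR_add_right)
    moreover have "director h x = m + \<epsilon> h *\<^sub>R R"
      by (simp add: director_def \<mu>_def R_def m_def scaleR_add_left scaleR_add_right)
    moreover have "Z h x = K + R" by (simp add: Z_def K_def R_def m_def add.assoc)
    ultimately show ?thesis by (simp add: scaleR_add_right)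
  qed
  ultimately show "dominated (\<lambda>_. \<omega>) \<epsilon> (\<lambda>h x. director h x - axis 3 1)"
    using scale by simp
qed

end

section \<open>Passage from the mid-surface to the plate\<close>

lemma norm_vec_le_sum: "norm x \<le> (\<Sum>i\<in>UNIV. norm (x $ i))"
  for x :: "'a::real_normed_vector^'n"
  unfolding norm_vec_def by (rule L2_set_le_sum) simp

lemma dominated_vec:
  fixes f :: "real \<Rightarrow> 'a \<Rightarrow> 'b::real_normed_vector^'n"
  assumes "\<And>i. dominated \<Omega> e (\<lambda>h x. f h x $ i)"
  shows "dominated \<Omega> e f"
proof -
  have "\<forall>i. \<exists>C\<ge>0. \<forall>h\<in>{0<..<1}. \<forall>x\<in>\<Omega> h. norm (f h x $ i) \<le> C * e h"
    using assms unfolding dominated_def by blast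
  then obtain C where C: "\<And>i. C i \<ge> 0" "\<And>i h x. h \<in> {0<..<1} \<Longrightarrow> x \<in> \<Omega> h \<Longrightarrow> norm (f h x $ i) \<le> C i * e h"
    by metis
  have "norm (f h x) \<le> (\<Sum>i\<in>UNIV. C i) * e h" if "h \<in> {0<..<1}" "x \<in> \<Omega> h" for h x
    using order_trans[OF norm_vec_le_sum sum_mono[OF C(2)[OF that]]] by (simp add: sum_distrib_right)
  then show ?thesis unfolding dominated_def using C(1) by (intro exI[of _ "\<Sum>i\<in>UNIV. C i"]) (auto intro: sum_nonneg)
qed

lemma tame_partial_derivatives:
  assumes "tame \<omega> M f"
  shows "\<And>h x. h \<in> {0<..<1} \<Longrightarrow> x \<in> \<omega> \<Longrightarrow> (f h has_derivative frechet_derivative (f h) (at x)) (at x)"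
    and "dominated (\<lambda>_. \<omega>) M (\<lambda>h x. frechet_derivative (f h) (at x) v)"
proof -
  obtain C where C: "C \<ge> 0" and f: "\<And>h x. h \<in> {0<..<1} \<Longrightarrow> x \<in> \<omega> \<Longrightarrow>
      (\<exists>D. (f h has_derivative D) (at x) \<and> (\<forall>v. norm (D v) \<le> C * M h * norm v))"
    using assms unfolding tame_def by metis
  show "(f h has_derivative frechet_derivative (f h) (at x)) (at x)" if "h \<in> {0<..<1}" "x \<in> \<omega>" for h x
    using f[OF that] by (auto simp: frechet_derivative_works[symmetric] differentiable_def)
  have "norm (frechet_derivative (f h) (at x) v) \<le> (C * norm v) * M h" if hx: "h \<in> {0<..<1}" "x \<in> \<omega>" for h x
  proof -
    obtain D where D: "(f h has_derivative D) (at x)" "norm (D v) \<le> C * M h * norm v" using f[OF hx] by blast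
    then have "frechet_derivative (f h) (at x) = D" using frechet_derivative_at by metis
    then show ?thesis using D(2) by (simp add: mult_ac)
  qed
  then show "dominated (\<lambda>_. \<omega>) M (\<lambda>h x. frechet_derivative (f h) (at x) v)"
    unfolding dominated_def using C by (intro exI[of _ "C * norm v"]) auto
qed

lemma bounded_linear_planar: "bounded_linear planar"
proof -
  have "linear planar" by (rule linearI) (simp_all add: planar_def vec_eq_iff forall_2)
  then show ?thesis by (simp add: linear_conv_bounded_linear)
qed

lemma dominated_planar:
  "dominated (\<lambda>_. \<omega>) e f \<Longrightarrow> dominated (thin_plate \<omega>) e (\<lambda>h x. f h (planar x))"
  unfolding dominated_def thin_plate_def by blast

lemma dominated_thickness: "dominated (thin_plate \<omega>) (\<lambda>h. h) (\<lambda>h x. x $ 3)"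
  unfolding dominated_def thin_plate_def by (intro exI[of _ 1]) auto

context corrugated_plate begin

text \<open>Size of the terms that the linear extension adds to the first two columns of the
  gradient: the thickness times a derivative of the director.\<close>

definition "q h = h * (\<epsilon> h * M h)"

definition "T1 h x = x $ 3 *\<^sub>R frechet_derivative (director h) (at (planar x)) (axis 1 1)"
definition "T2 h x = x $ 3 *\<^sub>R frechet_derivative (director h) (at (planar x)) (axis 2 1)"

text \<open>The columns of the gradient, stored as rows so that \<open>$ i\<close> selects them. The
  third is the director itself because the extension is linear in \<open>x\<^sub>3\<close>.\<close>

definition "column_field h x = (vector [P1 h (planar x) + T1 h x, P2 h (planar x) + T2 h x, director h (planar x)] :: (real^3)^3)"
definition "deformation h x = \<Phi> h (planar x) + x $ 3 *\<^sub>R director h (planar x)"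
definition "deformation_gradient h x = transpose (column_field h x)"
definition "\<Sigma> x = (vector [vector [\<sigma>11 x, \<sigma>12 x, \<sigma>13 x], vector [\<sigma>12 x, \<sigma>22 x, \<sigma>23 x], vector [\<sigma>13 x, \<sigma>23 x, \<sigma>33 x]] :: real^3^3)"

lemma deformation_derivative:
  assumes h: "h \<in> {0<..<1}" and x: "x \<in> thin_plate \<omega> h"
  shows "(deformation h has_derivative (\<lambda>v. deformation_gradient h x *v v)) (at x)"
proof -
  have y: "planar x \<in> \<omega>" "planar x \<in> U" using x \<omega>(2) closure_subset by (auto simp: thin_plate_def)
  have pl: "(planar has_derivative planar) (at x)"
    by (rule bounded_linear_imp_has_derivative[OF bounded_linear_planar])
  let ?D = "frechet_derivative (director h) (at (planar x))"
  note Dd = tame_partial_derivatives(1)[OF tame_frame(3) h y(1)]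
  have Dlin: "?D (planar v) = v $ 1 *\<^sub>R ?D (axis 1 1) + v $ 2 *\<^sub>R ?D (axis 2 1)" for v
  proof -
    have "planar v = v $ 1 *\<^sub>R axis 1 1 + v $ 2 *\<^sub>R axis 2 1"
      by (simp add: planar_def vec_eq_iff forall_2 axis_def)
    then show ?thesis
      using linear_add[OF has_derivative_linear[OF Dd]] linear_cmul[OF has_derivative_linear[OF Dd]] by simp
  qed
  have "((\<lambda>x. \<Phi> h (planar x) + x $ 3 *\<^sub>R director h (planar x)) has_derivative
      (\<lambda>v. (planar v $ 1 *\<^sub>R P1 h (planar x) + planar v $ 2 *\<^sub>R P2 h (planar x))
        + (x $ 3 *\<^sub>R ?D (planar v) + v $ 3 *\<^sub>R director h (planar x)))) (at x)"
    by (intro has_derivative_add has_derivative_scaleR has_derivative_compose[OF pl \<Phi>_derivative[OF h y(2)]]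
      has_derivative_compose[OF pl Dd] bounded_linear.has_derivative[OF bounded_linear_vec_nth has_derivative_ident])
  moreover have "(planar v $ 1 *\<^sub>R P1 h (planar x) + planar v $ 2 *\<^sub>R P2 h (planar x))
        + (x $ 3 *\<^sub>R ?D (planar v) + v $ 3 *\<^sub>R director h (planar x)) = deformation_gradient h x *v v" for v
    unfolding Dlin deformation_gradient_def column_field_def
    by (simp add: planar_def T1_def T2_def vec_eq_iff matrix_vector_mult_def transpose_def sum_3 algebra_simps)
  ultimately show ?thesis unfolding deformation_def[abs_def] by simp
qed

text \<open>The Gram matrix of the columns is the metric of the frame plus inner products containing
  \<open>T1\<close> or \<open>T2\<close>. Those linear in \<open>T1\<close> and \<open>T2\<close>
  have size \<open>q\<close>, and \<open>q \<le> 1\<close> gives the same for products of two of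
  them.\<close>

lemma strain_error:
  assumes q1: "\<And>h. h \<in> {0<..<1} \<Longrightarrow> q h \<le> 1"
  shows "dominated (thin_plate \<omega>) (\<lambda>_. 1) deformation"
    and "dominated (thin_plate \<omega>) (\<lambda>h. \<epsilon> h + q h) (\<lambda>h x. deformation_gradient h x - mat 1)"
    and "dominated (thin_plate \<omega>) (\<lambda>h. e0 h + q h)
      (\<lambda>h x. transpose (deformation_gradient h x) ** deformation_gradient h x
        - (mat 1 + (2 * e h) *\<^sub>R \<Sigma> (planar x)))"
proof -
  let ?\<Omega> = "thin_plate \<omega>"
  let ?err = "dominated ?\<Omega> (\<lambda>h. e0 h + q h)"
  have q0: "0 \<le> q h" if "h \<in> {0<..<1}" for h using that \<epsilon> M by (simp add: q_def)
  have e00: "0 \<le> e0 h" if "h \<in> {0<..<1}" for h using that e \<eta> by (simp add: e0_def)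
  have T: "dominated ?\<Omega> q T1" "dominated ?\<Omega> q T2"
    unfolding T1_def[abs_def] T2_def[abs_def] q_def[abs_def]
    by (intro dominated_bilinear[OF bounded_bilinear_scaleR dominated_thickness dominated_planar]
      tame_partial_derivatives(2) tame_frame)+
  have P: "dominated ?\<Omega> (\<lambda>_. 1) (\<lambda>h x. P1 h (planar x))" "dominated ?\<Omega> (\<lambda>_. 1) (\<lambda>h x. P2 h (planar x))"
    "dominated ?\<Omega> (\<lambda>_. 1) (\<lambda>h x. director h (planar x))" "dominated ?\<Omega> (\<lambda>_. 1) (\<lambda>h x. \<Phi> h (planar x))"
    by (rule dominated_planar[OF tame_imp_dominated[OF tame_frame(1)]]
        dominated_planar[OF tame_imp_dominated[OF tame_frame(2)]]
        dominated_planar[OF tame_imp_dominated[OF tame_frame(3)]]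
        dominated_planar[OF tame_imp_dominated[OF tame_Q(3)]])+
  have one: "dominated ?\<Omega> (\<lambda>_. 1) f" if "dominated ?\<Omega> q f" for f :: "real \<Rightarrow> real^3 \<Rightarrow> real^3"
    by (rule dominated_mono[OF that, of 1]) (use q1 in auto)
  have t1: "dominated ?\<Omega> (\<lambda>_. 1) (\<lambda>h x. x $ 3)"
    by (rule dominated_mono[OF dominated_thickness, of 1]) auto
  show "dominated ?\<Omega> (\<lambda>_. 1) deformation"
    unfolding deformation_def[abs_def]
    by (intro dominated_add P dominated_bilinear_bounded[OF bounded_bilinear_scaleR t1])
  have weak: "dominated ?\<Omega> (\<lambda>h. \<epsilon> h + q h) f" if "dominated ?\<Omega> \<epsilon> f \<or> dominated ?\<Omega> q f" for f :: "real \<Rightarrow> real^3 \<Rightarrow> real^3"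
    using that
  proof
    assume "dominated ?\<Omega> \<epsilon> f" then show ?thesis by (rule dominated_mono[of _ _ _ 1]) (use q0 in auto)
  next
    assume "dominated ?\<Omega> q f" then show ?thesis by (rule dominated_mono[of _ _ _ 1]) (use \<epsilon> in auto)
  qed
  have cols: "dominated ?\<Omega> (\<lambda>h. \<epsilon> h + q h) (\<lambda>h x. (P1 h (planar x) - axis 1 1) + T1 h x)"
    "dominated ?\<Omega> (\<lambda>h. \<epsilon> h + q h) (\<lambda>h x. (P2 h (planar x) - axis 2 1) + T2 h x)"
    "dominated ?\<Omega> (\<lambda>h. \<epsilon> h + q h) (\<lambda>h x. director h (planar x) - axis 3 1)"
    by (rule dominated_add[OF weak[OF disjI1[OF dominated_planar[OF frame_error(1)]]] weak[OF disjI2[OF T(1)]]]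
        dominated_add[OF weak[OF disjI1[OF dominated_planar[OF frame_error(2)]]] weak[OF disjI2[OF T(2)]]]
        weak[OF disjI1[OF dominated_planar[OF frame_error(3)]]])+
  have "dominated ?\<Omega> (\<lambda>h. \<epsilon> h + q h) (\<lambda>h x. column_field h x - mat 1)"
  proof (rule dominated_vec)
    fix i :: 3
    have "mat 1 $ i = (axis i 1 :: real^3)" by (simp add: mat_def axis_def vec_eq_iff eq_commute)
    then show "dominated ?\<Omega> (\<lambda>h. \<epsilon> h + q h) (\<lambda>h x. (column_field h x - mat 1) $ i)"
      using exhaust_3[of i] cols by (auto simp: column_field_def algebra_simps)
  qed
  moreover have "norm (deformation_gradient h x - mat 1) = norm (column_field h x - mat 1)" for h x
  proof -
    have "deformation_gradient h x - mat 1 = transpose (column_field h x - mat 1)"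
      by (simp add: deformation_gradient_def transpose_def vec_eq_iff mat_def)
    then show ?thesis by (simp add: norm_transpose)
  qed
  ultimately show "dominated ?\<Omega> (\<lambda>h. \<epsilon> h + q h) (\<lambda>h x. deformation_gradient h x - mat 1)"
    unfolding dominated_def by simp
  have weak_e: "?err (\<lambda>h x. f h (planar x))" if "dominated (\<lambda>_. \<omega>) e0 f"
    for f :: "real \<Rightarrow> real^2 \<Rightarrow> real"
    by (rule dominated_mono[OF dominated_planar[OF that], of 1]) (use q0 in auto)
  have weak_q: "?err f" if "dominated ?\<Omega> q f" for f :: "real \<Rightarrow> real^3 \<Rightarrow> real"
    by (rule dominated_mono[OF that, of 1]) (use e00 in auto)
  have ip: "dominated ?\<Omega> q (\<lambda>h x. f h x \<bullet> g h x)" if "dominated ?\<Omega> q f" "dominated ?\<Omega> (\<lambda>_. 1) g"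
    for f g :: "real \<Rightarrow> real^3 \<Rightarrow> real^3"
    by (rule dominated_bilinear_bounded[OF bounded_bilinear_inner that])
  note rules = weak_e[OF metric_error(1)] weak_e[OF metric_error(2)] weak_e[OF metric_error(3)]
    weak_e[OF metric_error(4)] weak_e[OF metric_error(5)] weak_e[OF metric_error(6)]
    weak_q[OF ip[OF T(1) P(1)]] weak_q[OF ip[OF T(1) P(2)]] weak_q[OF ip[OF T(1) P(3)]]
    weak_q[OF ip[OF T(2) P(1)]] weak_q[OF ip[OF T(2) P(2)]] weak_q[OF ip[OF T(2) P(3)]]
    weak_q[OF ip[OF T(1) one[OF T(1)]]] weak_q[OF ip[OF T(1) one[OF T(2)]]] weak_q[OF ip[OF T(2) one[OF T(2)]]]
    dominated_add
  let ?c = "\<lambda>i h x. column_field h x $ i"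
  have entries: "?err (\<lambda>h x. ?c 1 h x \<bullet> ?c 1 h x - (1 + 2 * e h * \<sigma>11 (planar x)))"
    "?err (\<lambda>h x. ?c 1 h x \<bullet> ?c 2 h x - 2 * e h * \<sigma>12 (planar x))"
    "?err (\<lambda>h x. ?c 2 h x \<bullet> ?c 2 h x - (1 + 2 * e h * \<sigma>22 (planar x)))"
    "?err (\<lambda>h x. ?c 1 h x \<bullet> ?c 3 h x - 2 * e h * \<sigma>13 (planar x))"
    "?err (\<lambda>h x. ?c 2 h x \<bullet> ?c 3 h x - 2 * e h * \<sigma>23 (planar x))"
    "?err (\<lambda>h x. ?c 3 h x \<bullet> ?c 3 h x - (1 + 2 * e h * \<sigma>33 (planar x)))"
  proof -
    have "?c 1 h x \<bullet> ?c 1 h x - (1 + 2 * e h * \<sigma>11 (planar x)) =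
        (P1 h (planar x) \<bullet> P1 h (planar x) - (1 + 2 * e h * \<sigma>11 (planar x)))
        + (T1 h x \<bullet> P1 h (planar x) + T1 h x \<bullet> P1 h (planar x) + T1 h x \<bullet> T1 h x)" for h x
      by (simp add: column_field_def inner_add_left inner_add_right inner_commute[of "P1 h (planar x)" "T1 h x"])
    then show "?err (\<lambda>h x. ?c 1 h x \<bullet> ?c 1 h x - (1 + 2 * e h * \<sigma>11 (planar x)))"
      by (simp only:) (rule rules)+
    have "?c 1 h x \<bullet> ?c 2 h x - 2 * e h * \<sigma>12 (planar x) =
        (P1 h (planar x) \<bullet> P2 h (planar x) - 2 * e h * \<sigma>12 (planar x))
        + (T1 h x \<bullet> P2 h (planar x) + T2 h x \<bullet> P1 h (planar x) + T1 h x \<bullet> T2 h x)" for h x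
      by (simp add: column_field_def inner_add_left inner_add_right inner_commute[of "P1 h (planar x)" "T2 h x"])
    then show "?err (\<lambda>h x. ?c 1 h x \<bullet> ?c 2 h x - 2 * e h * \<sigma>12 (planar x))"
      by (simp only:) (rule rules)+
    have "?c 2 h x \<bullet> ?c 2 h x - (1 + 2 * e h * \<sigma>22 (planar x)) =
        (P2 h (planar x) \<bullet> P2 h (planar x) - (1 + 2 * e h * \<sigma>22 (planar x)))
        + (T2 h x \<bullet> P2 h (planar x) + T2 h x \<bullet> P2 h (planar x) + T2 h x \<bullet> T2 h x)" for h x
      by (simp add: column_field_def inner_add_left inner_add_right inner_commute[of "P2 h (planar x)" "T2 h x"])
    then show "?err (\<lambda>h x. ?c 2 h x \<bullet> ?c 2 h x - (1 + 2 * e h * \<sigma>22 (planar x)))"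
      by (simp only:) (rule rules)+
    have "?c 1 h x \<bullet> ?c 3 h x - 2 * e h * \<sigma>13 (planar x) =
        (director h (planar x) \<bullet> P1 h (planar x) - 2 * e h * \<sigma>13 (planar x))
        + T1 h x \<bullet> director h (planar x)" for h x
      by (simp add: column_field_def inner_add_left inner_add_right inner_commute[of "director h (planar x)"])
    then show "?err (\<lambda>h x. ?c 1 h x \<bullet> ?c 3 h x - 2 * e h * \<sigma>13 (planar x))"
      by (simp only:) (rule rules)+
    have "?c 2 h x \<bullet> ?c 3 h x - 2 * e h * \<sigma>23 (planar x) =
        (director h (planar x) \<bullet> P2 h (planar x) - 2 * e h * \<sigma>23 (planar x))
        + T2 h x \<bullet> director h (planar x)" for h x
      by (simp add: column_field_def inner_add_left inner_add_right inner_commute[of "director h (planar x)"])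
    then show "?err (\<lambda>h x. ?c 2 h x \<bullet> ?c 3 h x - 2 * e h * \<sigma>23 (planar x))"
      by (simp only:) (rule rules)+
    show "?err (\<lambda>h x. ?c 3 h x \<bullet> ?c 3 h x - (1 + 2 * e h * \<sigma>33 (planar x)))"
      unfolding column_field_def vector_3 by (rule rules)
  qed
  have gram: "(transpose (deformation_gradient h x) ** deformation_gradient h x) $ i $ j = ?c i h x \<bullet> ?c j h x" for h x i j
    by (simp add: deformation_gradient_def matrix_matrix_mult_def transpose_def inner_vec_def)
  show "?err
      (\<lambda>h x. transpose (deformation_gradient h x) ** deformation_gradient h x
        - (mat 1 + (2 * e h) *\<^sub>R \<Sigma> (planar x)))"
  proof (rule dominated_vec, rule dominated_vec)
    fix i j :: 3
    show "?err (\<lambda>h x. (transpose (deformation_gradient h x) ** deformation_gradient h x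
        - (mat 1 + (2 * e h) *\<^sub>R \<Sigma> (planar x))) $ i $ j)"
      unfolding vector_minus_component vector_add_component vector_scaleR_component gram
      using exhaust_3[of i] exhaust_3[of j] entries
      by (auto simp: mat_def \<Sigma>_def inner_commute)
  qed
qed

end

section \<open>The energy of a thin plate\<close>

lemma norm_matrix_vector_mult: "norm (A *v x) \<le> norm A * norm x" for A :: "real^'n^'m"
proof -
  have "(norm (A *v x))\<^sup>2 = (\<Sum>i\<in>UNIV. (A $ i \<bullet> x)\<^sup>2)"
    by (simp add: matrix_mult_dot norm_vec_def L2_set_def sum_nonneg)
  also have "\<dots> \<le> (\<Sum>i\<in>UNIV. (norm (A $ i))\<^sup>2 * (norm x)\<^sup>2)"
  proof (rule sum_mono)
    fix i show "(A $ i \<bullet> x)\<^sup>2 \<le> (norm (A $ i))\<^sup>2 * (norm x)\<^sup>2"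
      using power_mono[OF Cauchy_Schwarz_ineq2[of "A $ i" x], of 2] by (simp add: power_mult_distrib)
  qed
  also have "\<dots> = (norm A * norm x)\<^sup>2"
    by (simp add: norm_vec_def[of A] L2_set_def sum_nonneg sum_distrib_right power_mult_distrib)
  finally show ?thesis by (rule power2_le_imp_le) simp
qed

lemma bounded_bilinear_matrix_mult:
  "bounded_bilinear ((**) :: real^'k^'m \<Rightarrow> real^'n^'k \<Rightarrow> real^'n^'m)"
proof
  show "(a + a') ** b = a ** b + a' ** b" for a a' :: "real^'k^'m" and b :: "real^'n^'k"
    by (simp add: matrix_matrix_mult_def vec_eq_iff algebra_simps sum.distrib)
  show "a ** (b + b') = a ** b + a ** b'" for a :: "real^'k^'m" and b b' :: "real^'n^'k"
    by (simp add: matrix_matrix_mult_def vec_eq_iff algebra_simps sum.distrib)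
  show "(r *\<^sub>R a) ** b = r *\<^sub>R (a ** b)" for r and a :: "real^'k^'m" and b :: "real^'n^'k"
    by (simp add: matrix_matrix_mult_def vec_eq_iff sum_distrib_left mult.assoc)
  show "a ** (r *\<^sub>R b) = r *\<^sub>R (a ** b)" for r and a :: "real^'k^'m" and b :: "real^'n^'k"
    by (simp add: matrix_matrix_mult_def vec_eq_iff sum_distrib_left mult.left_commute)
  show "\<exists>K. \<forall>a b. norm ((a :: real^'k^'m) ** (b :: real^'n^'k)) \<le> norm a * norm b * K"
    using norm_matrix_matrix_mult by (intro exI[of _ 1]) auto
qed

lemmas matrix_mult_diff_left = bounded_bilinear.diff_left[OF bounded_bilinear_matrix_mult]
  and matrix_mult_diff_right = bounded_bilinear.diff_right[OF bounded_bilinear_matrix_mult]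

text \<open>A kernel vector satisfies \<open>(A - 1) x = - x\<close>, which the bound
  \<open>1/2\<close> permits only for \<open>x = 0\<close>. The norm estimate comes from
  \<open>J = 1 - (A - 1) J\<close> for the inverse \<open>J\<close>; the Frobenius norm of the
  identity, in general above \<open>1\<close>, stays in the constant.\<close>

lemma matrix_inv_near_identity:
  fixes A :: "real^'n^'n"
  assumes A: "norm (A - mat 1) \<le> 1/2"
  shows "A ** matrix_inv A = mat 1" "norm (matrix_inv A) \<le> 2 * norm (mat 1 :: real^'n^'n)"
proof -
  have "x = 0" if "A *v x = 0" for x
  proof -
    have "(A - mat 1) *v x = - x" using that by (simp add: matrix_vector_mult_diff_rdistrib)
    then have "norm x \<le> 1/2 * norm x"
      using norm_matrix_vector_mult[of "A - mat 1" x] mult_right_mono[OF A norm_ge_zero[of x]]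
      by (metis norm_minus_cancel order_trans)
    then have "norm x \<le> 0" by simp
    then show ?thesis by simp
  qed
  then have "invertible A"
    using invertible_left_inverse matrix_left_invertible_ker by blast
  then have inv: "A ** matrix_inv A = mat 1"
    unfolding matrix_inv_def invertible_def by (metis (mono_tags, lifting) someI_ex)
  then show "A ** matrix_inv A = mat 1" .
  have "matrix_inv A = mat 1 - (A - mat 1) ** matrix_inv A"
    using inv by (simp add: matrix_mult_diff_left)
  then have "norm (matrix_inv A) \<le> norm (mat 1 :: real^'n^'n) + norm ((A - mat 1) ** matrix_inv A)"
    by (metis norm_triangle_ineq4)
  also have "norm ((A - mat 1) ** matrix_inv A) \<le> 1/2 * norm (matrix_inv A)"
    using order_trans[OF norm_matrix_matrix_mult mult_right_mono[OF A norm_ge_zero]] .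
  finally show "norm (matrix_inv A) \<le> 2 * norm (mat 1 :: real^'n^'n)" by simp
qed

text \<open>With \<open>J\<close> the inverse of \<open>A\<close>,
  \<open>F^T F - 1 = J^T (G^T G - A^T A) J\<close>: for the strain it is the metrics of deformation
  and prestrain that have to agree closely, while \<open>G\<close> and \<open>A\<close> themselves
  may differ by more.\<close>

lemma strain_relative_to_prestrain:
  fixes A G :: "real^'n^'n"
  assumes A: "norm (A - mat 1) \<le> 1/2"
  defines "K \<equiv> 2 * norm (mat 1 :: real^'n^'n)" and "F \<equiv> G ** matrix_inv A"
  shows "norm (F - mat 1) \<le> norm (G - A) * K"
    "norm (transpose F ** F - mat 1) \<le> K * norm (transpose G ** G - transpose A ** A) * K"
proof -
  define J where "J = matrix_inv A"
  have J: "A ** J = mat 1" "norm J \<le> K" unfolding J_def K_def using matrix_inv_near_identity[OF A] by auto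
  have F: "F = G ** J" by (simp add: F_def J_def)
  have "F - mat 1 = (G - A) ** J" by (simp add: F matrix_mult_diff_left J)
  then show "norm (F - mat 1) \<le> norm (G - A) * K"
    using order_trans[OF norm_matrix_matrix_mult mult_left_mono[OF J(2) norm_ge_zero]] by metis
  have "transpose J ** (transpose A ** A) ** J = mat 1"
    by (metis J(1) matrix_mul_assoc matrix_mul_lid matrix_transpose_mul transpose_mat)
  then have "transpose F ** F - mat 1 = transpose J ** (transpose G ** G - transpose A ** A) ** J"
    by (simp add: F matrix_transpose_mul matrix_mult_diff_left matrix_mult_diff_right matrix_mul_assoc)
  then have "norm (transpose F ** F - mat 1) \<le> norm (transpose J ** (transpose G ** G - transpose A ** A)) * norm J"
    using norm_matrix_matrix_mult by metis
  also have "\<dots> \<le> norm (transpose J) * norm (transpose G ** G - transpose A ** A) * norm J"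
    by (intro mult_right_mono norm_matrix_matrix_mult norm_ge_zero)
  also have "\<dots> \<le> K * norm (transpose G ** G - transpose A ** A) * K"
    using J(2) by (intro mult_mono) (auto simp: norm_transpose K_def)
  finally show "norm (transpose F ** F - mat 1) \<le> K * norm (transpose G ** G - transpose A ** A) * K" .
qed

lemma open_thin_plate: "open \<omega> \<Longrightarrow> open (thin_plate \<omega> h)"
proof -
  assume "open \<omega>"
  have 1: "open (planar -` \<omega>)"
    using \<open>open \<omega>\<close> linear_continuous_on[OF bounded_linear_planar] by (simp add: open_vimage)
  have "open {x :: real^3. - h / 2 < x $ 3}" "open {x :: real^3. x $ 3 < h / 2}"
    by (auto intro!: open_Collect_less continuous_intros)
  then have "open (planar -` \<omega> \<inter> {x. - h / 2 < x $ 3} \<inter> {x. x $ 3 < h / 2})" using 1 by blast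
  moreover have "thin_plate \<omega> h = planar -` \<omega> \<inter> {x. - h / 2 < x $ 3} \<inter> {x. x $ 3 < h / 2}"
    by (auto simp: thin_plate_def)
  ultimately show ?thesis by simp
qed

text \<open>The factor \<open>h\<close> in the volume bound compensates \<open>1 / h\<close> in the
  energy; a box with base of side \<open>2 * R\<close> gives \<open>V = 4 * R^2\<close>.\<close>

lemma thin_plate_measure:
  assumes "bounded \<omega>"
  obtains V where "V \<ge> 0" "\<And>h. h > 0 \<Longrightarrow> bounded (thin_plate \<omega> h)"
    "\<And>h. h > 0 \<Longrightarrow> emeasure lebesgue (thin_plate \<omega> h) \<le> ennreal (V * h)"
proof -
  obtain R where R: "R > 0" "\<And>y. y \<in> \<omega> \<Longrightarrow> norm y \<le> R" using assms bounded_pos by blast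
  define box where "box h = cbox (vector [-R, -R, -h/2]) (vector [R, R, h/2] :: real^3)" for h
  have sub: "thin_plate \<omega> h \<subseteq> box h" for h
  proof
    fix x assume x: "x \<in> thin_plate \<omega> h"
    then have "\<bar>planar x $ i\<bar> \<le> R" for i
      using R(2)[of "planar x"] component_le_norm_cart[of "planar x" i] by (auto simp: thin_plate_def)
    from this[of 1] this[of 2] show "x \<in> box h"
      using x by (auto simp: box_def mem_box_cart forall_3 thin_plate_def planar_def)
  qed
  have "emeasure lebesgue (thin_plate \<omega> h) \<le> ennreal ((4 * R\<^sup>2) * h)" if "h > 0" for h
  proof -
    have ne: "box h \<noteq> {}" using R(1) that by (auto simp: box_def interval_ne_empty_cart forall_3)
    have "emeasure lebesgue (thin_plate \<omega> h) \<le> emeasure lebesgue (box h)"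
      using sub by (intro emeasure_mono) (auto simp: box_def)
    also have "\<dots> = emeasure lborel (box h)" by (simp add: box_def)
    also have "\<dots> = ennreal (measure lborel (box h))"
      unfolding box_def by (rule emeasure_eq_ennreal_measure) (simp add: emeasure_lborel_cbox_eq)
    also have "measure lborel (box h) =
        (\<Prod>i\<in>UNIV. (vector [R, R, h/2] :: real^3) $ i - (vector [-R, -R, -h/2] :: real^3) $ i)"
      using ne unfolding box_def by (rule content_cbox_cart)
    also have "\<dots> = 4 * R\<^sup>2 * h"
      unfolding UNIV_3 by (simp add: power2_eq_square)
    finally show ?thesis .
  qed
  moreover have "bounded (thin_plate \<omega> h)" for h
    by (rule bounded_subset[OF _ sub]) (simp add: box_def)
  ultimately show thesis using that[of "4 * R\<^sup>2"] by simp
qed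

text \<open>The bound on \<open>W\<close> is given along the classical gradient and is carried over
  to the chosen weak gradient almost everywhere.\<close>

lemma inf_energy_le:
  fixes A :: "real^3 \<Rightarrow> real^3^3"
  assumes W: "admissible_density W"
    and \<omega>: "open \<omega>" "bounded (thin_plate \<omega> h)" "emeasure lebesgue (thin_plate \<omega> h) \<le> ennreal (V * h)" "V \<ge> 0" "h > 0"
    and u: "\<And>x. x \<in> thin_plate \<omega> h \<Longrightarrow> (u has_derivative (\<lambda>v. G x *v v)) (at x)"
    and B: "\<And>x. x \<in> thin_plate \<omega> h \<Longrightarrow> norm (u x) \<le> B" "\<And>x. x \<in> thin_plate \<omega> h \<Longrightarrow> norm (G x) \<le> B"
    and E: "\<And>x. x \<in> thin_plate \<omega> h \<Longrightarrow> W (G x ** matrix_inv (prestrain \<alpha> \<gamma> S Bm h x)) \<le> E" "E \<ge> 0"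
  shows "inf_energy W \<omega> \<alpha> \<gamma> S Bm h \<le> ennreal (V * E)"
proof -
  let ?P = "thin_plate \<omega> h"
  note op = open_thin_plate[OF \<omega>(1), of h]
  have sP: "?P \<in> sets lebesgue" using op by (simp add: borel_open sets_completionI_sets)
  have wg: "u \<in> W12 ?P" "AE x in lebesgue_on ?P. weak_gradient ?P u x = G x"
    using weak_gradient_classical[OF op \<omega>(2), of u G B] u B by blast+
  have "inf_energy W \<omega> \<alpha> \<gamma> S Bm h \<le> energy W \<omega> \<alpha> \<gamma> S Bm h u"
    unfolding inf_energy_def by (rule INF_lower) (rule wg(1))
  also have "\<dots> \<le> ennreal (1 / h) * (\<integral>\<^sup>+ x. ennreal E \<partial>lebesgue_on ?P)"
    unfolding energy_def
  proof (intro mult_left_mono nn_integral_mono_AE)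
    have "AE x in lebesgue_on ?P. x \<in> ?P" using AE_space[of "lebesgue_on ?P"] by (simp add: sP)
    then show "AE x in lebesgue_on ?P. ennreal (W (weak_gradient ?P u x ** matrix_inv (prestrain \<alpha> \<gamma> S Bm h x))) \<le> ennreal E"
      using wg(2)
    proof eventually_elim
      case (elim x)
      then show ?case using E(1)[of x] by (simp add: ennreal_leI)
    qed
  qed simp
  also have "(\<integral>\<^sup>+ x. ennreal E \<partial>lebesgue_on ?P) = ennreal E * emeasure lebesgue ?P"
    using sP by (simp add: emeasure_restrict_space)
  also have "ennreal (1 / h) * (ennreal E * emeasure lebesgue ?P) \<le> ennreal (1 / h) * (ennreal E * ennreal (V * h))"
    using \<omega>(3) by (intro mult_left_mono) auto
  also have "\<dots> = ennreal (V * E)"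
    using \<omega> E(2) by (simp add: ennreal_mult[symmetric])
  finally show ?thesis .
qed

section \<open>Scaling of the infimum\<close>

lemma smooth_up_to_imp_dominated:
  fixes S :: "'a::euclidean_space \<Rightarrow> real^'n^'m"
  assumes "bounded \<omega>" "smooth_up_to (closure \<omega>) S"
  shows "dominated (\<lambda>_. \<omega>) (\<lambda>_. 1) (\<lambda>h. S)"
proof -
  obtain F where F: "\<And>i j k. Ck_on k UNIV (F i j)" "\<And>i j x. x \<in> closure \<omega> \<Longrightarrow> F i j x = S x $ i $ j"
    using smooth_up_to_entry_extension[OF _ assms(2)] assms(1) by (metis compact_closure)
  have "dominated (\<lambda>_. \<omega>) (\<lambda>_. 1) (\<lambda>h x. S x $ i $ j)" for i j
  proof (rule dominated_cong[OF tame_imp_dominated])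
    show "tame \<omega> (\<lambda>_. 1) (\<lambda>h. F i j)"
      by (rule tame_C1[OF F(1) assms(1)]) auto
    show "S x $ i $ j = F i j x" if "x \<in> \<omega>" for x
      using F(2) that closure_subset by (metis subsetD)
  qed
  then show ?thesis by (intro dominated_vec)
qed

text \<open>The displacement that produces the off-diagonal entry also stretches the second
  direction by \<open>\<kappa>2\<close>, so the amplitudes are the roots of
  \<open>S\<^sub>1\<^sub>1 + c\<close> and \<open>S\<^sub>2\<^sub>2 - \<kappa>2 + c\<close>. All
  data are fixed before \<open>N\<close> and \<open>\<epsilon>\<close>, so the constants cannot
  depend on the scales.\<close>

lemma corrugation_data:
  assumes \<omega>: "bounded \<omega>" and S: "smooth_up_to (closure \<omega>) S" "\<forall>x\<in>closure \<omega>. transpose (S x) = S x"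
  obtains U c a a1 a2 b b1 b2 \<kappa> \<kappa>1 \<kappa>2 \<sigma>13 \<sigma>23 \<sigma>33 where
    "\<And>N \<epsilon>. (\<And>h. h \<in> {0<..<1} \<Longrightarrow> 1 \<le> N h) \<Longrightarrow> (\<And>h. h \<in> {0<..<1} \<Longrightarrow> 0 \<le> \<epsilon> h) \<Longrightarrow>
       (\<And>h. h \<in> {0<..<1} \<Longrightarrow> \<epsilon> h \<le> 1) \<Longrightarrow>
       corrugated_plate \<omega> U N \<epsilon> a a1 a2 b b1 b2 \<kappa> \<kappa>1 \<kappa>2 \<sigma>13 \<sigma>23 \<sigma>33"
    "\<And>x. x \<in> \<omega> \<Longrightarrow> corrugated_plate.\<Sigma> c a b \<kappa>1 \<kappa>2 \<sigma>13 \<sigma>23 \<sigma>33 x = S x"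
proof -
  have K: "compact (closure \<omega>)" using \<omega> by (simp add: compact_closure)
  obtain F :: "3 \<Rightarrow> 3 \<Rightarrow> real^2 \<Rightarrow> real" where F: "\<And>i j k. Ck_on k UNIV (F i j)"
    "\<And>i j x. x \<in> closure \<omega> \<Longrightarrow> F i j x = S x $ i $ j"
    using smooth_up_to_entry_extension[OF K S(1)] by metis
  \<comment> \<open>The off-diagonal entry is taken one order smoother: \<open>\<kappa>2\<close>
    contains its derivative \<open>f2\<close>, \<open>b\<close> contains \<open>\<kappa>2\<close>,
    and \<open>b\<close> must be \<open>C\<^sup>2\<close>.\<close>
  obtain f1 f2 where f: "\<And>x. x \<in> UNIV \<Longrightarrow> (F 1 2 has_derivative (\<lambda>v. f1 x * v $ 1 + f2 x * v $ 2)) (at x)"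
    "Ck_on 2 UNIV f1" "Ck_on 2 UNIV f2"
    by (rule Ck_on_planar_SucE[OF F(1)[of "Suc 2" 1 2]]) blast
  define \<kappa> \<kappa>1 \<kappa>2 where "\<kappa> = (\<lambda>x. 2 * line_integral (F 1 2) x)" and "\<kappa>1 = (\<lambda>x. 2 * F 1 2 x)"
    and "\<kappa>2 = (\<lambda>x. 2 * line_integral f2 x)"
  have C\<kappa>: "Ck_on 2 UNIV \<kappa>" "Ck_on 2 UNIV \<kappa>1" "Ck_on 2 UNIV \<kappa>2"
    unfolding \<kappa>_def \<kappa>1_def \<kappa>2_def by (intro Ck_on_cmult Ck_on_line_integral F f open_UNIV)+
  have d\<kappa>: "(\<kappa> has_derivative (\<lambda>v. \<kappa>1 x * v $ 1 + \<kappa>2 x * v $ 2)) (at x)" for x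
  proof -
    have "(line_integral (F 1 2) has_derivative (\<lambda>v. F 1 2 x * v $ 1 + line_integral f2 x * v $ 2)) (at x)"
      by (rule has_derivative_line_integral[OF _ Ck_on_imp_continuous_on[OF f(3)]]) (use f(1) in auto)
    from has_derivative_mult_right[OF this, of 2] show ?thesis
      by (simp add: \<kappa>_def \<kappa>1_def \<kappa>2_def algebra_simps)
  qed
  have bd: "\<exists>B. \<forall>x\<in>closure \<omega>. \<bar>g x\<bar> \<le> B" if "Ck_on 2 UNIV g" for g :: "real^2 \<Rightarrow> real"
  proof -
    have "continuous_on (closure \<omega>) g"
      using Ck_on_imp_continuous_on[OF that] continuous_on_subset by blast
    then have "bounded (g ` closure \<omega>)" using K by (intro compact_imp_bounded compact_continuous_image)
    then show ?thesis by (auto simp: bounded_iff)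
  qed
  define A Bf where "A = F 1 1" and "Bf = (\<lambda>x. F 2 2 x - \<kappa>2 x)"
  have CAB: "Ck_on 2 UNIV A" "Ck_on 2 UNIV Bf"
    unfolding A_def Bf_def by (intro Ck_on_diff F C\<kappa> open_UNIV)+
  obtain B1 B2 where B: "\<And>x. x \<in> closure \<omega> \<Longrightarrow> \<bar>A x\<bar> \<le> B1" "\<And>x. x \<in> closure \<omega> \<Longrightarrow> \<bar>Bf x\<bar> \<le> B2"
    using bd[OF CAB(1)] bd[OF CAB(2)] by blast
  \<comment> \<open>The final \<open>1\<close> makes both radicands strictly positive on the
    closure, hence on an open neighbourhood, where the square root is smooth.\<close>
  define c where "c = \<bar>B1\<bar> + \<bar>B2\<bar> + 1"
  define U where "U = {x. 0 < A x + c} \<inter> {x. 0 < Bf x + c}"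
  have U: "open U" "closure \<omega> \<subseteq> U"
  proof -
    show "open U" unfolding U_def
      by (intro open_Int open_Collect_less continuous_intros Ck_on_imp_continuous_on[OF CAB(1)] Ck_on_imp_continuous_on[OF CAB(2)])
    show "closure \<omega> \<subseteq> U"
      using B by (fastforce simp: U_def c_def)
  qed
  define a b where "a = (\<lambda>x. sqrt (A x + c))" and "b = (\<lambda>x. sqrt (Bf x + c))"
  have sub: "Ck_on k UNIV g \<Longrightarrow> Ck_on k U g" for k and g :: "real^2 \<Rightarrow> real" by (rule Ck_on_subset) auto
  have Cab: "Ck_on (Suc 1) U a" "Ck_on (Suc 1) U b"
  proof -
    have "Ck_on 2 U a" unfolding a_def
      by (rule Ck_on_sqrt[OF U(1) Ck_on_add[OF U(1) sub[OF CAB(1)] Ck_on_const[OF U(1)]]]) (auto simp: U_def)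
    moreover have "Ck_on 2 U b" unfolding b_def
      by (rule Ck_on_sqrt[OF U(1) Ck_on_add[OF U(1) sub[OF CAB(2)] Ck_on_const[OF U(1)]]]) (auto simp: U_def)
    ultimately show "Ck_on (Suc 1) U a" "Ck_on (Suc 1) U b" by (simp_all only: Suc_1)
  qed
  obtain a1 a2 where a: "\<And>x. x \<in> U \<Longrightarrow> (a has_derivative (\<lambda>v. a1 x * v $ 1 + a2 x * v $ 2)) (at x)"
    "Ck_on 1 U a1" "Ck_on 1 U a2" by (rule Ck_on_planar_SucE[OF Cab(1)]) blast
  obtain b1 b2 where b: "\<And>x. x \<in> U \<Longrightarrow> (b has_derivative (\<lambda>v. b1 x * v $ 1 + b2 x * v $ 2)) (at x)"
    "Ck_on 1 U b1" "Ck_on 1 U b2" by (rule Ck_on_planar_SucE[OF Cab(2)]) blast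
  have one: "Ck_on 2 UNIV g \<Longrightarrow> Ck_on 1 U g" for g :: "real^2 \<Rightarrow> real"
    using sub Ck_on_mono[of 2 U g 1] by simp
  have cp: "corrugated_plate \<omega> U N \<epsilon> a a1 a2 b b1 b2 \<kappa> \<kappa>1 \<kappa>2 (F 1 3) (F 2 3) (F 3 3)"
    if "\<And>h. h \<in> {0<..<1} \<Longrightarrow> 1 \<le> N h" "\<And>h. h \<in> {0<..<1} \<Longrightarrow> 0 \<le> \<epsilon> h" "\<And>h. h \<in> {0<..<1} \<Longrightarrow> \<epsilon> h \<le> 1" for N \<epsilon>
  proof
    show "Ck_on 1 U a" "Ck_on 1 U b" using Cab by (auto intro: Ck_on_Suc_imp simp del: Ck_on.simps)
  qed (use \<omega> U that a b d\<kappa> one C\<kappa> F(1) in \<open>simp_all del: Ck_on.simps\<close>)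
  have \<Sigma>: "corrugated_plate.\<Sigma> c a b \<kappa>1 \<kappa>2 (F 1 3) (F 2 3) (F 3 3) x = S x" if x: "x \<in> \<omega>" for x
  proof -
    \<comment> \<open>\<open>\<Sigma>\<close> does not involve \<open>N\<close> and
      \<open>\<epsilon>\<close>, so constant values serve to unfold it.\<close>
    interpret corrugated_plate \<omega> U "\<lambda>_. 1" "\<lambda>_. 1" c a a1 a2 b b1 b2 \<kappa> \<kappa>1 \<kappa>2 "F 1 3" "F 2 3" "F 3 3"
      by (rule cp) auto
    have xK: "x \<in> closure \<omega>" "x \<in> U" using x closure_subset U(2) by blast+
    then have "\<sigma>11 x = S x $ 1 $ 1" "\<sigma>12 x = S x $ 1 $ 2" "\<sigma>22 x = S x $ 2 $ 2"
      unfolding \<sigma>11_def \<sigma>12_def \<sigma>22_def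
      by (auto simp: a_def b_def U_def A_def Bf_def \<kappa>1_def F(2))
    moreover have "S x $ i $ j = S x $ j $ i" for i j
      using S(2) xK(1) by (metis (no_types, lifting) transpose_def vec_lambda_beta)
    ultimately show ?thesis
      using xK(1) by (simp add: \<Sigma>_def vec_eq_iff forall_3 F(2))
  qed
  show thesis by (rule that[OF cp \<Sigma>])
qed

text \<open>The three powers are squares of errors in the metric: the common size of
  \<open>e * \<eta>\<close> and \<open>q\<close>, the size \<open>h powr \<alpha>\<close> of the
  terms quadratic in the strain, and the size \<open>h powr (1 + \<gamma> / 2)\<close> of the
  bending prestrain. Which of them dominates is left to the comparison of exponents.\<close>

lemma energy_scaling:
  assumes dom: "open \<omega>" "bounded \<omega>"
    and S: "smooth_up_to (closure \<omega>) S" "\<forall>x\<in>closure \<omega>. transpose (S x) = S x"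
    and B: "smooth_up_to (closure \<omega>) B" "\<forall>x\<in>closure \<omega>. transpose (B x) = B x"
    and W: "admissible_density W" and \<alpha>: "0 < \<alpha>" "\<alpha> < 4" and \<gamma>: "0 < \<gamma>"
  obtains C where "C > 0" "\<forall>\<^sub>F h in at_right 0. inf_energy W \<omega> \<alpha> \<gamma> S B h
    \<le> ennreal (C * (h powr (5 * \<alpha> / 6 + 2/3) + h powr (2 * \<alpha>) + h powr (2 + \<gamma>)))"
proof -
  obtain U c a a1 a2 b b1 b2 \<kappa> \<kappa>1 \<kappa>2 \<sigma>13 \<sigma>23 \<sigma>33 where cp:
    "\<And>N \<epsilon>. (\<And>h. h \<in> {0<..<1} \<Longrightarrow> 1 \<le> N h) \<Longrightarrow> (\<And>h. h \<in> {0<..<1} \<Longrightarrow> 0 \<le> \<epsilon> h) \<Longrightarrow>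
       (\<And>h. h \<in> {0<..<1} \<Longrightarrow> \<epsilon> h \<le> 1) \<Longrightarrow>
       corrugated_plate \<omega> U N \<epsilon> a a1 a2 b b1 b2 \<kappa> \<kappa>1 \<kappa>2 \<sigma>13 \<sigma>23 \<sigma>33"
    and \<Sigma>S: "\<And>x. x \<in> \<omega> \<Longrightarrow> corrugated_plate.\<Sigma> c a b \<kappa>1 \<kappa>2 \<sigma>13 \<sigma>23 \<sigma>33 x = S x"
    using corrugation_data[OF dom(2) S] by metis
  \<comment> \<open>For \<open>N = h powr (- n)\<close> the exponent of \<open>e * \<eta>\<close> is
    \<open>\<alpha> / 2 + n\<close> and that of \<open>q\<close> is
    \<open>1 + \<alpha> / 4 - 2 * n\<close>; they agree for \<open>n = (4 - \<alpha>) / 12\<close>,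
    which is positive by \<open>\<alpha> < 4\<close>. \<open>\<epsilon>\<close> is the square root
    of the prestrain amplitude \<open>h powr (\<alpha> / 2)\<close>.\<close>
  define N \<epsilon> where "N h = h powr (- ((4 - \<alpha>) / 12))" and "\<epsilon> h = h powr (\<alpha> / 4)" for h :: real
  interpret corrugated_plate \<omega> U N \<epsilon> c a a1 a2 b b1 b2 \<kappa> \<kappa>1 \<kappa>2 \<sigma>13 \<sigma>23 \<sigma>33
  proof (rule cp)
    fix h :: real assume h: "h \<in> {0<..<1}"
    show "1 \<le> N h" using h \<alpha> powr_mono'[of "- ((4 - \<alpha>) / 12)" 0 h] by (simp add: N_def)
    show "0 \<le> \<epsilon> h" by (simp add: \<epsilon>_def)
    show "\<epsilon> h \<le> 1" using h \<alpha> powr_mono'[of 0 "\<alpha> / 4" h] by (simp add: \<epsilon>_def)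
  qed
  have eh: "e h = h powr (\<alpha> / 2)" if "h \<in> {0<..<1}" for h
    using that by (simp add: e_def \<epsilon>_def powr_power)
  have \<eta>h: "\<eta> h = h powr ((4 - \<alpha>) / 12)" if "h \<in> {0<..<1}" for h
    using that by (simp add: \<eta>_def N_def powr_minus_divide)
  have qh: "q h = h powr (1/3 + 5 * \<alpha> / 12)" if "h \<in> {0<..<1}" for h
  proof -
    have "q h = h powr 1 * (h powr (\<alpha> / 4) * h powr (2 * - ((4 - \<alpha>) / 12)))"
      using that by (simp add: q_def \<epsilon>_def M_def N_def powr_power)
    also have "\<dots> = h powr (1 + (\<alpha> / 4 + 2 * - ((4 - \<alpha>) / 12)))"
      by (simp only: powr_add)
    also have "1 + (\<alpha> / 4 + 2 * - ((4 - \<alpha>) / 12)) = 1/3 + 5 * \<alpha> / 12" by (simp add: field_simps)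
    finally show ?thesis .
  qed
  have q1: "q h \<le> 1" if "h \<in> {0<..<1}" for h
    using that \<alpha> powr_mono'[of 0 "1/3 + 5 * \<alpha> / 12" h] by (simp add: qh)
  have q0: "0 \<le> q h" if "h \<in> {0<..<1}" for h using that by (simp add: qh)
  let ?P = "thin_plate \<omega>"
  \<comment> \<open>\<open>p\<close> is the size of the bending prestrain and \<open>r\<close> the
    error in the metric, which determines the energy; \<open>s\<close> bounds distances from the
    identity and only has to tend to zero.\<close>
  define p r s where "p h = h powr (1 + \<gamma> / 2)" and "r h = e0 h + q h + h powr (1 + \<gamma> / 2)"
    and "s h = \<epsilon> h + q h + h powr (\<alpha> / 2) + h powr (1 + \<gamma> / 2)" for h :: real
  define T where "T h x = (h powr (\<gamma> / 2) * x $ 3) *\<^sub>R B (planar x)" for h :: real and x :: "real^3"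
  define A where "A = prestrain \<alpha> \<gamma> S B"
  have yK: "planar x \<in> \<omega>" "planar x \<in> closure \<omega>" if "x \<in> ?P h" for x h
    using that closure_subset by (auto simp: thin_plate_def)
  have p0: "0 \<le> p h" for h by (simp add: p_def)
  have e00: "0 \<le> e0 h" if "h \<in> {0<..<1}" for h using that e \<eta> by (simp add: e0_def)
  have S1: "dominated ?P (\<lambda>_. 1) (\<lambda>h x. S (planar x))"
    by (rule dominated_planar[OF smooth_up_to_imp_dominated[OF dom(2) S(1)]])
  have Tp: "dominated ?P p T"
  proof -
    have "dominated ?P (\<lambda>h. h powr (\<gamma> / 2) * h) (\<lambda>h x. h powr (\<gamma> / 2) * x $ 3)"
      by (rule dominated_bilinear[OF bounded_bilinear_mult dominated_param dominated_thickness]) simp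
    from dominated_bilinear_bounded[OF bounded_bilinear_scaleR this
        dominated_planar[OF smooth_up_to_imp_dominated[OF dom(2) B(1)]]]
    have "dominated ?P (\<lambda>h. h powr (\<gamma> / 2) * h) T" unfolding T_def .
    then show ?thesis
      by (rule dominated_mono[of _ _ _ 1]) (auto simp: p_def powr_add)
  qed
  have p1: "p h \<le> 1" if "h \<in> {0<..<1}" for h
    using that \<gamma> powr_mono'[of 0 "1 + \<gamma> / 2" h] by (simp add: p_def)
  have T1': "dominated ?P (\<lambda>_. 1) T" by (rule dominated_mono[OF Tp, of 1]) (use p1 in auto)
  have AT: "A h x = mat 1 + e h *\<^sub>R S (planar x) + T h x" if "h \<in> {0<..<1}" for h x
    using eh[OF that] by (simp add: A_def prestrain_def T_def)
  have Asym: "transpose (A h x) = A h x" if "x \<in> ?P h" for h x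
  proof -
    have "S (planar x) $ i $ j = S (planar x) $ j $ i" "B (planar x) $ i $ j = B (planar x) $ j $ i" for i j
      using S(2) B(2) yK(2)[OF that] by (metis (no_types, lifting) transpose_def vec_lambda_beta)+
    then show ?thesis by (simp add: A_def prestrain_def transpose_def vec_eq_iff mat_def)
  qed
  have D1: "dominated ?P (\<lambda>h. e h + p h) (\<lambda>h x. A h x - mat 1)"
  proof (rule dominated_cong)
    show "A h x - mat 1 = e h *\<^sub>R S (planar x) + T h x" if "h \<in> {0<..<1}" for h x
      by (simp add: AT[OF that])
    have "dominated ?P e (\<lambda>h x. e h *\<^sub>R S (planar x))"
      by (rule dominated_bilinear_bounded[OF bounded_bilinear_scaleR dominated_param S1]) (use e in auto)
    then have "dominated ?P (\<lambda>h. e h + p h) (\<lambda>h x. e h *\<^sub>R S (planar x))"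
      by (rule dominated_mono[of _ _ _ 1]) (use p0 in auto)
    moreover have "dominated ?P (\<lambda>h. e h + p h) T"
      by (rule dominated_mono[OF Tp, of 1]) (use e in auto)
    ultimately show "dominated ?P (\<lambda>h. e h + p h) (\<lambda>h x. e h *\<^sub>R S (planar x) + T h x)"
      by (rule dominated_add)
  qed
  note mm = dominated_bilinear_bounded[OF bounded_bilinear_matrix_mult]
  \<comment> \<open>Since \<open>A\<close> is symmetric, \<open>A^T A\<close> is the square of
    \<open>1 + e S + T\<close>. Beyond \<open>1 + 2 e S\<close> it contains \<open>e^2 S^2\<close>,
    covered by \<open>e0\<close>, and terms with a factor \<open>T\<close>, covered by
    \<open>p\<close>.\<close>
  have D2: "dominated ?P r (\<lambda>h x. transpose (A h x) ** A h x - (mat 1 + (2 * e h) *\<^sub>R S (planar x)))"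
  proof (rule dominated_cong)
    fix h :: real and x assume hx: "h \<in> {0<..<1}" "x \<in> ?P h"
    note bil = bounded_bilinear.add_left[OF bounded_bilinear_matrix_mult]
      bounded_bilinear.add_right[OF bounded_bilinear_matrix_mult]
      bounded_bilinear.scaleR_left[OF bounded_bilinear_matrix_mult]
      bounded_bilinear.scaleR_right[OF bounded_bilinear_matrix_mult]
    have two: "(2 * e h) *\<^sub>R S (planar x) = e h *\<^sub>R S (planar x) + e h *\<^sub>R S (planar x)"
      by (simp add: scaleR_left_distrib[symmetric])
    show "transpose (A h x) ** A h x - (mat 1 + (2 * e h) *\<^sub>R S (planar x)) =
        (e h)\<^sup>2 *\<^sub>R (S (planar x) ** S (planar x)) + (T h x + T h x)
        + (e h *\<^sub>R (T h x ** S (planar x)) + e h *\<^sub>R (S (planar x) ** T h x)) + T h x ** T h x"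
      unfolding Asym[OF hx(2)] unfolding AT[OF hx(1)] two diff_eq_eq
      by (simp only: bil matrix_mul_lid matrix_mul_rid power2_eq_square scaleR_add_right scaleR_scaleR add_ac)
  next
    have weak_p: "dominated ?P r f" if "dominated ?P p f" for f :: "real \<Rightarrow> real^3 \<Rightarrow> real^3^3"
      by (rule dominated_mono[OF that, of 1]) (use e00 q0 in \<open>auto simp: r_def p_def\<close>)
    have e1: "dominated ?P (\<lambda>_. 1) (\<lambda>h x. e h)"
      using e by (intro dominated_param) auto
    have 1: "dominated ?P (\<lambda>h. (e h)\<^sup>2) (\<lambda>h x. (e h)\<^sup>2 *\<^sub>R (S (planar x) ** S (planar x)))"
      by (rule dominated_bilinear_bounded[OF bounded_bilinear_scaleR dominated_param mm[OF S1 S1]]) simp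
    have 2: "dominated ?P r (\<lambda>h x. (e h)\<^sup>2 *\<^sub>R (S (planar x) ** S (planar x)))"
      by (rule dominated_mono[OF 1, of 1]) (use e \<eta> q0 in \<open>auto simp: r_def e0_def\<close>)
    have sc: "dominated ?P r (\<lambda>h x. e h *\<^sub>R f h x)" if "dominated ?P p f" for f :: "real \<Rightarrow> real^3 \<Rightarrow> real^3^3"
      by (rule weak_p) (use dominated_bilinear[OF bounded_bilinear_scaleR e1 that] in simp)
    have ST: "dominated ?P p (\<lambda>h x. S (planar x) ** T h x)"
      using dominated_bilinear[OF bounded_bilinear_matrix_mult S1 Tp] by simp
    show "dominated ?P r (\<lambda>h x. (e h)\<^sup>2 *\<^sub>R (S (planar x) ** S (planar x)) + (T h x + T h x)
        + (e h *\<^sub>R (T h x ** S (planar x)) + e h *\<^sub>R (S (planar x) ** T h x)) + T h x ** T h x)"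
      by (rule dominated_add 2 sc[OF mm[OF Tp S1]] sc[OF ST] weak_p[OF Tp] weak_p[OF mm[OF Tp T1']])+
  qed
  let ?G = deformation_gradient
  \<comment> \<open>As \<open>\<Sigma>\<close> equals \<open>S\<close> on \<open>\<omega>\<close>,
    both metrics are compared with the same matrix \<open>1 + 2 e S\<close>.\<close>
  have D3: "dominated ?P r (\<lambda>h x. transpose (?G h x) ** ?G h x - transpose (A h x) ** A h x)"
  proof (rule dominated_cong)
    show "transpose (?G h x) ** ?G h x - transpose (A h x) ** A h x =
        (transpose (?G h x) ** ?G h x - (mat 1 + (2 * e h) *\<^sub>R \<Sigma> (planar x)))
        - (transpose (A h x) ** A h x - (mat 1 + (2 * e h) *\<^sub>R S (planar x)))" if "x \<in> ?P h" for h x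
      using \<Sigma>S[OF yK(1)[OF that]] by simp
    have "dominated ?P r (\<lambda>h x. transpose (?G h x) ** ?G h x - (mat 1 + (2 * e h) *\<^sub>R \<Sigma> (planar x)))"
      by (rule dominated_mono[OF strain_error(3)[OF q1], of 1]) (auto simp: r_def)
    then show "dominated ?P r (\<lambda>h x. (transpose (?G h x) ** ?G h x - (mat 1 + (2 * e h) *\<^sub>R \<Sigma> (planar x)))
        - (transpose (A h x) ** A h x - (mat 1 + (2 * e h) *\<^sub>R S (planar x))))"
      using D2 by (rule dominated_diff)
  qed
  have DA: "dominated ?P s (\<lambda>h x. A h x - mat 1)"
    by (rule dominated_mono[OF D1, of 1]) (use q0 \<epsilon> eh in \<open>auto simp: s_def p_def\<close>)
  have DG: "dominated ?P s (\<lambda>h x. ?G h x - mat 1)"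
    by (rule dominated_mono[OF strain_error(2)[OF q1], of 1]) (auto simp: s_def)
  have DGA: "dominated ?P s (\<lambda>h x. ?G h x - A h x)"
    using dominated_diff[OF DG DA] by simp
  obtain C1 C2 C3 C4 C5 where C: "C1 \<ge> 0"
    "\<And>h x. h \<in> {0<..<1} \<Longrightarrow> x \<in> ?P h \<Longrightarrow> norm (transpose (?G h x) ** ?G h x - transpose (A h x) ** A h x) \<le> C1 * r h"
    "\<And>h x. h \<in> {0<..<1} \<Longrightarrow> x \<in> ?P h \<Longrightarrow> norm (?G h x - A h x) \<le> C2 * s h"
    "\<And>h x. h \<in> {0<..<1} \<Longrightarrow> x \<in> ?P h \<Longrightarrow> norm (A h x - mat 1) \<le> C3 * s h"
    "\<And>h x. h \<in> {0<..<1} \<Longrightarrow> x \<in> ?P h \<Longrightarrow> norm (deformation h x) \<le> C4"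
    "\<And>h x. h \<in> {0<..<1} \<Longrightarrow> x \<in> ?P h \<Longrightarrow> norm (?G h x - mat 1) \<le> C5 * s h"
  proof -
    from D3 obtain C1 where c1: "C1 \<ge> 0"
      "\<And>h x. h \<in> {0<..<1} \<Longrightarrow> x \<in> ?P h \<Longrightarrow> norm (transpose (?G h x) ** ?G h x - transpose (A h x) ** A h x) \<le> C1 * r h"
      unfolding dominated_def by blast
    from DGA obtain C2 where c2: "\<And>h x. h \<in> {0<..<1} \<Longrightarrow> x \<in> ?P h \<Longrightarrow> norm (?G h x - A h x) \<le> C2 * s h"
      unfolding dominated_def by blast
    from DA obtain C3 where c3: "\<And>h x. h \<in> {0<..<1} \<Longrightarrow> x \<in> ?P h \<Longrightarrow> norm (A h x - mat 1) \<le> C3 * s h"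
      unfolding dominated_def by blast
    from strain_error(1)[OF q1] obtain C4 where c4: "\<And>h x. h \<in> {0<..<1} \<Longrightarrow> x \<in> ?P h \<Longrightarrow> norm (deformation h x) \<le> C4"
      unfolding dominated_def mult_1_right by blast
    from DG obtain C5 where c5: "\<And>h x. h \<in> {0<..<1} \<Longrightarrow> x \<in> ?P h \<Longrightarrow> norm (?G h x - mat 1) \<le> C5 * s h"
      unfolding dominated_def by blast
    show thesis by (rule that[OF c1 c2 c3 c4 c5])
  qed
  obtain CW d where CW: "CW > 0" "d > 0"
    "\<And>F. norm (F - mat 1) < d \<Longrightarrow> W F \<le> CW * (norm (transpose F ** F - mat 1))\<^sup>2"
    using admissible_density_strain_bound[OF W] by metis
  obtain V where V: "V \<ge> 0" "\<And>h. h > 0 \<Longrightarrow> bounded (?P h)"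
    "\<And>h. h > 0 \<Longrightarrow> emeasure lebesgue (?P h) \<le> ennreal (V * h)"
    using thin_plate_measure[OF dom(2)] by metis
  define K where "K = 2 * norm (mat 1 :: real^3^3)"
  have K0: "K \<ge> 0" by (simp add: K_def)
  define E where "E h = CW * (K * (C1 * r h) * K)\<^sup>2" for h
  have E0: "E h \<ge> 0" for h using CW(1) by (simp add: E_def)
  have h01: "\<forall>\<^sub>F h in at_right 0. h \<in> {0<..<1::real}"
    by (rule eventually_at_right_real) simp
  have s0: "(s \<longlongrightarrow> 0) (at_right 0)"
  proof -
    have pw: "((\<lambda>h::real. h powr t) \<longlongrightarrow> 0) (at_right 0)" if "t > 0" for t
      by (rule tendsto_zero_powrI[of _ _ _ t])
        (use that in \<open>auto intro!: tendsto_ident_at eventually_at_right_less[THEN eventually_mono]\<close>)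
    have "((\<lambda>h. h powr (\<alpha> / 4) + h powr (1/3 + 5 * \<alpha> / 12) + h powr (\<alpha> / 2) + h powr (1 + \<gamma> / 2)) \<longlongrightarrow> 0 + 0 + 0 + 0) (at_right 0)"
      using \<alpha> \<gamma> by (intro tendsto_add pw) auto
    then have "((\<lambda>h. h powr (\<alpha> / 4) + h powr (1/3 + 5 * \<alpha> / 12) + h powr (\<alpha> / 2) + h powr (1 + \<gamma> / 2)) \<longlongrightarrow> 0) (at_right 0)"
      by simp
    moreover have "\<forall>\<^sub>F h in at_right 0. h powr (\<alpha> / 4) + h powr (1/3 + 5 * \<alpha> / 12) + h powr (\<alpha> / 2) + h powr (1 + \<gamma> / 2) = s h"
      using h01 by eventually_elim (simp add: s_def \<epsilon>_def qh)
    ultimately show ?thesis by (rule Lim_transform_eventually)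
  qed
  have small: "\<forall>\<^sub>F h in at_right 0. X * s h < Y" if "Y > 0" for X Y
  proof -
    have "((\<lambda>h. X * s h) \<longlongrightarrow> X * 0) (at_right 0)" by (intro tendsto_mult tendsto_const s0)
    then show ?thesis using that by (intro order_tendstoD(2)) auto
  qed
  \<comment> \<open>\<open>1/2\<close> is the threshold for inverting the prestrain,
    \<open>d\<close> the radius in which \<open>W\<close> is bounded by the squared strain.\<close>
  have sm: "\<forall>\<^sub>F h in at_right 0. C3 * s h < 1/2" "\<forall>\<^sub>F h in at_right 0. (C2 * K) * s h < d"
    by (rule small, simp) (rule small, rule CW(2))
  have main: "\<forall>\<^sub>F h in at_right 0. inf_energy W \<omega> \<alpha> \<gamma> S B h \<le> ennreal (V * E h)"
    using h01 sm
  proof eventually_elim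
    case (elim h)
    have h: "h > 0" "h \<in> {0<..<1}" using elim(1) by auto
    show ?case
    proof (rule inf_energy_le[OF W dom(1) V(2)[OF h(1)] V(3)[OF h(1)] V(1) h(1)])
      fix x assume x: "x \<in> ?P h"
      show "(deformation h has_derivative (\<lambda>v. ?G h x *v v)) (at x)"
        by (rule deformation_derivative[OF h(2) x])
      show "norm (deformation h x) \<le> max C4 (norm (mat 1 :: real^3^3) + C5 * s h)"
        using C(5)[OF h(2) x] by simp
      have "norm (?G h x) \<le> norm (mat 1 :: real^3^3) + norm (?G h x - mat 1)"
        using norm_triangle_ineq[of "mat 1" "?G h x - mat 1"] by simp
      then show "norm (?G h x) \<le> max C4 (norm (mat 1 :: real^3^3) + C5 * s h)"
        using C(6)[OF h(2) x] by simp
      have half: "norm (A h x - mat 1) \<le> 1/2" using C(4)[OF h(2) x] elim(2) by simp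
      let ?F = "?G h x ** matrix_inv (A h x)"
      note rel = strain_relative_to_prestrain[OF half, of "?G h x", folded K_def]
      have "norm (?G h x - A h x) * K \<le> C2 * s h * K"
        using C(3)[OF h(2) x] K0 by (rule mult_right_mono)
      then have "norm (?F - mat 1) < d" using rel(1) elim(3) by (simp add: mult_ac)
      then have "W ?F \<le> CW * (norm (transpose ?F ** ?F - mat 1))\<^sup>2" by (rule CW(3))
      also have "\<dots> \<le> CW * (K * (C1 * r h) * K)\<^sup>2"
      proof (intro mult_left_mono power_mono)
        have "K * norm (transpose (?G h x) ** ?G h x - transpose (A h x) ** A h x) * K \<le> K * (C1 * r h) * K"
          using C(2)[OF h(2) x] K0 by (intro mult_right_mono mult_left_mono)
        then show "norm (transpose ?F ** ?F - mat 1) \<le> K * (C1 * r h) * K" using rel(2) by linarith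
      qed (use CW in auto)
      finally show "W (?G h x ** matrix_inv (prestrain \<alpha> \<gamma> S B h x)) \<le> E h"
        by (simp add: E_def A_def)
    qed (rule E0)
  qed
  let ?Z = "\<lambda>h. h powr (5 * \<alpha> / 6 + 2/3) + h powr (2 * \<alpha>) + h powr (2 + \<gamma>)"
  have rZ: "(r h)\<^sup>2 \<le> 8 * ?Z h" if h: "h \<in> {0<..<1}" for h
  proof -
    have sq: "(h powr t)\<^sup>2 = h powr (2 * t)" for t using h by (simp add: powr_power)
    have "e h * \<eta> h = h powr (\<alpha> / 2 + (4 - \<alpha>) / 12)" by (simp add: eh[OF h] \<eta>h[OF h] powr_add)
    also have "\<alpha> / 2 + (4 - \<alpha>) / 12 = 1/3 + 5 * \<alpha> / 12" by (simp add: field_simps)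
    finally have r: "r h = h powr (1/3 + 5 * \<alpha> / 12) + h powr \<alpha> + h powr (1/3 + 5 * \<alpha> / 12) + h powr (1 + \<gamma> / 2)"
      using sq[of "\<alpha> / 2"] by (simp add: r_def e0_def qh[OF h] eh[OF h])
    \<comment> \<open>The errors \<open>e * \<eta>\<close> and \<open>q\<close> are the same power
      of \<open>h\<close>, hence the repeated \<open>x\<close>.\<close>
    have four: "(x + y + x + z)\<^sup>2 \<le> 8 * (x\<^sup>2 + y\<^sup>2 + z\<^sup>2)" for x y z :: real
    proof -
      have "0 \<le> 2 * (x - y)\<^sup>2 + 2 * (x - z)\<^sup>2 + (y - z)\<^sup>2 + 4 * y\<^sup>2 + 4 * z\<^sup>2" by simp
      also have "\<dots> = 8 * (x\<^sup>2 + y\<^sup>2 + z\<^sup>2) - (x + y + x + z)\<^sup>2"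
        by (simp add: power2_eq_square algebra_simps)
      finally show ?thesis by simp
    qed
    have "(r h)\<^sup>2 \<le> 8 * ((h powr (1/3 + 5 * \<alpha> / 12))\<^sup>2 + (h powr \<alpha>)\<^sup>2 + (h powr (1 + \<gamma> / 2))\<^sup>2)"
      unfolding r by (rule four)
    also have "\<dots> = 8 * ?Z h" by (simp add: sq algebra_simps)
    finally show ?thesis .
  qed
  define Cf where "Cf = V * (CW * (K * C1 * K)\<^sup>2 * 8) + 1"
  have Cf: "Cf > 0" using V(1) CW(1) by (simp add: Cf_def add_nonneg_pos)
  have "\<forall>\<^sub>F h in at_right 0. inf_energy W \<omega> \<alpha> \<gamma> S B h \<le> ennreal (Cf * ?Z h)"
    using main h01
  proof eventually_elim
    case (elim h)
    have Z0: "0 \<le> ?Z h" by simp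
    have "E h = CW * (K * C1 * K)\<^sup>2 * (r h)\<^sup>2" by (simp add: E_def power_mult_distrib mult_ac)
    also have "\<dots> \<le> CW * (K * C1 * K)\<^sup>2 * (8 * ?Z h)"
      using rZ[OF elim(2)] CW(1) by (intro mult_left_mono) auto
    finally have "V * E h \<le> V * (CW * (K * C1 * K)\<^sup>2 * (8 * ?Z h))" using V(1) by (rule mult_left_mono)
    also have "\<dots> \<le> Cf * ?Z h" using Z0 by (simp add: Cf_def algebra_simps)
    finally show ?case using elim(1) by (meson ennreal_leI order_trans)
  qed
  then show thesis using that Cf by blast
qed

section \<open>Comparison of the exponents\<close>

lemma scaling_boundI:
  assumes "C > 0" "\<forall>\<^sub>F h in at_right 0. E h \<le> ennreal (C * (h powr a + h powr b + h powr c))"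
    and "\<beta> \<le> a" "\<beta> \<le> b" "\<beta> \<le> c"
  shows "scaling_bound E \<beta>"
proof -
  have h01: "\<forall>\<^sub>F h in at_right 0. h \<in> {0<..<1::real}"
    by (rule eventually_at_right_real) simp
  have "\<forall>\<^sub>F h in at_right 0. E h \<le> ennreal ((3 * C) * h powr \<beta>)"
    using assms(2) h01
  proof eventually_elim
    case (elim h)
    have "h powr a \<le> h powr \<beta>" "h powr b \<le> h powr \<beta>" "h powr c \<le> h powr \<beta>"
      using elim(2) assms(3-5) by (auto intro!: powr_mono')
    then have "h powr a + h powr b + h powr c \<le> 3 * h powr \<beta>" by linarith
    then have "C * (h powr a + h powr b + h powr c) \<le> C * (3 * h powr \<beta>)"
      using assms(1) by (intro mult_left_mono) auto
    then show ?case using elim(1) ennreal_leI order_trans by (metis (no_types, lifting) mult.assoc mult.commute)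
  qed
  then show ?thesis unfolding scaling_bound_def using assms(1) by (intro exI[of _ "3 * C"]) auto
qed

text \<open>With vanishing bending prestrain the energy does not see \<open>\<gamma>\<close>, which
  can then be exchanged for a value that makes the exponent \<open>2 + \<gamma>'\<close>
  harmless.\<close>

lemma inf_energy_no_bending:
  assumes "\<forall>x\<in>closure \<omega>. B x = 0"
  shows "inf_energy W \<omega> \<alpha> \<gamma> S B = inf_energy W \<omega> \<alpha> \<gamma>' S B"
proof -
  have "energy W \<omega> \<alpha> \<gamma> S B h u = energy W \<omega> \<alpha> \<gamma>' S B h u" for h u
    unfolding energy_def
  proof (intro arg_cong2[where f="(*)"] nn_integral_cong refl)
    fix x assume "x \<in> space (lebesgue_on (thin_plate \<omega> h))"
    then have "planar x \<in> closure \<omega>" using closure_subset by (auto simp: thin_plate_def space_restrict_space)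
    then show "ennreal (W (weak_gradient (thin_plate \<omega> h) u x ** matrix_inv (prestrain \<alpha> \<gamma> S B h x))) =
        ennreal (W (weak_gradient (thin_plate \<omega> h) u x ** matrix_inv (prestrain \<alpha> \<gamma>' S B h x)))"
      using assms(1) by (simp add: prestrain_def)
  qed
  then show ?thesis by (simp add: inf_energy_def fun_eq_iff)
qed

theorem theorem1p4:
  fixes \<omega> :: "(real^2) set"
    and S B :: "real^2 \<Rightarrow> real^3^3"
    and W :: "real^3^3 \<Rightarrow> real"
    and \<alpha> \<gamma> :: real
  assumes "open \<omega>" and "bounded \<omega>" and "simply_connected \<omega>" and "C11_boundary \<omega>"
    and "smooth_up_to (closure \<omega>) S" and "\<forall>x\<in>closure \<omega>. transpose (S x) = S x"
    and "smooth_up_to (closure \<omega>) B" and "\<forall>x\<in>closure \<omega>. transpose (B x) = B x"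
    and "admissible_density W"
    and "0 < \<alpha>" and "\<alpha> < 4" and "0 < \<gamma>"
  shows "(4/7 \<le> \<alpha> \<and> 5 * \<alpha> / 6 + 2/3 > 2 + \<gamma> \<longrightarrow>
            scaling_bound (inf_energy W \<omega> \<alpha> \<gamma> S B) (2 + \<gamma>))
       \<and> (4/7 \<le> \<alpha> \<and> 5 * \<alpha> / 6 + 2/3 \<le> 2 + \<gamma> \<longrightarrow>
            (\<forall>\<delta>. 0 < \<delta> \<and> \<delta> < 5 * \<alpha> / 6 + 2/3 \<longrightarrow>
               scaling_bound (inf_energy W \<omega> \<alpha> \<gamma> S B) \<delta>))
       \<and> (\<alpha> < 4/7 \<longrightarrow>
            scaling_bound (inf_energy W \<omega> \<alpha> \<gamma> S B) (2 * \<alpha>))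
       \<and> ((\<forall>x\<in>closure \<omega>. B x = 0) \<longrightarrow>
            (4/7 \<le> \<alpha> \<longrightarrow>
               (\<forall>\<delta>. 0 < \<delta> \<and> \<delta> < 5 * \<alpha> / 6 + 2/3 \<longrightarrow>
                  scaling_bound (inf_energy W \<omega> \<alpha> \<gamma> S B) \<delta>))
          \<and> (\<alpha> < 4/7 \<longrightarrow>
               scaling_bound (inf_energy W \<omega> \<alpha> \<gamma> S B) (2 * \<alpha>)))"
proof -
  note fin = energy_scaling[OF assms(1,2,5-9,10,11)]
  have bound: "scaling_bound (inf_energy W \<omega> \<alpha> \<gamma>' S B) \<beta>"
    if \<beta>: "0 < \<gamma>'" "\<beta> \<le> 5 * \<alpha> / 6 + 2/3" "\<beta> \<le> 2 * \<alpha>" "\<beta> \<le> 2 + \<gamma>'" for \<gamma>' \<beta>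
  proof -
    obtain C where "C > 0" "\<forall>\<^sub>F h in at_right 0. inf_energy W \<omega> \<alpha> \<gamma>' S B h
      \<le> ennreal (C * (h powr (5 * \<alpha> / 6 + 2/3) + h powr (2 * \<alpha>) + h powr (2 + \<gamma>')))"
      by (rule fin[OF \<beta>(1)])
    then show ?thesis using \<beta>(2-4) by (rule scaling_boundI)
  qed
  have flat: "scaling_bound (inf_energy W \<omega> \<alpha> \<gamma> S B) \<beta>"
    if "\<forall>x\<in>closure \<omega>. B x = 0" "\<beta> \<le> 5 * \<alpha> / 6 + 2/3" "\<beta> \<le> 2 * \<alpha>" for \<beta>
  proof -
    \<comment> \<open>The value \<open>2\<close> gives \<open>2 + \<gamma>' = 4\<close>, and
      \<open>5 * \<alpha> / 6 + 2/3 < 4\<close> is equivalent to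
      \<open>\<alpha> < 4\<close>.\<close>
    have "scaling_bound (inf_energy W \<omega> \<alpha> 2 S B) \<beta>"
      by (rule bound) (use that(2,3) assms(11) in simp_all)
    then show ?thesis using inf_energy_no_bending[OF that(1), of W \<alpha> \<gamma> S 2] by simp
  qed
  \<comment> \<open>The inequality \<open>5 * \<alpha> / 6 + 2/3 \<le> 2 * \<alpha>\<close> means
    \<open>4/7 \<le> \<alpha>\<close>. Below this value \<open>2 * \<alpha>\<close> is the smallest
    exponent: it is less than \<open>8/7\<close>, hence less than
    \<open>2 + \<gamma>\<close>.\<close>
  show ?thesis
  proof (intro conjI impI allI, goal_cases)
    case 1
    then show ?case using assms(10-12) by (intro bound) auto
  next
    case (2 \<delta>)
    then show ?case using assms(10-12) by (intro bound) auto
  next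
    case 3
    then show ?case using assms(10-12) by (intro bound) auto
  next
    case (4 \<delta>)
    then show ?case using assms(11) by (intro flat) auto
  next
    case 5
    then show ?case using assms(11) by (intro flat) auto
  qed
qed

end
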